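(* Let $(M,g,\nabla,\nabla^* )$ be a statistical manifold and $U\subset M$ a dually convex set. For $p,q\in U$ let $\sigma^*$ and $\sigma$ (parametrized by $[0,1]$) be the $\nabla^*$-geodesic and the $\nabla$-geodesic in $U$ with $\sigma^*(0)=p=\sigma(0)$ and $\sigma^*(1)=q=\sigma(1)$. Write $\varphi_p(q)=\varphi(p,q)$ and $\varphi^*_p(q)=\varphi^*(p,q)$ for the Phi-functions. Then $$\Pi_q(p)=\operatorname{grad}_q\varphi_p+V_q,\qquad V_q\in T_qM,\quad \langle V_q,\dot\sigma^*(1)\rangle_q=0,$$ $$\Pi^*_q(p)=\operatorname{grad}_q\varphi^*_p+V^*_q,\qquad V^*_q\in T_qM,\quad \langle V^*_q,\dot\sigma(1)\rangle_q=0 .$$ In addition, these decompositions are unique in $U$: for fixed $p\in U$, if $\psi:U\to\mathbb R$ is smooth and $W$ is a vector field on $U$ with $\Pi_q(p)=\operatorname{grad}_q\psi+W_q$ and $\langle W_q,\dot\sigma^*(1)\rangle_q=0$ for all $q\in U$ ($\sigma^*$ being the $\nabla^*$-geodesic from $p$ to $q$), then $\operatorname{grad}_q\psi=\operatorname{grad}_q\varphi_p$ and $W_q=V_q$ for all $q\in U$; and the analogous statement holds for the decomposition of $\Pi^*_q(p)$ (with $\sigma$ in place of $\sigma^*$, $\varphi^*_p$ in place of $\varphi_p$ and $V^*_q$ in place of $V_q$).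
   Context: Statistical manifold: $M$ is a smooth manifold, $g=\langle\cdot,\cdot\rangle$ a Riemannian metric, and $\nabla,\nabla^*$ are torsion-free affine connections on $TM$, dual with respect to $g$: $X g(Y,Z)=g(\nabla_XY,Z)+g(Y,\nabla^*_XZ)$ for all vector fields $X,Y,Z$. $\exp$ and $\exp^*$ denote the exponential maps of $\nabla$ and $\nabla^*$; $\operatorname{grad}_q$ is the Riemannian gradient at $q$. Dually convex set: $U\subset M$ such that for all $p,q\in U$ there are a unique $\nabla$-geodesic $\sigma:[0,1]\to U$ and a unique $\nabla^*$-geodesic $\sigma^*:[0,1]\to U$ with $\sigma(0)=\sigma^*(0)=p$, $\sigma(1)=\sigma^*(1)=q$. One writes $\exp_p^{-1}(q):=\dot\sigma(0)$ and $(\exp^*_p)^{-1}(q):=\dot\sigma^*(0)$. Standing convention: $U$ is open and for each $p\in U$ there is a neighbourhood $\mathcal E_p$ of $0$ in $T_pM$ on which $\exp_p$ and $\exp^*_p$ are diffeomorphisms onto images containing $U$, their inverses on $U$ being given respectively by the initial velocities $\dot\sigma(0)$ and $\dot\sigma^*(0)$ of the $\nabla$-geodesic $\sigma$ and the $\nabla^*$-geodesic $\sigma^*$ in $U$ from $p$ to $q$, which depend smoothly on $(p,q)\in U\times U$. Vectors $\Pi,\Pi^*$: for $p,q\in U$ with $\sigma,\sigma^*:[0,1]\to U$ the unique $\nabla$-geodesic and the unique $\nabla^*$-geodesic in $U$ from $p$ to $q$, $\Pi_q(p)\in T_qM$ is the $\nabla$-parallel transport of $\exp_p^{-1}(q)=\dot\sigma(0)$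 along the $\nabla^*$-geodesic $\sigma^*$ from $p$ to $q$, and $\Pi^*_q(p)\in T_qM$ is the $\nabla^*$-parallel transport of $(\exp^*_p)^{-1}(q)=\dot\sigma^*(0)$ along the $\nabla$-geodesic $\sigma$ from $p$ to $q$. Phi-functions: with $\sigma,\sigma^*$ the geodesics from $p$ to $q$, $$\varphi(p,q):=\int_0^1\langle \Pi_{\sigma^*(t)}(p),\dot\sigma^*(t)\rangle_{\sigma^*(t)}\,dt,\qquad \varphi^*(p,q):=\int_0^1\langle \Pi^*_{\sigma(t)}(p),\dot\sigma(t)\rangle_{\sigma(t)}\,dt .$$ *)

theory Defs
  imports "HOL-Analysis.Analysis" "HOL-Library.Function_Algebras"
begin

section \<open>Pointwise vector space structure on functions\<close>

instantiation "fun" :: (type, scaleR) scaleR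
begin
definition scaleR_fun_def: "r *\<^sub>R f = (\<lambda>x. r *\<^sub>R f x)"
instance ..
end

instance "fun" :: (type, real_vector) real_vector
  by standard (simp_all add: scaleR_fun_def fun_eq_iff algebra_simps)


section \<open>Smooth maps between Euclidean spaces\<close>

text \<open>\<open>Ck_on k f S\<close> is meant for open \<open>S\<close>: all iterated directional derivatives of \<open>f\<close> up to
  order \<open>k\<close> exist and are continuous on \<open>S\<close>.\<close>

primrec Ck_on :: "nat \<Rightarrow> ('b::euclidean_space \<Rightarrow> 'c::real_normed_vector) \<Rightarrow> 'b set \<Rightarrow> bool" where
  "Ck_on 0 f S \<longleftrightarrow> continuous_on S f"
| "Ck_on (Suc k) f S \<longleftrightarrow>
     f differentiable_on S \<and> (\<forall>v. Ck_on k (\<lambda>x. frechet_derivative f (at x) v) S)"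

text \<open>Smoothness on an arbitrary set: locally, \<open>f\<close> has a smooth extension to an open set.
  The only non-open sets to which this is applied are relatively open subsets of \<open>[0,1]\<close>.\<close>

definition smooth_on :: "('b::euclidean_space \<Rightarrow> 'c::real_normed_vector) \<Rightarrow> 'b set \<Rightarrow> bool" where
  "smooth_on f S \<longleftrightarrow>
     (\<forall>x\<in>S. \<exists>W h. open W \<and> x \<in> W \<and> (\<forall>k. Ck_on k h W) \<and> (\<forall>y\<in>W \<inter> S. f y = h y))"


section \<open>Smooth manifolds\<close>

text \<open>The manifold is the whole type \<open>'a\<close>, modelled on the Euclidean space \<open>'e\<close>.  A chart is a
  pair of a domain and a coordinate map, whose values off the domain are irrelevant.\<close>

type_synonym ('a, 'e) chart = "'a set \<times> ('a \<Rightarrow> 'e)"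

definition chart_inv :: "('a, 'e) chart \<Rightarrow> 'e \<Rightarrow> 'a" where
  "chart_inv c = inv_into (fst c) (snd c)"

definition is_chart :: "('a::topological_space, 'e::euclidean_space) chart \<Rightarrow> bool" where
  "is_chart c \<longleftrightarrow> open (fst c) \<and> open (snd c ` fst c) \<and>
     homeomorphism (fst c) (snd c ` fst c) (snd c) (chart_inv c)"

definition compatible :: "('a, 'e::euclidean_space) chart \<Rightarrow> ('a, 'e) chart \<Rightarrow> bool" where
  "compatible c d \<longleftrightarrow>
     smooth_on (snd d \<circ> chart_inv c) (snd c ` (fst c \<inter> fst d)) \<and>
     smooth_on (snd c \<circ> chart_inv d) (snd d ` (fst c \<inter> fst d))"

text \<open>\<open>A\<close> is a maximal smooth atlas.\<close>

definition smooth_manifold ::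
  "('a::{t2_space, second_countable_topology}, 'e::euclidean_space) chart set \<Rightarrow> bool" where
  "smooth_manifold A \<longleftrightarrow>
     (\<forall>c\<in>A. is_chart c) \<and> (\<Union>c\<in>A. fst c) = UNIV \<and> (\<forall>c\<in>A. \<forall>d\<in>A. compatible c d) \<and>
     (\<forall>c. is_chart c \<and> (\<forall>d\<in>A. compatible c d) \<longrightarrow> c \<in> A)"

text \<open>A tangent vector at \<open>x\<close> is the family of its coordinate vectors in all charts around \<open>x\<close>,
  related by the differentials of the coordinate changes (and \<open>0\<close> at all other charts).
  \<open>coord_vec A x c u\<close> is the tangent vector at \<open>x\<close> whose coordinate vector in the chart \<open>c\<close>
  around \<open>x\<close> is \<open>u\<close>.\<close>

type_synonym ('a, 'e) tvec = "('a, 'e) chart \<Rightarrow> 'e"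

definition coord_vec ::
  "('a, 'e::euclidean_space) chart set \<Rightarrow> 'a \<Rightarrow> ('a, 'e) chart \<Rightarrow> 'e \<Rightarrow> ('a, 'e) tvec" where
  "coord_vec A x c u =
     (\<lambda>d. if d \<in> A \<and> x \<in> fst d
          then frechet_derivative (snd d \<circ> chart_inv c) (at (snd c x)) u else 0)"

definition tangent_space ::
  "('a, 'e::euclidean_space) chart set \<Rightarrow> 'a \<Rightarrow> ('a, 'e) tvec set" where
  "tangent_space A x =
     {v. (\<forall>c. \<not> (c \<in> A \<and> x \<in> fst c) \<longrightarrow> v c = 0) \<and>
         (\<forall>c\<in>A. \<forall>d\<in>A. x \<in> fst c \<and> x \<in> fst d \<longrightarrow>
            v d = frechet_derivative (snd d \<circ> chart_inv c) (at (snd c x)) (v c))}"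

text \<open>Smooth real functions on an open set \<open>S\<close>.\<close>

definition smooth_fun ::
  "('a, 'e::euclidean_space) chart set \<Rightarrow> 'a set \<Rightarrow> ('a \<Rightarrow> real) \<Rightarrow> bool" where
  "smooth_fun A S f \<longleftrightarrow> (\<forall>c\<in>A. smooth_on (f \<circ> chart_inv c) (snd c ` (fst c \<inter> S)))"

definition differential ::
  "('a, 'e::euclidean_space) chart set \<Rightarrow> ('a \<Rightarrow> real) \<Rightarrow> 'a \<Rightarrow> ('a, 'e) tvec \<Rightarrow> real" where
  "differential A f x v =
     (let c = (SOME c. c \<in> A \<and> x \<in> fst c)
      in frechet_derivative (f \<circ> chart_inv c) (at (snd c x)) (v c))"

text \<open>Smooth vector fields on the manifold.\<close>

definition vector_fields :: "('a, 'e::euclidean_space) chart set \<Rightarrow> ('a \<Rightarrow> ('a, 'e) tvec) set" where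
  "vector_fields A =
     {X. (\<forall>x. X x \<in> tangent_space A x) \<and>
         (\<forall>c\<in>A. smooth_on (\<lambda>y. X (chart_inv c y) c) (snd c ` fst c))}"

definition lie_bracket ::
  "('a, 'e::euclidean_space) chart set \<Rightarrow> ('a \<Rightarrow> ('a, 'e) tvec) \<Rightarrow> ('a \<Rightarrow> ('a, 'e) tvec)
     \<Rightarrow> 'a \<Rightarrow> ('a, 'e) tvec" where
  "lie_bracket A X Y x =
     (\<lambda>c. if c \<in> A \<and> x \<in> fst c
          then frechet_derivative (\<lambda>y. Y (chart_inv c y) c) (at (snd c x)) (X x c)
             - frechet_derivative (\<lambda>y. X (chart_inv c y) c) (at (snd c x)) (Y x c)
          else 0)"


section \<open>Statistical manifolds\<close>

definition riemannian_metric ::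
  "('a, 'e::euclidean_space) chart set \<Rightarrow> ('a \<Rightarrow> ('a, 'e) tvec \<Rightarrow> ('a, 'e) tvec \<Rightarrow> real) \<Rightarrow> bool"
where
  "riemannian_metric A g \<longleftrightarrow>
     (\<forall>x. \<forall>u\<in>tangent_space A x. \<forall>v\<in>tangent_space A x. g x u v = g x v u) \<and>
     (\<forall>x. \<forall>u\<in>tangent_space A x. \<forall>v\<in>tangent_space A x. \<forall>w\<in>tangent_space A x.
        g x (u + v) w = g x u w + g x v w) \<and>
     (\<forall>x r. \<forall>u\<in>tangent_space A x. \<forall>v\<in>tangent_space A x. g x (r *\<^sub>R u) v = r * g x u v) \<and>
     (\<forall>x. \<forall>u\<in>tangent_space A x. u \<noteq> 0 \<longrightarrow> 0 < g x u u) \<and>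
     (\<forall>c\<in>A. \<forall>u v. smooth_on
        (\<lambda>y. g (chart_inv c y) (coord_vec A (chart_inv c y) c u) (coord_vec A (chart_inv c y) c v))
        (snd c ` fst c))"

type_synonym ('a, 'e) connection =
  "('a \<Rightarrow> ('a, 'e) tvec) \<Rightarrow> ('a \<Rightarrow> ('a, 'e) tvec) \<Rightarrow> 'a \<Rightarrow> ('a, 'e) tvec"

text \<open>\<open>nabla X Y\<close> is the covariant derivative of \<open>Y\<close> in the direction \<open>X\<close>, for global smooth
  vector fields \<open>X\<close> and \<open>Y\<close>.\<close>

definition affine_connection ::
  "('a, 'e::euclidean_space) chart set \<Rightarrow> ('a, 'e) connection \<Rightarrow> bool" where
  "affine_connection A nabla \<longleftrightarrow>
     (\<forall>X\<in>vector_fields A. \<forall>Y\<in>vector_fields A. nabla X Y \<in> vector_fields A) \<and>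
     (\<forall>X\<in>vector_fields A. \<forall>X'\<in>vector_fields A. \<forall>Y\<in>vector_fields A.
        nabla (X + X') Y = nabla X Y + nabla X' Y) \<and>
     (\<forall>X\<in>vector_fields A. \<forall>Y\<in>vector_fields A. \<forall>Y'\<in>vector_fields A.
        nabla X (Y + Y') = nabla X Y + nabla X Y') \<and>
     (\<forall>f. smooth_fun A UNIV f \<longrightarrow> (\<forall>X\<in>vector_fields A. \<forall>Y\<in>vector_fields A.
        nabla (\<lambda>x. f x *\<^sub>R X x) Y = (\<lambda>x. f x *\<^sub>R nabla X Y x) \<and>
        nabla X (\<lambda>x. f x *\<^sub>R Y x) =
          (\<lambda>x. differential A f x (X x) *\<^sub>R Y x + f x *\<^sub>R nabla X Y x)))"

definition torsion_free ::
  "('a, 'e::euclidean_space) chart set \<Rightarrow> ('a, 'e) connection \<Rightarrow> bool" where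
  "torsion_free A nabla \<longleftrightarrow>
     (\<forall>X\<in>vector_fields A. \<forall>Y\<in>vector_fields A. nabla X Y - nabla Y X = lie_bracket A X Y)"

definition dual_connections ::
  "('a, 'e::euclidean_space) chart set \<Rightarrow> ('a \<Rightarrow> ('a, 'e) tvec \<Rightarrow> ('a, 'e) tvec \<Rightarrow> real) \<Rightarrow>
     ('a, 'e) connection \<Rightarrow> ('a, 'e) connection \<Rightarrow> bool" where
  "dual_connections A g nabla nabla' \<longleftrightarrow>
     (\<forall>X\<in>vector_fields A. \<forall>Y\<in>vector_fields A. \<forall>Z\<in>vector_fields A. \<forall>x.
        differential A (\<lambda>y. g y (Y y) (Z y)) x (X x)
          = g x (nabla X Y x) (Z x) + g x (Y x) (nabla' X Z x))"

definition statistical_manifold ::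
  "('a::{t2_space, second_countable_topology}, 'e::euclidean_space) chart set \<Rightarrow>
     ('a \<Rightarrow> ('a, 'e) tvec \<Rightarrow> ('a, 'e) tvec \<Rightarrow> real) \<Rightarrow>
     ('a, 'e) connection \<Rightarrow> ('a, 'e) connection \<Rightarrow> bool" where
  "statistical_manifold A g nabla nabla' \<longleftrightarrow>
     smooth_manifold A \<and> riemannian_metric A g \<and>
     affine_connection A nabla \<and> torsion_free A nabla \<and>
     affine_connection A nabla' \<and> torsion_free A nabla' \<and>
     dual_connections A g nabla nabla'"

definition grad ::
  "('a, 'e::euclidean_space) chart set \<Rightarrow> ('a \<Rightarrow> ('a, 'e) tvec \<Rightarrow> ('a, 'e) tvec \<Rightarrow> real) \<Rightarrow>
     ('a \<Rightarrow> real) \<Rightarrow> 'a \<Rightarrow> ('a, 'e) tvec" where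
  "grad A g f x =
     (THE v. v \<in> tangent_space A x \<and> (\<forall>w\<in>tangent_space A x. g x v w = differential A f x w))"


section \<open>Geodesics, parallel transport and the exponential map\<close>

text \<open>All curves are parametrised by \<open>[0,1]\<close>; derivatives at the end points are one-sided.\<close>

definition smooth_curve ::
  "('a::topological_space, 'e::euclidean_space) chart set \<Rightarrow> (real \<Rightarrow> 'a) \<Rightarrow> bool" where
  "smooth_curve A \<gamma> \<longleftrightarrow>
     continuous_on {0..1} \<gamma> \<and> (\<forall>c\<in>A. smooth_on (snd c \<circ> \<gamma>) {t\<in>{0..1}. \<gamma> t \<in> fst c})"

definition velocity ::
  "('a, 'e::euclidean_space) chart set \<Rightarrow> (real \<Rightarrow> 'a) \<Rightarrow> real \<Rightarrow> ('a, 'e) tvec" where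
  "velocity A \<gamma> t =
     (\<lambda>c. if c \<in> A \<and> \<gamma> t \<in> fst c
          then vector_derivative (snd c \<circ> \<gamma>) (at t within {0..1}) else 0)"

text \<open>\<open>D\<close> is the covariant derivative at \<open>t\<close> of the field \<open>V\<close> along \<open>\<gamma>\<close>: writing
  \<open>V s = (\<Sum>i<n. f i s *\<^sub>R E i (\<gamma> s))\<close> for \<open>s\<close> near \<open>t\<close>, with vector fields \<open>E i\<close> on the manifold,
  it is given by the Leibniz rule, where \<open>\<nabla>\<close> in the direction of \<open>\<gamma>\<close> is taken
  with respect to a vector field \<open>X\<close> extending the velocity of \<open>\<gamma>\<close> at \<open>t\<close>.\<close>

definition has_covariant_derivative ::
  "('a, 'e::euclidean_space) chart set \<Rightarrow> ('a, 'e) connection \<Rightarrow> (real \<Rightarrow> 'a) \<Rightarrow>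
     (real \<Rightarrow> ('a, 'e) tvec) \<Rightarrow> real \<Rightarrow> ('a, 'e) tvec \<Rightarrow> bool" where
  "has_covariant_derivative A nabla \<gamma> V t D \<longleftrightarrow>
     (\<exists>(n::nat) E f f' X.
        (\<forall>i<n. E i \<in> vector_fields A) \<and>
        (\<forall>i<n. (f i has_real_derivative f' i) (at t within {0..1})) \<and>
        (\<exists>\<delta>>0. \<forall>s\<in>{0..1}. \<bar>s - t\<bar> < \<delta> \<longrightarrow> V s = (\<Sum>i<n. f i s *\<^sub>R E i (\<gamma> s))) \<and>
        X \<in> vector_fields A \<and> X (\<gamma> t) = velocity A \<gamma> t \<and>
        D = (\<Sum>i<n. f' i *\<^sub>R E i (\<gamma> t) + f i t *\<^sub>R nabla X (E i) (\<gamma> t)))"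

definition parallel_along ::
  "('a, 'e::euclidean_space) chart set \<Rightarrow> ('a, 'e) connection \<Rightarrow> (real \<Rightarrow> 'a) \<Rightarrow>
     (real \<Rightarrow> ('a, 'e) tvec) \<Rightarrow> bool" where
  "parallel_along A nabla \<gamma> V \<longleftrightarrow>
     (\<forall>t\<in>{0..1}. V t \<in> tangent_space A (\<gamma> t) \<and> has_covariant_derivative A nabla \<gamma> V t 0)"

definition parallel_transport ::
  "('a, 'e::euclidean_space) chart set \<Rightarrow> ('a, 'e) connection \<Rightarrow> (real \<Rightarrow> 'a) \<Rightarrow>
     ('a, 'e) tvec \<Rightarrow> ('a, 'e) tvec" where
  "parallel_transport A nabla \<gamma> v = (THE w. \<exists>V. parallel_along A nabla \<gamma> V \<and> V 0 = v \<and> V 1 = w)"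

definition geodesic ::
  "('a::topological_space, 'e::euclidean_space) chart set \<Rightarrow> ('a, 'e) connection \<Rightarrow>
     (real \<Rightarrow> 'a) \<Rightarrow> bool" where
  "geodesic A nabla \<gamma> \<longleftrightarrow> smooth_curve A \<gamma> \<and> parallel_along A nabla \<gamma> (velocity A \<gamma>)"

definition exp_dom ::
  "('a::topological_space, 'e::euclidean_space) chart set \<Rightarrow> ('a, 'e) connection \<Rightarrow>
     'a \<Rightarrow> ('a, 'e) tvec set" where
  "exp_dom A nabla p =
     {v\<in>tangent_space A p. \<exists>\<gamma>. geodesic A nabla \<gamma> \<and> \<gamma> 0 = p \<and> velocity A \<gamma> 0 = v}"

definition exp_map ::
  "('a::topological_space, 'e::euclidean_space) chart set \<Rightarrow> ('a, 'e) connection \<Rightarrow>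
     'a \<Rightarrow> ('a, 'e) tvec \<Rightarrow> 'a" where
  "exp_map A nabla p v =
     (THE q. \<exists>\<gamma>. geodesic A nabla \<gamma> \<and> \<gamma> 0 = p \<and> velocity A \<gamma> 0 = v \<and> \<gamma> 1 = q)"


section \<open>Dually convex sets\<close>

text \<open>Curves \<open>[0,1] \<rightarrow> U\<close> are taken extensional (undefined off \<open>[0,1]\<close>), so that uniqueness of the
  curve is equality of functions.\<close>

definition geodesic_from_to ::
  "('a::topological_space, 'e::euclidean_space) chart set \<Rightarrow> ('a, 'e) connection \<Rightarrow>
     'a set \<Rightarrow> 'a \<Rightarrow> 'a \<Rightarrow> (real \<Rightarrow> 'a) \<Rightarrow> bool" where
  "geodesic_from_to A nabla U p q \<sigma> \<longleftrightarrow>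
     \<sigma> \<in> {0..1} \<rightarrow>\<^sub>E U \<and> geodesic A nabla \<sigma> \<and> \<sigma> 0 = p \<and> \<sigma> 1 = q"

definition geodesic_between ::
  "('a::topological_space, 'e::euclidean_space) chart set \<Rightarrow> ('a, 'e) connection \<Rightarrow>
     'a set \<Rightarrow> 'a \<Rightarrow> 'a \<Rightarrow> real \<Rightarrow> 'a" where
  "geodesic_between A nabla U p q = (THE \<sigma>. geodesic_from_to A nabla U p q \<sigma>)"

text \<open>The initial velocity \<open>exp\<^sub>p\<^sup>-\<^sup>1(q)\<close> of the geodesic in \<open>U\<close> from \<open>p\<close> to \<open>q\<close>.\<close>

definition exp_inv ::
  "('a::topological_space, 'e::euclidean_space) chart set \<Rightarrow> ('a, 'e) connection \<Rightarrow>
     'a set \<Rightarrow> 'a \<Rightarrow> 'a \<Rightarrow> ('a, 'e) tvec" where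
  "exp_inv A nabla U p q = velocity A (geodesic_between A nabla U p q) 0"

text \<open>\<open>F\<close> restricts to a diffeomorphism from the open subset \<open>E\<close> of the tangent space at \<open>p\<close>
  onto an open subset of the manifold.  Topology and smooth structure of the tangent space are
  those of \<open>'e\<close> via the linear isomorphism \<open>v \<mapsto> v c\<close>, for any chart \<open>c\<close> around \<open>p\<close>.\<close>

definition tangent_diffeo ::
  "('a::topological_space, 'e::euclidean_space) chart set \<Rightarrow> 'a \<Rightarrow> ('a, 'e) tvec set \<Rightarrow>
     (('a, 'e) tvec \<Rightarrow> 'a) \<Rightarrow> bool" where
  "tangent_diffeo A p E F \<longleftrightarrow>
     E \<subseteq> tangent_space A p \<and> inj_on F E \<and> open (F ` E) \<and>
     (\<forall>c\<in>A. p \<in> fst c \<longrightarrow>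
        open ((\<lambda>v. v c) ` E) \<and>
        continuous_on ((\<lambda>v. v c) ` E) (\<lambda>u. F (coord_vec A p c u)) \<and>
        (\<forall>d\<in>A. smooth_on (\<lambda>u. snd d (F (coord_vec A p c u)))
                 {u \<in> (\<lambda>v. v c) ` E. F (coord_vec A p c u) \<in> fst d} \<and>
               smooth_on (\<lambda>y. inv_into E F (chart_inv d y) c) (snd d ` (fst d \<inter> F ` E))))"

definition exp_diffeo ::
  "('a::topological_space, 'e::euclidean_space) chart set \<Rightarrow> ('a, 'e) connection \<Rightarrow>
     'a set \<Rightarrow> 'a \<Rightarrow> ('a, 'e) tvec set \<Rightarrow> bool" where
  "exp_diffeo A nabla U p E \<longleftrightarrow>
     E \<subseteq> exp_dom A nabla p \<and> tangent_diffeo A p E (exp_map A nabla p) \<and>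
     U \<subseteq> exp_map A nabla p ` E \<and>
     (\<forall>q\<in>U. inv_into E (exp_map A nabla p) q = exp_inv A nabla U p q)"

text \<open>Smoothness of \<open>(p, q) \<mapsto> exp\<^sub>p\<^sup>-\<^sup>1(q)\<close> as a map from \<open>U \<times> U\<close> to the tangent bundle (the base
  point component being \<open>p\<close>).\<close>

definition exp_inv_smooth ::
  "('a::topological_space, 'e::euclidean_space) chart set \<Rightarrow> ('a, 'e) connection \<Rightarrow>
     'a set \<Rightarrow> bool" where
  "exp_inv_smooth A nabla U \<longleftrightarrow>
     (\<forall>c\<in>A. \<forall>d\<in>A. smooth_on
        (\<lambda>(x, y). exp_inv A nabla U (chart_inv c x) (chart_inv d y) c)
        ((snd c ` (fst c \<inter> U)) \<times> (snd d ` (fst d \<inter> U))))"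

definition dually_convex ::
  "('a::topological_space, 'e::euclidean_space) chart set \<Rightarrow> ('a, 'e) connection \<Rightarrow>
     ('a, 'e) connection \<Rightarrow> 'a set \<Rightarrow> bool" where
  "dually_convex A nabla nabla' U \<longleftrightarrow>
     open U \<and>
     (\<forall>p\<in>U. \<forall>q\<in>U. (\<exists>!\<sigma>. geodesic_from_to A nabla U p q \<sigma>) \<and>
                     (\<exists>!\<sigma>. geodesic_from_to A nabla' U p q \<sigma>)) \<and>
     (\<forall>p\<in>U. \<exists>E. 0 \<in> E \<and> exp_diffeo A nabla U p E \<and> exp_diffeo A nabla' U p E) \<and>
     exp_inv_smooth A nabla U \<and> exp_inv_smooth A nabla' U"


section \<open>The vectors \<open>\<Pi>\<close> and the Phi-functions\<close>

text \<open>\<open>Pi_vec A nabla nabla' U p q\<close> is \<open>\<Pi>\<^sub>q(p)\<close>; its dual \<open>\<Pi>\<^sup>*\<^sub>q(p)\<close> is \<open>Pi_vec A nabla' nabla U p q\<close>.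
  Likewise \<open>phi_fun\<close> yields \<open>\<phi>\<^sup>*\<close> when the two connections are exchanged.\<close>

definition Pi_vec ::
  "('a::topological_space, 'e::euclidean_space) chart set \<Rightarrow> ('a, 'e) connection \<Rightarrow>
     ('a, 'e) connection \<Rightarrow> 'a set \<Rightarrow> 'a \<Rightarrow> 'a \<Rightarrow> ('a, 'e) tvec" where
  "Pi_vec A nabla nabla' U p q =
     parallel_transport A nabla (geodesic_between A nabla' U p q) (exp_inv A nabla U p q)"

definition phi_fun ::
  "('a::topological_space, 'e::euclidean_space) chart set \<Rightarrow>
     ('a \<Rightarrow> ('a, 'e) tvec \<Rightarrow> ('a, 'e) tvec \<Rightarrow> real) \<Rightarrow> ('a, 'e) connection \<Rightarrow>
     ('a, 'e) connection \<Rightarrow> 'a set \<Rightarrow> 'a \<Rightarrow> 'a \<Rightarrow> real" where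
  "phi_fun A g nabla nabla' U p q =
     (let \<sigma> = geodesic_between A nabla' U p q
      in integral {0..1}
           (\<lambda>t. g (\<sigma> t) (Pi_vec A nabla nabla' U p (\<sigma> t)) (velocity A \<sigma> t)))"

end

theory Submission
  imports Defs
begin

text \<open>The exponential map of the starred connection at \<open>p\<close> provides a chart containing \<open>U\<close> in which the
  starred geodesic from \<open>p\<close> to the point with coordinates \<open>y\<close> is \<open>t \<mapsto> t *\<^sub>R y\<close>.  Duality makes the
  pairing of a parallel field with a field parallel for the dual connection constant, so
  \<open>\<langle>\<Pi>\<^sub>q(p), \<sigma>'(1)\<rangle>\<^sub>q = \<langle>exp\<^sub>p\<^sup>-\<^sup>1(q), \<sigma>'(0)\<rangle>\<^sub>p\<close> along the starred geodesic \<open>\<sigma>\<close>, and in that chart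
  \<open>\<phi>\<^sub>p(y) = \<integral>\<^sub>0\<^sup>1 B (G (t *\<^sub>R y)) y dt\<close> with \<open>B\<close> the metric at \<open>p\<close> and \<open>G\<close> the coordinates of
  \<open>exp\<^sub>p\<^sup>-\<^sup>1\<close>.  This is smooth in \<open>y\<close>, and its radial derivative is \<open>B (G y) y\<close>, which is the
  orthogonality claim.  Uniqueness holds because a function on a star-shaped set with vanishing
  radial derivative is constant.\<close>

section \<open>Calculus of smooth maps\<close>

text \<open>Connections act on global vector fields only, whereas every computation is local. Bump
  functions bridge this gap: they give the coordinate formula with Christoffel symbols, which turns
  parallel transport into a linear differential equation. Since the starred geodesics from
  \<open>p\<close> stay in one chart, the equation is solved on all of \<open>[0,1]\<close> at once.
  The vector at an intermediate point of a starred geodesic is defined with the geodesic from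
  \<open>p\<close> to that point. By uniqueness this is the original geodesic slowed down by
  \<open>t\<close>, so its initial and its final velocity both carry a factor \<open>t\<close>. The
  factor cancels for nonzero \<open>t\<close>, and the integrand becomes a pairing in the fixed
  tangent space at \<open>p\<close>, which can be differentiated under the integral sign. A
  substitution shows that \<phi> at s y is the integral of B (G (t y)) y over t from 0 to s, so the
  radial derivative comes from the fundamental theorem of calculus. The dual half follows by
  exchanging the connections.\<close>

lemma frechet_derivative_cong_open:
  assumes "open S" "x \<in> S" "\<And>y. y \<in> S \<Longrightarrow> f y = g y"
  shows "frechet_derivative f (at x) = frechet_derivative g (at x)"
proof -
  \<comment> \<open>\<open>frechet_derivative\<close> is a choice among all derivatives, so it is
    enough that both functions have the same ones, differentiable or not.\<close>
  have "(f has_derivative D) (at x) \<longleftrightarrow> (g has_derivative D) (at x)" for D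
    using has_derivative_transform_within_open[of f D x UNIV S g]
      has_derivative_transform_within_open[of g D x UNIV S f] assms by auto
  then show ?thesis
    by (simp add: frechet_derivative_def)
qed

lemma Ck_on_cong:
  assumes "open S" "\<And>x. x \<in> S \<Longrightarrow> f x = g x" "Ck_on k f S"
  shows "Ck_on k g S"
  using assms(2,3)
proof (induction k arbitrary: f g)
  case 0
  then show ?case using continuous_on_cong by fastforce
next
  case (Suc k)
  have "g differentiable_on S"
    unfolding differentiable_on_def
  proof
    fix x assume "x \<in> S"
    then show "g differentiable (at x within S)"
      using Suc.prems differentiable_transform_within[of f x S 1 g]
      by (simp add: differentiable_on_def)
  qed
  moreover have "Ck_on k (\<lambda>x. frechet_derivative g (at x) v) S" for v
  proof (rule Suc.IH)
    show "Ck_on k (\<lambda>x. frechet_derivative f (at x) v) S" using Suc.prems(2) by simp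
    show "frechet_derivative f (at x) v = frechet_derivative g (at x) v" if "x \<in> S" for x
      using frechet_derivative_cong_open[OF assms(1) that Suc.prems(1)] by simp
  qed
  ultimately show ?case by simp
qed

lemma Ck_on_subset: "Ck_on k f S \<Longrightarrow> T \<subseteq> S \<Longrightarrow> Ck_on k f T"
  by (induction k arbitrary: f) (auto intro: continuous_on_subset differentiable_on_subset)

lemma Ck_on_local:
  assumes "\<And>x. x \<in> S \<Longrightarrow> \<exists>W. open W \<and> x \<in> W \<and> Ck_on k f W"
  shows "Ck_on k f S"
  using assms
proof (induction k arbitrary: f)
  case 0
  then have "isCont f x" if "x \<in> S" for x
    using that by (metis Ck_on.simps(1) continuous_on_eq_continuous_at)
  then show ?case
    by (simp add: continuous_at_imp_continuous_on)
next
  case (Suc k)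
  have "f differentiable (at x)" if "x \<in> S" for x
    using Suc.prems[OF that] by (metis Ck_on.simps(2) differentiable_on_eq_differentiable_at)
  moreover have "Ck_on k (\<lambda>x. frechet_derivative f (at x) v) S" for v
    using Suc.prems by (intro Suc.IH) (metis Ck_on.simps(2))
  ultimately show ?case
    by (simp add: differentiable_at_imp_differentiable_on)
qed

lemma Ck_on_SucD: "Ck_on (Suc k) f S \<Longrightarrow> Ck_on k f S"
proof (induction k arbitrary: f)
  case 0
  then show ?case by (simp add: differentiable_imp_continuous_on)
next
  case (Suc k)
  then show ?case by (metis Ck_on.simps(2))
qed

lemma Ck_on_const: "Ck_on k (\<lambda>x. c) S"
  by (induction k arbitrary: c) (auto simp: frechet_derivative_const)

lemma Ck_on_bounded_linear:
  assumes "bounded_linear L" shows "Ck_on k L S"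
proof (cases k)
  case 0
  then show ?thesis using assms by (simp add: linear_continuous_on)
next
  case (Suc l)
  have "frechet_derivative L (at x) = L" for x
    using bounded_linear_imp_has_derivative[OF assms] frechet_derivative_at by metis
  then show ?thesis
    using Suc assms by (simp add: Ck_on_const bounded_linear_imp_differentiable_on)
qed

lemma Ck_on_add:
  assumes "open S" "Ck_on k f S" "Ck_on k g S"
  shows "Ck_on k (\<lambda>x. f x + g x) S"
  using assms(2,3)
proof (induction k arbitrary: f g)
  case 0
  then show ?case by (auto intro: continuous_on_add)
next
  case (Suc k)
  have d: "f differentiable (at x)" "g differentiable (at x)" if "x \<in> S" for x
    using Suc.prems that assms(1) by (auto simp: differentiable_on_eq_differentiable_at)
  have "Ck_on k (\<lambda>x. frechet_derivative (\<lambda>x. f x + g x) (at x) v) S" for v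
  proof (rule Ck_on_cong[OF assms(1)])
    show "Ck_on k (\<lambda>x. frechet_derivative f (at x) v + frechet_derivative g (at x) v) S"
      using Suc.prems by (intro Suc.IH) auto
    show "frechet_derivative f (at x) v + frechet_derivative g (at x) v =
        frechet_derivative (\<lambda>x. f x + g x) (at x) v" if "x \<in> S" for x
      using frechet_derivative_at[OF has_derivative_add[OF
          d[OF that, unfolded frechet_derivative_works]]] by metis
  qed
  then show ?case using Suc.prems by (simp add: differentiable_on_add)
qed

text \<open>One Leibniz induction serves scalar multiples, products and inner products; the
  undifferentiated factors are brought to the lower order by \<open>Ck_on_SucD\<close>.\<close>

lemma Ck_on_bilinear:
  assumes bil: "bounded_bilinear pr" and "open S" "Ck_on k f S" "Ck_on k g S"
  shows "Ck_on k (\<lambda>x. pr (f x) (g x)) S"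
  using assms(3,4)
proof (induction k arbitrary: f g)
  case 0
  then show ?case by (auto intro: bounded_bilinear.continuous_on[OF bil])
next
  case (Suc k)
  have d: "f differentiable (at x)" "g differentiable (at x)" if "x \<in> S" for x
    using Suc.prems that assms(2) by (auto simp: differentiable_on_eq_differentiable_at)
  have D: "((\<lambda>x. pr (f x) (g x)) has_derivative
      (\<lambda>v. pr (f x) (frechet_derivative g (at x) v) + pr (frechet_derivative f (at x) v) (g x))) (at x)"
    if "x \<in> S" for x
    using d[OF that] by (intro bounded_bilinear.FDERIV[OF bil]) (simp_all add: frechet_derivative_works)
  have "Ck_on k (\<lambda>x. frechet_derivative (\<lambda>x. pr (f x) (g x)) (at x) v) S" for v
  proof (rule Ck_on_cong[OF assms(2)])
    have "Ck_on k f S" "Ck_on k g S" using Suc.prems Ck_on_SucD by blast+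
    then show "Ck_on k (\<lambda>x. pr (f x) (frechet_derivative g (at x) v)
        + pr (frechet_derivative f (at x) v) (g x)) S"
      using Suc.prems by (intro Ck_on_add[OF assms(2)] Suc.IH) auto
    show "pr (f x) (frechet_derivative g (at x) v) + pr (frechet_derivative f (at x) v) (g x) =
        frechet_derivative (\<lambda>x. pr (f x) (g x)) (at x) v" if "x \<in> S" for x
      by (simp add: frechet_derivative_at[OF D[OF that], symmetric])
  qed
  moreover have "(\<lambda>x. pr (f x) (g x)) differentiable_on S"
    using D by (meson differentiable_at_imp_differentiable_on differentiable_def)
  ultimately show ?case by simp
qed

lemmas Ck_on_scaleR = Ck_on_bilinear[OF bounded_bilinear_scaleR]
lemmas Ck_on_mult = Ck_on_bilinear[OF bounded_bilinear_mult]

lemma Ck_on_sum: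
  assumes "open S" "\<And>i. i \<in> I \<Longrightarrow> Ck_on k (f i) S"
  shows "Ck_on k (\<lambda>x. \<Sum>i\<in>I. f i x) S"
  using assms(2)
  by (induction I rule: infinite_finite_induct) (auto simp: Ck_on_const intro!: Ck_on_add[OF assms(1)])

lemma Ck_on_bounded_linear_comp:
  assumes "bounded_linear L" "open S" "Ck_on k f S"
  shows "Ck_on k (\<lambda>x. L (f x)) S"
proof -
  interpret L: bounded_linear L by fact
  show ?thesis
    using assms(3)
  proof (induction k arbitrary: f)
    case 0
    then show ?case by (auto intro: L.continuous_on)
  next
    case (Suc k)
    have D: "((\<lambda>x. L (f x)) has_derivative (\<lambda>v. L (frechet_derivative f (at x) v))) (at x)"
      if "x \<in> S" for x
      using Suc.prems that assms(2)
      by (intro L.has_derivative)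
         (simp add: differentiable_on_eq_differentiable_at frechet_derivative_works)
    have "Ck_on k (\<lambda>x. frechet_derivative (\<lambda>x. L (f x)) (at x) v) S" for v
    proof (rule Ck_on_cong[OF assms(2)])
      show "Ck_on k (\<lambda>x. L (frechet_derivative f (at x) v)) S"
        using Suc.prems by (intro Suc.IH) auto
      show "L (frechet_derivative f (at x) v) = frechet_derivative (\<lambda>x. L (f x)) (at x) v"
        if "x \<in> S" for x
        by (simp add: frechet_derivative_at[OF D[OF that], symmetric])
    qed
    moreover have "(\<lambda>x. L (f x)) differentiable_on S"
      using D by (meson differentiable_at_imp_differentiable_on differentiable_def)
    ultimately show ?case by simp
  qed
qed

lemma linear_euclidean_expansion:
  fixes L :: "'b::euclidean_space \<Rightarrow> 'c::real_vector"
  assumes "linear L" shows "L v = (\<Sum>b\<in>Basis. (v \<bullet> b) *\<^sub>R L b)"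
proof -
  have "L v = L (\<Sum>b\<in>Basis. (v \<bullet> b) *\<^sub>R b)" by (simp add: euclidean_representation)
  also have "\<dots> = (\<Sum>b\<in>Basis. (v \<bullet> b) *\<^sub>R L b)"
    by (simp add: linear_sum[OF assms] linear_cmul[OF assms])
  finally show ?thesis .
qed

lemma linear_frechet_derivative:
  assumes "f differentiable (at x)" shows "linear (frechet_derivative f (at x))"
  using assms frechet_derivative_works has_derivative_linear by blast

lemma Ck_on_compose:
  fixes f :: "'b::euclidean_space \<Rightarrow> 'c::euclidean_space"
    and h :: "'c \<Rightarrow> 'd::real_normed_vector"
  assumes "open S" "open T" "f ` S \<subseteq> T" "Ck_on k f S" "Ck_on k h T"
  shows "Ck_on k (\<lambda>x. h (f x)) S"
  using assms(4,5)
proof (induction k arbitrary: h)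
  case 0
  then show ?case
    using assms(3) continuous_on_compose2 by auto
next
  case (Suc k)
  have df: "f differentiable (at x)" if "x \<in> S" for x
    using Suc.prems that assms(1) by (auto simp: differentiable_on_eq_differentiable_at)
  have dh: "h differentiable (at (f x))" if "x \<in> S" for x
    using Suc.prems that assms(2,3) by (auto simp: differentiable_on_eq_differentiable_at)
  have D: "((\<lambda>x. h (f x)) has_derivative
      (\<lambda>v. frechet_derivative h (at (f x)) (frechet_derivative f (at x) v))) (at x)"
    if "x \<in> S" for x
    using df[OF that] dh[OF that]
    by (intro has_derivative_compose[of f _ x UNIV h])
       (simp_all add: frechet_derivative_works)
  have fk: "Ck_on k f S" using Suc.prems Ck_on_SucD by blast
  have "Ck_on k (\<lambda>x. frechet_derivative (\<lambda>x. h (f x)) (at x) v) S" for v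
  proof (rule Ck_on_cong[OF assms(1)])
    \<comment> \<open>The chain rule applies the derivative of \<open>h\<close> to a direction that
      varies with \<open>x\<close>. Expanding it over the basis leaves fixed directions, to which
      the induction hypothesis applies.\<close>
    show "Ck_on k (\<lambda>x. \<Sum>b\<in>Basis. (frechet_derivative f (at x) v \<bullet> b) *\<^sub>R
        frechet_derivative h (at (f x)) b) S"
      using Suc.prems fk
      by (intro Ck_on_sum Ck_on_scaleR Ck_on_bounded_linear_comp[OF bounded_linear_inner_left]
            Suc.IH assms(1)) auto
    show "(\<Sum>b\<in>Basis. (frechet_derivative f (at x) v \<bullet> b) *\<^sub>R frechet_derivative h (at (f x)) b)
        = frechet_derivative (\<lambda>x. h (f x)) (at x) v" if "x \<in> S" for x
      unfolding frechet_derivative_at[OF D[OF that], symmetric]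
      by (rule linear_euclidean_expansion[OF linear_frechet_derivative[OF dh[OF that]], symmetric])
  qed
  moreover have "(\<lambda>x. h (f x)) differentiable_on S"
    using D by (meson differentiable_at_imp_differentiable_on differentiable_def)
  ultimately show ?case by simp
qed

section \<open>Smoothness on sets that need not be open\<close>

lemma smooth_on_open_iff:
  assumes "open S" shows "smooth_on f S \<longleftrightarrow> (\<forall>k. Ck_on k f S)"
proof
  assume s: "smooth_on f S"
  show "\<forall>k. Ck_on k f S"
  proof (intro allI Ck_on_local)
    fix k x assume "x \<in> S"
    then obtain W h where W: "open W" "x \<in> W" "\<forall>k. Ck_on k h W" "\<forall>y\<in>W \<inter> S. f y = h y"
      using s unfolding smooth_on_def by meson
    \<comment> \<open>On this open set the local extension coincides with \<open>f\<close>, so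
      \<open>f\<close> inherits its derivatives.\<close>
    then have "Ck_on k f (W \<inter> S)"
      using assms Ck_on_subset[of k h W "W \<inter> S"] by (intro Ck_on_cong[of "W \<inter> S" h f]) auto
    then show "\<exists>W. open W \<and> x \<in> W \<and> Ck_on k f W"
      using W \<open>x \<in> S\<close> assms by (intro exI[of _ "W \<inter> S"]) auto
  qed
next
  assume "\<forall>k. Ck_on k f S"
  then show "smooth_on f S" using assms unfolding smooth_on_def by blast
qed

lemma smooth_onE:
  assumes "smooth_on f S" "x \<in> S"
  obtains W h where "open W" "x \<in> W" "\<And>k. Ck_on k h W" "\<And>y. y \<in> W \<Longrightarrow> y \<in> S \<Longrightarrow> f y = h y"
  using assms unfolding smooth_on_def by (meson IntI)

lemma smooth_on_cong:
  assumes "\<And>x. x \<in> S \<Longrightarrow> f x = g x" "smooth_on f S" shows "smooth_on g S"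
  using assms unfolding smooth_on_def by (metis IntD2)

lemma smooth_on_subset: "smooth_on f S \<Longrightarrow> T \<subseteq> S \<Longrightarrow> smooth_on f T"
  unfolding smooth_on_def by (meson Int_mono order_refl subsetD)

lemma smooth_on_local:
  assumes "\<And>x. x \<in> S \<Longrightarrow> \<exists>W. open W \<and> x \<in> W \<and> smooth_on f (W \<inter> S)"
  shows "smooth_on f S"
  unfolding smooth_on_def
proof
  fix x assume "x \<in> S"
  then obtain W where W: "open W" "x \<in> W" "smooth_on f (W \<inter> S)" using assms by blast
  then obtain W' h where "open W'" "x \<in> W'" "\<forall>k. Ck_on k h W'" "\<forall>y\<in>W' \<inter> (W \<inter> S). f y = h y"
    using \<open>x \<in> S\<close> unfolding smooth_on_def by (meson IntI)
  then show "\<exists>W h. open W \<and> x \<in> W \<and> (\<forall>k. Ck_on k h W) \<and> (\<forall>y\<in>W \<inter> S. f y = h y)"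
    using W by (intro exI[of _ "W \<inter> W'"] exI[of _ h]) (auto intro: Ck_on_subset)
qed

lemma smooth_on_const: "smooth_on (\<lambda>x. c) S"
  unfolding smooth_on_def using Ck_on_const open_UNIV by blast

lemma smooth_on_bounded_linear: "bounded_linear L \<Longrightarrow> smooth_on L S"
  unfolding smooth_on_def using Ck_on_bounded_linear open_UNIV by blast

lemma smooth_on_id: "smooth_on (\<lambda>x. x) S"
  by (intro smooth_on_bounded_linear bounded_linear_ident)

lemma smooth_on_add:
  "open S \<Longrightarrow> smooth_on f S \<Longrightarrow> smooth_on g S \<Longrightarrow> smooth_on (\<lambda>x. f x + g x) S"
  by (simp add: smooth_on_open_iff Ck_on_add)

lemma smooth_on_scaleR:
  "open S \<Longrightarrow> smooth_on f S \<Longrightarrow> smooth_on g S \<Longrightarrow> smooth_on (\<lambda>x. f x *\<^sub>R g x) S"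
  by (simp add: smooth_on_open_iff Ck_on_scaleR)

lemma smooth_on_mult:
  fixes f g :: "'b::euclidean_space \<Rightarrow> real"
  shows "open S \<Longrightarrow> smooth_on f S \<Longrightarrow> smooth_on g S \<Longrightarrow> smooth_on (\<lambda>x. f x * g x) S"
  by (simp add: smooth_on_open_iff Ck_on_mult)

lemma smooth_on_sum:
  "open S \<Longrightarrow> (\<And>i. i \<in> I \<Longrightarrow> smooth_on (f i) S) \<Longrightarrow> smooth_on (\<lambda>x. \<Sum>i\<in>I. f i x) S"
  by (simp add: smooth_on_open_iff Ck_on_sum)

lemma smooth_on_bounded_linear_comp:
  "bounded_linear L \<Longrightarrow> open S \<Longrightarrow> smooth_on f S \<Longrightarrow> smooth_on (\<lambda>x. L (f x)) S"
  by (simp add: smooth_on_open_iff Ck_on_bounded_linear_comp)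

lemma smooth_on_inner:
  "open S \<Longrightarrow> smooth_on f S \<Longrightarrow> smooth_on (\<lambda>x. f x \<bullet> b) S"
  by (rule smooth_on_bounded_linear_comp[OF bounded_linear_inner_left])

lemma smooth_on_compose_open:
  fixes f :: "'b::euclidean_space \<Rightarrow> 'c::euclidean_space"
    and h :: "'c \<Rightarrow> 'd::real_normed_vector"
  assumes "open S" "open T" "f ` S \<subseteq> T" "smooth_on f S" "smooth_on h T"
  shows "smooth_on (\<lambda>x. h (f x)) S"
  using assms by (simp add: smooth_on_open_iff Ck_on_compose)

lemma smooth_on_differentiable:
  assumes "open S" "smooth_on f S" "x \<in> S" shows "f differentiable (at x)"
proof -
  have "Ck_on (Suc 0) f S" using assms smooth_on_open_iff by blast
  then show ?thesis using assms by (auto simp: differentiable_on_eq_differentiable_at)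
qed

lemma smooth_on_imp_continuous_on:
  assumes "smooth_on f S" shows "continuous_on S f"
  unfolding continuous_on_eq_continuous_within
proof
  fix x assume "x \<in> S"
  then obtain W h where W: "open W" "x \<in> W" "\<forall>k. Ck_on k h W" "\<forall>y\<in>W \<inter> S. f y = h y"
    using assms unfolding smooth_on_def by meson
  then have "continuous_on W h" by (metis Ck_on.simps(1))
  then have "continuous (at x within S) h"
    using W by (simp add: continuous_at_imp_continuous_at_within continuous_on_eq_continuous_at)
  moreover obtain e where "e > 0" "ball x e \<subseteq> W" using W(1,2) open_contains_ball by blast
  ultimately show "continuous (at x within S) f"
    using W(4) \<open>x \<in> S\<close>
    by (intro continuous_transform_within[of x S h e f]) (auto simp: dist_commute subset_iff)
qed

lemma smooth_on_frechet_derivative: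
  assumes "open S" "smooth_on f S" shows "smooth_on (\<lambda>x. frechet_derivative f (at x) v) S"
  using assms by (metis Ck_on.simps(2) smooth_on_open_iff)

text \<open>Base point and direction both vary, as when the Jacobian of a coordinate change acts on
  a vector field; the basis expansion reduces this to fixed directions.\<close>

lemma smooth_on_frechet_derivative_apply:
  fixes f :: "'b::euclidean_space \<Rightarrow> 'd::real_normed_vector"
    and h :: "'c::euclidean_space \<Rightarrow> 'b"
  assumes "open S" "open T" "h ` T \<subseteq> S" "smooth_on f S" "smooth_on h T" "smooth_on w T"
  shows "smooth_on (\<lambda>x. frechet_derivative f (at (h x)) (w x)) T"
proof (rule smooth_on_cong)
  show "smooth_on (\<lambda>x. \<Sum>b\<in>Basis. (w x \<bullet> b) *\<^sub>R frechet_derivative f (at (h x)) b) T"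
    using assms
    by (intro smooth_on_sum smooth_on_scaleR smooth_on_inner
          smooth_on_compose_open[of T S h "\<lambda>y. frechet_derivative f (at y) _"]
          smooth_on_frechet_derivative) auto
  fix x assume "x \<in> T"
  then have "f differentiable (at (h x))" using smooth_on_differentiable assms by blast
  then show "(\<Sum>b\<in>Basis. (w x \<bullet> b) *\<^sub>R frechet_derivative f (at (h x)) b) =
      frechet_derivative f (at (h x)) (w x)"
    using linear_euclidean_expansion linear_frechet_derivative by metis
qed

text \<open>Meant for the time change by a factor \<open>r\<close> on relatively open subsets of
  \<open>[0,1]\<close>: local extensions of \<open>h\<close> are pulled back along
  \<open>L\<close>.\<close>

lemma smooth_on_compose_linear:
  fixes L :: "'b::euclidean_space \<Rightarrow> 'c::euclidean_space"
  assumes "bounded_linear L" "L ` T \<subseteq> S" "smooth_on h S"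
  shows "smooth_on (\<lambda>x. h (L x)) T"
  unfolding smooth_on_def
proof
  fix x assume "x \<in> T"
  then have "L x \<in> S" using assms(2) by blast
  then obtain W g where W: "open W" "L x \<in> W" "\<And>k. Ck_on k g W"
      "\<And>y. y \<in> W \<Longrightarrow> y \<in> S \<Longrightarrow> h y = g y"
    using smooth_onE[OF assms(3)] by metis
  have o: "open (L -` W)"
    using W(1) linear_continuous_on[OF assms(1)] by (simp add: open_vimage)
  have "Ck_on k (\<lambda>x. g (L x)) (L -` W)" for k
    using Ck_on_compose[OF o W(1) _ Ck_on_bounded_linear[OF assms(1)] W(3)] by auto
  then show "\<exists>V g. open V \<and> x \<in> V \<and> (\<forall>k. Ck_on k g V) \<and> (\<forall>y\<in>V \<inter> T. h (L y) = g y)"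
    using W o assms(2) by (intro exI[of _ "L -` W"] exI[of _ "\<lambda>x. g (L x)"]) auto
qed

section \<open>Bump functions\<close>

text \<open>For \<open>p = 1\<close> this is the classical flat function exp(-1/x), extended by 0.
  The polynomial in 1/x makes the family closed under differentiation, so that a single induction
  gives smoothness.\<close>

definition flat :: "real poly \<Rightarrow> real \<Rightarrow> real" where
  "flat p x = (if x \<le> 0 then 0 else poly p (inverse x) * exp (- inverse x))"

lemma poly_times_exp_tendsto_0: "((\<lambda>y::real. poly p y * exp (- y)) \<longlongrightarrow> 0) at_top"
proof -
  have "((\<lambda>y::real. \<Sum>i\<le>degree p. coeff p i * (y ^ i / exp y)) \<longlongrightarrow>
      (\<Sum>i\<le>degree p. coeff p i * 0)) at_top"
    by (intro tendsto_intros tendsto_power_div_exp_0)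
  then show ?thesis
    by (simp add: poly_altdef exp_minus sum_distrib_right divide_inverse mult.assoc)
qed

text \<open>With y = 1/x, the derivative of p(y) exp(-y) with respect to x is y^2 (p(y) - p'(y))
  exp(-y), and \<open>[:0,0,1:]\<close> stands for y^2.\<close>

lemma flat_has_derivative:
  "(flat p has_real_derivative flat ([:0,0,1:] * (p - pderiv p)) x) (at x)"
proof -
  consider "x < 0" | "x > 0" | "x = 0" by linarith
  then show ?thesis
  proof cases
    case 1
    have "(flat p has_real_derivative 0) (at x)"
      by (rule has_field_derivative_transform_within_open[of "\<lambda>_. 0" _ _ "{..<0}"])
         (use 1 in \<open>auto simp: flat_def\<close>)
    then show ?thesis using 1 by (simp add: flat_def)
  next
    case 2
    have "((\<lambda>x. poly p (inverse x) * exp (- inverse x)) has_real_derivative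
        flat ([:0,0,1:] * (p - pderiv p)) x) (at x)"
      using 2 by (auto intro!: derivative_eq_intros DERIV_chain2[of "poly p"] poly_DERIV
            simp: flat_def power2_eq_square) (simp add: algebra_simps)
    then show ?thesis
      by (rule has_field_derivative_transform_within_open[of _ _ _ "{0<..}"])
         (use 2 in \<open>auto simp: flat_def\<close>)
  next
    case 3
    have "((\<lambda>h. flat p h / h) \<longlongrightarrow> 0) (at_right 0)"
    proof -
      \<comment> \<open>Dividing by \<open>h\<close> multiplies the polynomial in 1/h by its
        variable, hence \<open>[:0,1:]\<close>.\<close>
      have "((\<lambda>h. poly ([:0,1:] * p) (inverse h) * exp (- inverse h)) \<longlongrightarrow> 0) (at_right (0::real))"
        by (rule filterlim_compose[OF poly_times_exp_tendsto_0 filterlim_inverse_at_top_right])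
      moreover have "\<forall>\<^sub>F h in at_right (0::real).
          poly ([:0,1:] * p) (inverse h) * exp (- inverse h) = flat p h / h"
        unfolding eventually_at_right[OF zero_less_one]
        by (intro exI[of _ 1]) (auto simp: flat_def field_simps)
      ultimately show ?thesis using tendsto_cong by fast
    qed
    moreover have "((\<lambda>h. flat p h / h) \<longlongrightarrow> 0) (at_left 0)"
      by (rule tendsto_eventually) (auto simp: eventually_at_left[of "-1"] flat_def intro!: exI[of _ "-1"])
    ultimately have "((\<lambda>h. flat p h / h) \<longlongrightarrow> 0) (at 0)"
      using filterlim_at_split by blast
    then show ?thesis using 3 by (simp add: has_field_derivative_iff flat_def)
  qed
qed

lemma Ck_on_flat: "Ck_on k (flat p) UNIV"
proof (induction k arbitrary: p)
  case 0
  then show ?case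
    by (auto intro!: continuous_at_imp_continuous_on DERIV_isCont[OF flat_has_derivative])
next
  case (Suc k)
  have "frechet_derivative (flat p) (at x) v = flat ([:0,0,1:] * (p - pderiv p)) x * v" for x v
    using frechet_derivative_at[OF flat_has_derivative[of p x, unfolded has_field_derivative_def]]
    by metis
  then have "(\<lambda>x. frechet_derivative (flat p) (at x) v) = (\<lambda>x. flat ([:0,0,1:] * (p - pderiv p)) x * v)"
    for v by blast
  moreover have "Ck_on k (\<lambda>x. flat q x * v) UNIV" for q v
    by (rule Ck_on_mult[OF open_UNIV Suc Ck_on_const])
  moreover have "flat p differentiable_on UNIV"
    using flat_has_derivative
    by (meson differentiable_at_imp_differentiable_on real_differentiable_def)
  ultimately show ?case by simp
qed

text \<open>\<open>flat 1\<close> is applied twice. On the small ball \<open>u\<close> is at most 0,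
  so \<open>w\<close> is 1; off the large ball \<open>u\<close> is at least 1, so \<open>w\<close>
  is at most 0, and the outer application turns this into the exact value 0. The factors
  \<open>exp 1\<close> normalise \<open>flat 1 1\<close> to 1.\<close>

lemma bump_function_euclidean:
  fixes x0 :: "'b::euclidean_space"
  assumes "r > 0"
  obtains b :: "'b \<Rightarrow> real" where "smooth_on b UNIV" "\<And>y. y \<in> ball x0 r \<Longrightarrow> b y = 1"
    "\<And>y. y \<notin> ball x0 (2 * r) \<Longrightarrow> b y = 0"
proof -
  define u where "u = (\<lambda>y::'b. (y - x0) \<bullet> (y - x0) * inverse (r^2) + (- 1))"
  define w where "w = (\<lambda>y. 1 + (- exp 1) * flat 1 (u y))"
  define b where "b = (\<lambda>y. exp 1 * flat 1 (w y))"
  have lin: "Ck_on k (\<lambda>y::'b. y - x0) UNIV" for k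
    using Ck_on_add[OF open_UNIV Ck_on_bounded_linear[OF bounded_linear_ident] Ck_on_const[of k "- x0"]]
    by simp
  have u: "Ck_on k u UNIV" for k
    unfolding u_def
    by (intro Ck_on_add Ck_on_mult Ck_on_const open_UNIV Ck_on_bilinear[OF bounded_bilinear_inner] lin)
  have w: "Ck_on k w UNIV" for k
    unfolding w_def
    by (rule Ck_on_add[OF open_UNIV Ck_on_const Ck_on_mult[OF open_UNIV Ck_on_const
          Ck_on_compose[OF open_UNIV open_UNIV subset_UNIV u Ck_on_flat]]])
  have "Ck_on k b UNIV" for k
    unfolding b_def
    by (rule Ck_on_mult[OF open_UNIV Ck_on_const
          Ck_on_compose[OF open_UNIV open_UNIV subset_UNIV w Ck_on_flat]])
  then have "smooth_on b UNIV" by (simp add: smooth_on_open_iff)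
  moreover have "b y = 1" if "y \<in> ball x0 r" for y
  proof -
    have "norm (y - x0) < r" using that by (simp add: dist_norm norm_minus_commute)
    then have "(norm (y - x0))^2 < r^2" by (intro power_strict_mono) auto
    moreover have "r^2 > 0" using assms by simp
    ultimately have "(norm (y - x0))^2 / r^2 \<le> 1"
      by (metis divide_le_eq_1_pos less_imp_le)
    then have "u y \<le> 0" by (simp add: u_def dot_square_norm flip: divide_inverse)
    then show ?thesis by (simp add: b_def w_def flat_def exp_minus)
  qed
  moreover have "b y = 0" if "y \<notin> ball x0 (2 * r)" for y
  proof -
    have "norm (y - x0) \<ge> 2 * r" using that by (simp add: dist_norm norm_minus_commute)
    then have "(2 * r)^2 \<le> (norm (y - x0))^2" using assms by (intro power_mono) auto
    moreover have "2 * r^2 \<le> (2 * r)^2" by (simp add: power_mult_distrib)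
    ultimately have "2 * r^2 \<le> (norm (y - x0))^2" by (rule order_trans[rotated])
    then have "1 \<le> u y" using assms by (simp add: u_def dot_square_norm pos_le_divide_eq flip: divide_inverse)
    then have "exp (- 1) \<le> flat 1 (u y)" by (simp add: flat_def inverse_le_1_iff)
    then have "w y \<le> 0" by (simp add: w_def exp_minus field_simps)
    then show ?thesis by (simp add: b_def flat_def)
  qed
  ultimately show ?thesis using that by blast
qed

section \<open>Integrals along rays\<close>

text \<open>Differentiating \<open>h (t *\<^sub>R y)\<close> in \<open>y\<close> brings out a factor
  \<open>t\<close>. Carrying the weight \<open>t ^ m\<close> makes this class of integrals closed
  under differentiation.\<close>

lemma radial_integral_has_derivative:
  fixes h :: "'b::euclidean_space \<Rightarrow> real"
  assumes "open S" and star: "\<And>y t. y \<in> S \<Longrightarrow> 0 \<le> t \<Longrightarrow> t \<le> 1 \<Longrightarrow> t *\<^sub>R y \<in> S"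
    and h: "smooth_on h S" and "y \<in> S"
  shows "((\<lambda>y. integral {0..1} (\<lambda>t. t ^ m * h (t *\<^sub>R y))) has_derivative
      (\<lambda>v. integral {0..1} (\<lambda>t. t ^ Suc m * frechet_derivative h (at (t *\<^sub>R y)) v))) (at y)"
proof -
  obtain e where e: "e > 0" "ball y e \<subseteq> S" using assms(1,4) open_contains_ball by blast
  \<comment> \<open>Packaging the derivative as a bounded operator lets its joint continuity in
    point and parameter be stated, as the Leibniz rule demands; in finite dimension continuity can
    be checked on basis vectors.\<close>
  define Dh where "Dh = (\<lambda>z. Blinfun (frechet_derivative h (at z)))"
  have dh: "(h has_derivative blinfun_apply (Dh z)) (at z)" if "z \<in> S" for z
  proof -
    have "(h has_derivative frechet_derivative h (at z)) (at z)"
      using smooth_on_differentiable[OF assms(1) h that] by (simp add: frechet_derivative_works)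
    then show ?thesis
      unfolding Dh_def using bounded_linear_Blinfun_apply has_derivative_bounded_linear by metis
  qed
  have app: "blinfun_apply (Dh z) v = frechet_derivative h (at z) v" if "z \<in> S" for z v
    using frechet_derivative_at[OF dh[OF that]] by simp
  have cDh: "continuous_on S Dh"
  proof (rule continuous_on_blinfun_componentwise)
    fix b :: 'b
    have "continuous_on S (\<lambda>z. frechet_derivative h (at z) b)"
      by (rule smooth_on_imp_continuous_on[OF smooth_on_frechet_derivative[OF assms(1) h]])
    then show "continuous_on S (\<lambda>z. blinfun_apply (Dh z) b)"
      by (rule continuous_on_eq) (simp add: app)
  qed
  define fx where "fx = (\<lambda>y t. t ^ Suc m *\<^sub>R Dh (t *\<^sub>R y))"
  have inS: "t *\<^sub>R z \<in> S" if "z \<in> ball y e" "t \<in> cbox 0 1" for z and t::real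
    using that star e by auto
  have cfx: "continuous_on (ball y e \<times> cbox 0 1) (\<lambda>(x, t). fx x t)"
    unfolding fx_def split_def using inS
    by (intro continuous_intros continuous_on_compose2[OF cDh]) auto
  have "((\<lambda>y. integral (cbox 0 1) (\<lambda>t. t ^ m * h (t *\<^sub>R y))) has_derivative
      blinfun_apply (integral (cbox 0 1) (fx y))) (at y within ball y e)"
  proof (rule leibniz_rule[OF _ _ cfx])
    fix z and t :: real assume z: "z \<in> ball y e" "t \<in> cbox 0 1"
    have "((\<lambda>z. t ^ m * h (t *\<^sub>R z)) has_derivative (\<lambda>v. t ^ m * blinfun_apply (Dh (t *\<^sub>R z)) (t *\<^sub>R v))) (at z)"
      by (intro has_derivative_mult_right has_derivative_compose[of "\<lambda>z. t *\<^sub>R z" _ z UNIV h]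
          has_derivative_scaleR_right has_derivative_ident dh inS z)
    moreover have "(\<lambda>v. t ^ m * blinfun_apply (Dh (t *\<^sub>R z)) (t *\<^sub>R v)) = blinfun_apply (fx z t)"
      by (auto simp: fx_def blinfun.scaleR_right blinfun.scaleR_left)
    ultimately show "((\<lambda>z. t ^ m * h (t *\<^sub>R z)) has_derivative blinfun_apply (fx z t)) (at z within ball y e)"
      using has_derivative_at_withinI by metis
  next
    fix z assume z: "z \<in> ball y e"
    show "(\<lambda>t. t ^ m * h (t *\<^sub>R z)) integrable_on cbox 0 1"
      using inS[OF z]
      by (intro integrable_continuous continuous_intros
          continuous_on_compose2[OF smooth_on_imp_continuous_on[OF h]]) auto
  qed (use e in auto)
  then have *: "((\<lambda>y. integral {0..1} (\<lambda>t. t ^ m * h (t *\<^sub>R y))) has_derivative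
      blinfun_apply (integral {0..1} (fx y))) (at y)"
    using e at_within_open[of y "ball y e"] by simp
  have "blinfun_apply (integral {0..1} (fx y)) v =
      integral {0..1} (\<lambda>t. t ^ Suc m * frechet_derivative h (at (t *\<^sub>R y)) v)" for v
  proof -
    have "continuous_on {0..1} (fx y)"
      unfolding fx_def using star[OF assms(4)]
      by (intro continuous_intros continuous_on_compose2[OF cDh]) auto
    then have "blinfun_apply (integral {0..1} (fx y)) v = integral {0..1} (\<lambda>t. blinfun_apply (fx y t) v)"
      by (intro blinfun_apply_integral integrable_continuous_real)
    also have "\<dots> = integral {0..1} (\<lambda>t. t ^ Suc m * frechet_derivative h (at (t *\<^sub>R y)) v)"
      using star[OF assms(4)] by (intro integral_cong) (simp add: fx_def blinfun.scaleR_left app)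
    finally show ?thesis .
  qed
  then have "blinfun_apply (integral {0..1} (fx y)) =
      (\<lambda>v. integral {0..1} (\<lambda>t. t ^ Suc m * frechet_derivative h (at (t *\<^sub>R y)) v))" by blast
  then show ?thesis using * by metis
qed

lemma smooth_on_radial_integral:
  fixes h :: "'b::euclidean_space \<Rightarrow> real"
  assumes "open S" and "\<And>y t. y \<in> S \<Longrightarrow> 0 \<le> t \<Longrightarrow> t \<le> 1 \<Longrightarrow> t *\<^sub>R y \<in> S"
    and "smooth_on h S"
  shows "smooth_on (\<lambda>y. integral {0..1} (\<lambda>t. h (t *\<^sub>R y))) S"
proof -
  \<comment> \<open>The induction on the order runs over all weights; the claim is the case
    \<open>m = 0\<close>.\<close>
  have "Ck_on k (\<lambda>y. integral {0..1} (\<lambda>t. t ^ m * h (t *\<^sub>R y))) S" for k m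
    using assms(3)
  proof (induction k arbitrary: m h)
    case 0
    have "isCont (\<lambda>y. integral {0..1} (\<lambda>t. t ^ m * h (t *\<^sub>R y))) y" if "y \<in> S" for y
      using radial_integral_has_derivative[OF assms(1,2) 0 that] has_derivative_continuous by blast
    then show ?case by (simp add: continuous_at_imp_continuous_on)
  next
    case (Suc k)
    note D = radial_integral_has_derivative[OF assms(1,2) Suc.prems]
    have "Ck_on k (\<lambda>y. frechet_derivative (\<lambda>y. integral {0..1} (\<lambda>t. t ^ m * h (t *\<^sub>R y))) (at y) v) S"
      for v
    proof (rule Ck_on_cong[OF assms(1)])
      show "Ck_on k (\<lambda>y. integral {0..1} (\<lambda>t. t ^ Suc m * frechet_derivative h (at (t *\<^sub>R y)) v)) S"
        by (rule Suc.IH[OF smooth_on_frechet_derivative[OF assms(1) Suc.prems]])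
      fix y assume "y \<in> S"
      show "integral {0..1} (\<lambda>t. t ^ Suc m * frechet_derivative h (at (t *\<^sub>R y)) v) =
          frechet_derivative (\<lambda>y. integral {0..1} (\<lambda>t. t ^ m * h (t *\<^sub>R y))) (at y) v"
        using fun_cong[OF frechet_derivative_at[OF D[OF _ _ _ \<open>y \<in> S\<close>, of m]], of v] by simp
    qed
    moreover have "(\<lambda>y. integral {0..1} (\<lambda>t. t ^ m * h (t *\<^sub>R y))) differentiable_on S"
      using D by (meson differentiable_at_imp_differentiable_on differentiable_def)
    ultimately show ?case by simp
  qed
  from this[of _ 0] show ?thesis using assms(1) by (simp add: smooth_on_open_iff)
qed

section \<open>Linear differential equations\<close>

text \<open>Picard iteration on the whole interval at once: under the weight exp(-L t) the integral
  operator contracts by \<open>K / L\<close>, where \<open>K\<close> bounds the operators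
  \<open>M t\<close>. The choice \<open>L = 2 * K\<close> gives the factor 1/2.\<close>

lemma linear_ode_exists:
  fixes M :: "real \<Rightarrow> 'b::banach \<Rightarrow>\<^sub>L 'b"
  assumes M: "continuous_on {0..1} M"
  obtains x where "x 0 = x0"
    "\<And>t. t \<in> {0..1} \<Longrightarrow> (x has_vector_derivative M t (x t)) (at t within {0..1})"
proof -
  have "bounded (M ` {0..1})"
    using compact_continuous_image[OF M] compact_imp_bounded by blast
  then obtain K where K: "K > 0" "\<And>t. t \<in> {0..1} \<Longrightarrow> norm (M t) \<le> K"
    unfolding bounded_pos by auto
  define L where "L = 2 * K"
  \<comment> \<open>Clamping time to \<open>[0,1]\<close> turns functions on the interval into
    bounded continuous functions on the line, which form a complete space.\<close>
  define cl :: "real \<Rightarrow> real" where "cl = (\<lambda>t. max 0 (min 1 t))"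
  have cl: "cl t \<in> {0..1}" for t by (simp add: cl_def)
  \<comment> \<open>This is the Picard operator for the rescaled unknown exp(-L t) x(t), hence the
    two exponential weights.\<close>
  define G where "G = (\<lambda>(y::real \<Rightarrow>\<^sub>C 'b) t.
    exp (- (L * t)) *\<^sub>R (x0 + integral {0..t} (\<lambda>s. exp (L * s) *\<^sub>R M s (y s))))"
  have cy: "continuous_on T (apply_bcontfun (y::real \<Rightarrow>\<^sub>C 'b))" for y T
    using continuous_on_apply_bcontfun continuous_on_id by blast
  have ci: "continuous_on {0..1} (\<lambda>s. exp (L * s) *\<^sub>R M s (y s))" for y :: "real \<Rightarrow>\<^sub>C 'b"
    by (intro continuous_intros M cy)
  have cG: "continuous_on {0..1} (G y)" for y
    unfolding G_def
    by (intro continuous_intros indefinite_integral_continuous_1 integrable_continuous_real ci)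
  define T where "T = (\<lambda>y. Bcontfun (\<lambda>t. G y (cl t)))"
  have Tapp: "apply_bcontfun (T y) t = G y (cl t)" for y t
  proof -
    have "continuous_on UNIV (\<lambda>t. G y (cl t))"
      by (rule continuous_on_compose2[OF cG]) (auto simp: cl_def intro!: continuous_intros)
    moreover have "bounded (range (\<lambda>t. G y (cl t)))"
      by (rule bounded_subset[OF compact_imp_bounded[OF compact_continuous_image[OF cG]]])
         (use cl in auto)
    ultimately show ?thesis
      unfolding T_def by (subst Bcontfun_inverse) (simp_all add: bcontfun_def)
  qed
  have "dist (T y) (T z) \<le> 1/2 * dist y z" for y z
  proof (rule dist_bound)
    fix t
    define \<tau> where "\<tau> = cl t"
    have \<tau>: "\<tau> \<in> {0..1}" using cl \<tau>_def by simp
    have iy: "(\<lambda>s. exp (L * s) *\<^sub>R M s (u s)) integrable_on {0..\<tau>}" for u :: "real \<Rightarrow>\<^sub>C 'b"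
      using \<tau> by (intro integrable_continuous_real continuous_on_subset[OF ci]) auto
    have LK: "L > 0" "K / L = 1/2" using K by (auto simp: L_def)
    \<comment> \<open>The factor 1/L of this antiderivative is the source of the
      contraction.\<close>
    have I: "((\<lambda>s. exp (L * s) * (K * dist y z)) has_integral
        (exp (L * \<tau>) / L * (K * dist y z) - exp (L * 0) / L * (K * dist y z))) {0..\<tau>}"
      using \<tau> LK
      by (intro fundamental_theorem_of_calculus)
         (auto intro!: derivative_eq_intros simp flip: has_real_derivative_iff_has_vector_derivative)
    have "dist (G y \<tau>) (G z \<tau>) = exp (- (L * \<tau>)) * norm (integral {0..\<tau>}
        (\<lambda>s. exp (L * s) *\<^sub>R M s (y s)) - integral {0..\<tau>} (\<lambda>s. exp (L * s) *\<^sub>R M s (z s)))"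
      by (simp add: G_def dist_norm flip: scaleR_diff_right)
    also have "\<dots> = exp (- (L * \<tau>)) * norm (integral {0..\<tau>} (\<lambda>s. exp (L * s) *\<^sub>R M s (y s - z s)))"
      using integral_diff[OF iy iy, of y z]
      by (simp add: blinfun.diff_right scaleR_diff_right)
    also have "\<dots> \<le> exp (- (L * \<tau>)) * integral {0..\<tau>} (\<lambda>s. exp (L * s) * (K * dist y z))"
    proof (intro mult_left_mono integral_norm_bound_integral)
      show "(\<lambda>s. exp (L * s) *\<^sub>R M s (y s - z s)) integrable_on {0..\<tau>}"
        using integrable_diff[OF iy iy, of y z] by (simp add: blinfun.diff_right scaleR_diff_right)
      show "(\<lambda>s. exp (L * s) * (K * dist y z)) integrable_on {0..\<tau>}" using I by blast
      fix s assume s: "s \<in> {0..\<tau>}"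
      have "norm (M s (y s - z s)) \<le> norm (M s) * norm (y s - z s)" by (rule norm_blinfun)
      also have "\<dots> \<le> K * dist y z"
        using K s \<tau> dist_bounded[of y s z] by (intro mult_mono) (auto simp: dist_norm)
      finally show "norm (exp (L * s) *\<^sub>R M s (y s - z s)) \<le> exp (L * s) * (K * dist y z)" by simp
    qed auto
    also have "\<dots> = exp (- (L * \<tau>)) * ((exp (L * \<tau>) - 1) * (K / L * dist y z))"
      unfolding integral_unique[OF I] by (simp add: algebra_simps diff_divide_distrib)
    also have "\<dots> = (1 - exp (- (L * \<tau>))) * (1/2 * dist y z)"
      unfolding LK by (simp add: exp_minus field_simps)
    also have "\<dots> \<le> 1 * (1/2 * dist y z)"
      by (intro mult_right_mono) auto
    finally show "dist (T y t) (T z t) \<le> 1/2 * dist y z"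
      by (simp add: Tapp \<tau>_def)
  qed
  then obtain y where y: "T y = y"
    using banach_fix_type[of "1/2" T] by auto
  define x where "x = (\<lambda>t. exp (L * t) *\<^sub>R y t)"
  have x: "x t = x0 + integral {0..t} (\<lambda>s. M s (x s))" if "t \<in> {0..1}" for t
  proof -
    have "y t = G y t" using Tapp[of y t] y that by (simp add: cl_def)
    then have "x t = exp (L * t) *\<^sub>R G y t" by (simp add: x_def)
    then show ?thesis
      by (simp add: G_def x_def blinfun.scaleR_right flip: exp_add)
  qed
  have "(x has_vector_derivative M t (x t)) (at t within {0..1})" if t: "t \<in> {0..1}" for t
  proof -
    have "continuous_on {0..1} (\<lambda>s. M s (x s))"
      unfolding x_def by (intro continuous_intros M cy)
    then have "((\<lambda>u. integral {0..u} (\<lambda>s. M s (x s))) has_vector_derivative M t (x t)) (at t within {0..1})"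
      using integral_has_vector_derivative t by blast
    then have "((\<lambda>u. x0 + integral {0..u} (\<lambda>s. M s (x s))) has_vector_derivative M t (x t)) (at t within {0..1})"
      using has_vector_derivative_add[OF has_vector_derivative_const] by fastforce
    then show ?thesis
      by (rule has_vector_derivative_transform[OF t, rotated]) (rule x)
  qed
  moreover have "x 0 = x0" using x[of 0] by simp
  ultimately show ?thesis using that by blast
qed

text \<open>Energy estimate: the squared norm of \<open>x\<close> grows at most like exp(2 K t), so
  the weighted quantity \<open>f\<close> does not increase from its initial value 0. By linearity
  this yields uniqueness of solutions.\<close>

lemma linear_ode_zero:
  fixes M :: "real \<Rightarrow> 'b::euclidean_space \<Rightarrow>\<^sub>L 'b"
  assumes M: "continuous_on {0..1} M" and "x 0 = 0"
    and x: "\<And>t. t \<in> {0..1} \<Longrightarrow> (x has_vector_derivative M t (x t)) (at t within {0..1})"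
    and t: "t \<in> {0..1}"
  shows "x t = 0"
proof -
  have "bounded (M ` {0..1})"
    using compact_continuous_image[OF M] compact_imp_bounded by blast
  then obtain K where K: "K > 0" "\<And>t. t \<in> {0..1} \<Longrightarrow> norm (M t) \<le> K"
    unfolding bounded_pos by auto
  define f where "f = (\<lambda>s. exp (- (2 * K * s)) * (x s \<bullet> x s))"
  have cx: "continuous_on {0..1} x"
    using x has_vector_derivative_continuous continuous_on_eq_continuous_within by blast
  have "f t \<le> f 0"
  proof (rule DERIV_nonpos_imp_decreasing_open[of 0 t f])
    show "0 \<le> t" using t by simp
    show "continuous_on {0..t} f"
      unfolding f_def using t by (intro continuous_intros continuous_on_subset[OF cx]) auto
    fix s assume s: "0 < s" "s < t"
    have "(x has_vector_derivative M s (x s)) (at s)"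
      using x[of s] s t at_within_interior[of s "{0..1}"] by simp
    then have "(x has_derivative (\<lambda>h. h *\<^sub>R M s (x s))) (at s)"
      by (simp add: has_vector_derivative_def)
    then have "((\<lambda>s. x s \<bullet> x s) has_derivative (\<lambda>h. x s \<bullet> h *\<^sub>R M s (x s) + h *\<^sub>R M s (x s) \<bullet> x s)) (at s)"
      by (intro has_derivative_inner)
    then have d: "((\<lambda>s. x s \<bullet> x s) has_real_derivative 2 * (x s \<bullet> M s (x s))) (at s)"
      unfolding has_field_derivative_def
      by (rule has_derivative_eq_rhs) (auto simp: inner_commute algebra_simps)
    have "(f has_real_derivative exp (- (2 * K * s)) * (2 * (x s \<bullet> M s (x s)) - 2 * K * (x s \<bullet> x s))) (at s)"
      unfolding f_def by (auto intro!: derivative_eq_intros d simp: algebra_simps)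
    moreover have "x s \<bullet> M s (x s) \<le> K * (x s \<bullet> x s)"
    proof -
      have "x s \<bullet> M s (x s) \<le> norm (x s) * norm (M s (x s))" by (rule norm_cauchy_schwarz)
      also have "\<dots> \<le> norm (x s) * (K * norm (x s))"
        using K(2)[of s] s t norm_blinfun[of "M s" "x s"]
        by (intro mult_left_mono order_trans[OF norm_blinfun] mult_right_mono) auto
      finally show ?thesis by (simp add: dot_square_norm power2_eq_square mult_ac)
    qed
    ultimately show "\<exists>y. (f has_real_derivative y) (at s) \<and> y \<le> 0"
      by (intro exI conjI) (auto simp: mult_le_0_iff)
  qed
  then have "exp (- (2 * K * t)) * (x t \<bullet> x t) \<le> 0" by (simp add: f_def assms(2))
  then have "x t \<bullet> x t \<le> 0" by (simp add: mult_le_0_iff)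
  then show ?thesis by (metis inner_eq_zero_iff inner_ge_zero order_antisym)
qed

text \<open>\<open>R\<close> is the Gram map of \<open>B\<close>. Positivity makes it injective,
  hence bijective in finite dimension. This is what supplies gradients.\<close>

lemma positive_definite_represents:
  fixes B :: "'b::euclidean_space \<Rightarrow> 'b \<Rightarrow> real"
  assumes B: "bounded_bilinear B" and pos: "\<And>v. v \<noteq> 0 \<Longrightarrow> B v v > 0" and l: "linear l"
  shows "\<exists>!v. \<forall>w. B v w = l w"
proof -
  interpret bounded_bilinear B by fact
  define R where "R = (\<lambda>v. \<Sum>b\<in>Basis. B v b *\<^sub>R b)"
  have R: "R v \<bullet> w = B v w" for v w
  proof -
    have "B v w = (\<Sum>b\<in>Basis. (w \<bullet> b) *\<^sub>R B v b)"
      by (rule linear_euclidean_expansion) (simp add: bounded_linear_right bounded_linear.linear)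
    then show ?thesis by (simp add: R_def inner_sum_left inner_commute[of w] mult_ac)
  qed
  have lR: "linear R"
    unfolding R_def by (intro linearI) (simp_all add: add_left scaleR_left scaleR_left_distrib
      sum.distrib scaleR_sum_right)
  have inj: "inj R"
    using R pos unfolding linear_injective_0[OF lR] by (metis inner_zero_left less_irrefl)
  then have "surj R" using lR linear_injective_imp_surjective by blast
  then obtain v where v: "R v = (\<Sum>b\<in>Basis. l b *\<^sub>R b)" by (metis surjD)
  have "B v w = l w" for w
  proof -
    have "B v w = (\<Sum>b\<in>Basis. l b *\<^sub>R b) \<bullet> w" using R v by metis
    also have "\<dots> = l w"
      unfolding linear_euclidean_expansion[OF l, of w]
      by (simp add: inner_sum_left inner_commute[of w] mult_ac)
    finally show ?thesis .
  qed
  moreover have "u = v" if "\<forall>w. B u w = l w" for u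
    using that \<open>\<And>w. B v w = l w\<close> inj R by (metis injD vector_eq_rdot)
  ultimately show ?thesis by blast
qed

section \<open>Charts and tangent vectors\<close>

locale smooth_mfd =
  fixes A :: "('a::{t2_space, second_countable_topology}, 'e::euclidean_space) chart set"
  assumes mfd: "smooth_manifold A"
begin

lemma is_chart: "c \<in> A \<Longrightarrow> is_chart c"
  using mfd by (simp add: smooth_manifold_def)

lemma chart_open: "c \<in> A \<Longrightarrow> open (fst c)"
  using is_chart by (simp add: is_chart_def)

lemma chart_homeomorphism: "c \<in> A \<Longrightarrow> homeomorphism (fst c) (snd c ` fst c) (snd c) (chart_inv c)"
  using is_chart by (simp add: is_chart_def)

lemma chart_inv_left: "c \<in> A \<Longrightarrow> x \<in> fst c \<Longrightarrow> chart_inv c (snd c x) = x"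
  using chart_homeomorphism homeomorphism_apply1 by metis

lemma chart_image_open:
  assumes "c \<in> A" "open N" shows "open (snd c ` (fst c \<inter> N))"
proof -
  have "openin (top_of_set (snd c ` fst c)) (snd c ` (fst c \<inter> N))"
    using homeomorphism_imp_open_map[OF chart_homeomorphism[OF assms(1)]] assms(2)
    by (simp add: openin_open_Int)
  then show ?thesis
    using is_chart[OF assms(1)] openin_open_trans unfolding is_chart_def by blast
qed

lemma chart_image_open_subset:
  "c \<in> A \<Longrightarrow> open N \<Longrightarrow> N \<subseteq> fst c \<Longrightarrow> open (snd c ` N)"
  using chart_image_open by (metis inf.absorb2)

lemma chart_exists: obtains c where "c \<in> A" "x \<in> fst c"
proof -
  have "x \<in> (\<Union>c\<in>A. fst c)" using mfd by (simp add: smooth_manifold_def)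
  then show ?thesis using that by blast
qed

lemma transition_smooth:
  "c \<in> A \<Longrightarrow> d \<in> A \<Longrightarrow> smooth_on (snd d \<circ> chart_inv c) (snd c ` (fst c \<inter> fst d))"
  using mfd by (auto simp: smooth_manifold_def compatible_def)

definition jac :: "('a, 'e) chart \<Rightarrow> ('a, 'e) chart \<Rightarrow> 'a \<Rightarrow> 'e \<Rightarrow> 'e" where
  "jac c d x = frechet_derivative (snd d \<circ> chart_inv c) (at (snd c x))"

lemma jac_has_derivative:
  assumes "c \<in> A" "d \<in> A" "x \<in> fst c" "x \<in> fst d"
  shows "((snd d \<circ> chart_inv c) has_derivative jac c d x) (at (snd c x))"
proof -
  have "(snd d \<circ> chart_inv c) differentiable (at (snd c x))"
    using smooth_on_differentiable[OF _ transition_smooth[OF assms(1,2)]]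
      chart_image_open[OF assms(1) chart_open[OF assms(2)]] assms by blast
  then show ?thesis by (simp add: jac_def frechet_derivative_works)
qed

lemma jac_linear:
  "c \<in> A \<Longrightarrow> d \<in> A \<Longrightarrow> x \<in> fst c \<Longrightarrow> x \<in> fst d \<Longrightarrow> linear (jac c d x)"
  using jac_has_derivative has_derivative_linear by blast

text \<open>The common source of chart independence: applied to a coordinate map it gives
  \<open>jac_chain\<close>, applied to a real function it gives
  \<open>differential_chart\<close>.\<close>

lemma has_derivative_change_chart:
  assumes "c \<in> A" "d \<in> A" "x \<in> fst c" "x \<in> fst d"
    and h: "((\<lambda>y. f (chart_inv d y)) has_derivative D) (at (snd d x))"
  shows "((\<lambda>y. f (chart_inv c y)) has_derivative (\<lambda>u. D (jac c d x u))) (at (snd c x))"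
proof -
  have "((\<lambda>y. f (chart_inv d ((snd d \<circ> chart_inv c) y))) has_derivative (\<lambda>u. D (jac c d x u)))
      (at (snd c x))"
    using has_derivative_compose[OF jac_has_derivative[OF assms(1-4)], of "\<lambda>y. f (chart_inv d y)" D] h
    by (simp add: chart_inv_left assms)
  then show ?thesis
    by (rule has_derivative_transform_within_open[OF _ chart_image_open[OF assms(1) chart_open[OF assms(2)]]])
       (use assms in \<open>auto simp: chart_inv_left\<close>)
qed

lemma jac_chain:
  assumes "c \<in> A" "d \<in> A" "d' \<in> A" "x \<in> fst c" "x \<in> fst d" "x \<in> fst d'"
  shows "jac d d' x (jac c d x u) = jac c d' x u"
proof -
  have "((snd d' \<circ> chart_inv c) has_derivative (\<lambda>u. jac d d' x (jac c d x u))) (at (snd c x))"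
    using has_derivative_change_chart[of c d x "snd d'"] jac_has_derivative[of d d' x] assms
    by (simp add: comp_def)
  then have "jac c d' x = (\<lambda>u. jac d d' x (jac c d x u))"
    using has_derivative_unique jac_has_derivative assms by blast
  then show ?thesis by simp
qed

lemma jac_self: assumes "c \<in> A" "x \<in> fst c" shows "jac c c x u = u"
proof -
  have "((snd c \<circ> chart_inv c) has_derivative (\<lambda>u. u)) (at (snd c x))"
    by (rule has_derivative_transform_within_open[OF has_derivative_ident
          chart_image_open_subset[OF assms(1) chart_open[OF assms(1)] subset_refl]])
       (use assms in \<open>auto simp: chart_inv_left\<close>)
  then have "jac c c x = (\<lambda>u. u)"
    using has_derivative_unique jac_has_derivative assms by blast
  then show ?thesis by simp
qed

lemma tangent_space_jac:
  "tangent_space A x = {v. (\<forall>c. \<not> (c \<in> A \<and> x \<in> fst c) \<longrightarrow> v c = 0) \<and>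
     (\<forall>c\<in>A. \<forall>d\<in>A. x \<in> fst c \<and> x \<in> fst d \<longrightarrow> v d = jac c d x (v c))}"
  by (simp add: tangent_space_def jac_def)

lemma coord_vec_jac:
  "coord_vec A x c u = (\<lambda>d. if d \<in> A \<and> x \<in> fst d then jac c d x u else 0)"
  unfolding coord_vec_def jac_def ..

lemma tangentI:
  assumes "\<And>c. \<not> (c \<in> A \<and> x \<in> fst c) \<Longrightarrow> v c = 0"
    and "\<And>c d. c \<in> A \<Longrightarrow> d \<in> A \<Longrightarrow> x \<in> fst c \<Longrightarrow> x \<in> fst d \<Longrightarrow> v d = jac c d x (v c)"
  shows "v \<in> tangent_space A x"
  unfolding tangent_space_jac using assms by blast

lemma tangent_outside: "v \<in> tangent_space A x \<Longrightarrow> \<not> (c \<in> A \<and> x \<in> fst c) \<Longrightarrow> v c = 0"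
  unfolding tangent_space_def by blast

lemma coord_vec_tangent: "c \<in> A \<Longrightarrow> x \<in> fst c \<Longrightarrow> coord_vec A x c u \<in> tangent_space A x"
  by (auto simp: tangent_space_jac coord_vec_jac jac_chain)

lemma coord_vec_self: "c \<in> A \<Longrightarrow> x \<in> fst c \<Longrightarrow> coord_vec A x c u c = u"
  by (simp add: coord_vec_jac jac_self)

lemma tangent_jac:
  "v \<in> tangent_space A x \<Longrightarrow> c \<in> A \<Longrightarrow> d \<in> A \<Longrightarrow> x \<in> fst c \<Longrightarrow> x \<in> fst d \<Longrightarrow> v d = jac c d x (v c)"
  unfolding tangent_space_jac by blast

text \<open>One coordinate vector determines all others through \<open>jac\<close>, so equations
  between tangent vectors can be checked in a single convenient chart.\<close>

lemma tangent_eqI: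
  assumes "c \<in> A" "x \<in> fst c" "v \<in> tangent_space A x" "w \<in> tangent_space A x" "v c = w c"
  shows "v = w"
proof
  fix d
  show "v d = w d"
  proof (cases "d \<in> A \<and> x \<in> fst d")
    case True
    then show ?thesis
      using tangent_jac[OF assms(3) assms(1)] tangent_jac[OF assms(4) assms(1)] assms(2,5) by simp
  next
    case False
    then show ?thesis using tangent_outside[OF assms(3) False] tangent_outside[OF assms(4) False] by simp
  qed
qed

lemma tangent_coord_vec:
  "c \<in> A \<Longrightarrow> x \<in> fst c \<Longrightarrow> v \<in> tangent_space A x \<Longrightarrow> coord_vec A x c (v c) = v"
  by (intro tangent_eqI[of c x] coord_vec_tangent) (auto simp: coord_vec_self)

lemma tangent_subspace: "subspace (tangent_space A x)"
  unfolding subspace_def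
proof (intro conjI ballI allI)
  show "0 \<in> tangent_space A x"
    by (rule tangentI) (auto simp: linear_0[OF jac_linear])
  fix v w assume "v \<in> tangent_space A x" "w \<in> tangent_space A x"
  then show "v + w \<in> tangent_space A x"
    by (intro tangentI) (simp_all add: tangent_outside linear_add[OF jac_linear] flip: tangent_jac)
next
  fix r v assume "v \<in> tangent_space A x"
  then show "r *\<^sub>R v \<in> tangent_space A x"
    by (intro tangentI)
       (simp_all add: scaleR_fun_def tangent_outside linear_cmul[OF jac_linear] flip: tangent_jac)
qed

lemmas tangent_zero = subspace_0[OF tangent_subspace]
  and tangent_add = subspace_add[OF tangent_subspace]
  and tangent_diff = subspace_diff[OF tangent_subspace]
  and tangent_scaleR = subspace_scale[OF tangent_subspace]
  and tangent_sum = subspace_sum[OF tangent_subspace]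

lemma coord_vec_add: "c \<in> A \<Longrightarrow> x \<in> fst c \<Longrightarrow>
    coord_vec A x c (u + v) = coord_vec A x c u + coord_vec A x c v"
  by (rule tangent_eqI[of c x]) (auto simp: coord_vec_self coord_vec_tangent tangent_add)

lemma coord_vec_scaleR: "c \<in> A \<Longrightarrow> x \<in> fst c \<Longrightarrow>
    coord_vec A x c (r *\<^sub>R u) = r *\<^sub>R coord_vec A x c u"
  by (rule tangent_eqI[of c x, OF _ _ coord_vec_tangent tangent_scaleR[OF coord_vec_tangent]])
     (simp_all add: coord_vec_self scaleR_fun_def)

lemma coord_vec_linear: "c \<in> A \<Longrightarrow> x \<in> fst c \<Longrightarrow> linear (coord_vec A x c)"
  by (intro linearI coord_vec_add coord_vec_scaleR)

lemma tangent_expansion: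
  assumes "c \<in> A" "x \<in> fst c" "v \<in> tangent_space A x"
  shows "v = (\<Sum>b\<in>Basis. (v c \<bullet> b) *\<^sub>R coord_vec A x c b)"
  using linear_euclidean_expansion[OF coord_vec_linear[OF assms(1,2)]] tangent_coord_vec[OF assms]
  by metis

section \<open>Smooth functions and vector fields\<close>

lemma smooth_on_change_chart:
  assumes "c \<in> A" "d \<in> A" "open N" "N \<subseteq> fst c" "N \<subseteq> fst d"
    and "smooth_on (\<lambda>y. f (chart_inv c y)) (snd c ` N)"
  shows "smooth_on (\<lambda>y. f (chart_inv d y)) (snd d ` N)"
proof (rule smooth_on_cong)
  have sub: "snd d ` N \<subseteq> snd d ` (fst d \<inter> fst c)" using assms by blast
  show "smooth_on (\<lambda>y. f (chart_inv c ((snd c \<circ> chart_inv d) y))) (snd d ` N)"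
  proof (rule smooth_on_compose_open[where T = "snd c ` N"])
    show "(snd c \<circ> chart_inv d) ` (snd d ` N) \<subseteq> snd c ` N"
      using assms by (auto simp: chart_inv_left)
    show "smooth_on (snd c \<circ> chart_inv d) (snd d ` N)"
      by (rule smooth_on_subset[OF transition_smooth[OF assms(2,1)] sub])
  qed (use assms chart_image_open_subset in auto)
  fix y assume "y \<in> snd d ` N"
  then show "f (chart_inv c ((snd c \<circ> chart_inv d) y)) = f (chart_inv d y)"
    using assms by (auto simp: chart_inv_left subset_iff)
qed

text \<open>\<open>smooth_fun\<close> quantifies over all charts of a maximal atlas; coordinate
  changes reduce this to one chart near each point.\<close>

lemma smooth_fun_local:
  assumes "\<And>x. x \<in> S \<Longrightarrow> \<exists>c\<in>A. \<exists>N. open N \<and> x \<in> N \<and> N \<subseteq> fst c \<and>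
      smooth_on (\<lambda>y. f (chart_inv c y)) (snd c ` N)"
  shows "smooth_fun A S f"
  unfolding smooth_fun_def comp_def
proof (intro ballI smooth_on_local)
  fix d y assume d: "d \<in> A" and "y \<in> snd d ` (fst d \<inter> S)"
  then obtain x where x: "x \<in> fst d" "x \<in> S" "y = snd d x" by blast
  then obtain c N where N: "c \<in> A" "open N" "x \<in> N" "N \<subseteq> fst c"
    "smooth_on (\<lambda>y. f (chart_inv c y)) (snd c ` N)" using assms by meson
  have "smooth_on (\<lambda>y. f (chart_inv d y)) (snd d ` (N \<inter> fst d))"
    by (rule smooth_on_change_chart[OF N(1) d _ _ _ smooth_on_subset[OF N(5)]])
       (use N chart_open[OF d] in auto)
  then show "\<exists>W. open W \<and> y \<in> W \<and>
      smooth_on (\<lambda>y. f (chart_inv d y)) (W \<inter> snd d ` (fst d \<inter> S))"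
    using x N d chart_open[OF d]
    by (intro exI[of _ "snd d ` (N \<inter> fst d)"] conjI chart_image_open_subset)
       (auto elim: smooth_on_subset)
qed

lemma smooth_funD:
  "smooth_fun A S f \<Longrightarrow> c \<in> A \<Longrightarrow> N \<subseteq> fst c \<Longrightarrow> N \<subseteq> S \<Longrightarrow>
     smooth_on (\<lambda>y. f (chart_inv c y)) (snd c ` N)"
  unfolding smooth_fun_def comp_def by (metis image_mono le_inf_iff smooth_on_subset)

lemma smooth_fun_const: "smooth_fun A S (\<lambda>_. r)"
  by (simp add: smooth_fun_def comp_def smooth_on_const)

lemma smooth_fun_has_derivative:
  assumes "smooth_fun A S f" "open S" "x \<in> S" "c \<in> A" "x \<in> fst c"
  shows "((\<lambda>y. f (chart_inv c y)) has_derivative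
     frechet_derivative (\<lambda>y. f (chart_inv c y)) (at (snd c x))) (at (snd c x))"
  using smooth_on_differentiable[OF chart_image_open[of c S] smooth_funD[of S f c "fst c \<inter> S"]] assms
  by (auto simp flip: frechet_derivative_works)

text \<open>The chart inside \<open>differential\<close> is an arbitrary choice; the chain rule for
  \<open>f\<close> cancels against the transformation rule of \<open>v\<close>.\<close>

lemma differential_chart:
  assumes "smooth_fun A S f" "open S" "x \<in> S" "c \<in> A" "x \<in> fst c" "v \<in> tangent_space A x"
  shows "differential A f x v = frechet_derivative (\<lambda>y. f (chart_inv c y)) (at (snd c x)) (v c)"
proof -
  define d where "d = (SOME c. c \<in> A \<and> x \<in> fst c)"
  have d: "d \<in> A" "x \<in> fst d"
    using someI_ex[of "\<lambda>c. c \<in> A \<and> x \<in> fst c"] chart_exists[of x] d_def by blast+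
  have "((\<lambda>y. f (chart_inv c y)) has_derivative
      (\<lambda>u. frechet_derivative (\<lambda>y. f (chart_inv d y)) (at (snd d x)) (jac c d x u))) (at (snd c x))"
    by (rule has_derivative_change_chart[OF assms(4) d(1) assms(5) d(2)
          smooth_fun_has_derivative[OF assms(1,2,3) d]])
  then have "frechet_derivative (\<lambda>y. f (chart_inv c y)) (at (snd c x)) (v c) =
      frechet_derivative (\<lambda>y. f (chart_inv d y)) (at (snd d x)) (v d)"
    using frechet_derivative_at tangent_jac[OF assms(6,4) d(1) assms(5) d(2)] by metis
  then show ?thesis by (simp add: differential_def d_def Let_def comp_def)
qed

lemma vector_field_tangent: "X \<in> vector_fields A \<Longrightarrow> X x \<in> tangent_space A x"
  by (simp add: vector_fields_def)

lemma vector_field_smooth: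
  "X \<in> vector_fields A \<Longrightarrow> c \<in> A \<Longrightarrow> smooth_on (\<lambda>y. X (chart_inv c y) c) (snd c ` fst c)"
  by (simp add: vector_fields_def)

lemma vector_field_has_derivative:
  assumes "X \<in> vector_fields A" "c \<in> A" "x \<in> fst c"
  shows "((\<lambda>y. X (chart_inv c y) c) has_derivative
     frechet_derivative (\<lambda>y. X (chart_inv c y) c) (at (snd c x))) (at (snd c x))"
  using smooth_on_differentiable[OF _ vector_field_smooth[OF assms(1,2)]] assms
    chart_image_open_subset[OF assms(2) chart_open] by (auto simp flip: frechet_derivative_works)

lemma vector_field_local:
  assumes t: "\<And>x. X x \<in> tangent_space A x"
    and l: "\<And>x. \<exists>c\<in>A. \<exists>N. open N \<and> x \<in> N \<and> N \<subseteq> fst c \<and>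
      smooth_on (\<lambda>y. X (chart_inv c y) c) (snd c ` N)"
  shows "X \<in> vector_fields A"
proof -
  have "smooth_on (\<lambda>y. X (chart_inv d y) d) (snd d ` fst d)" if d: "d \<in> A" for d
  proof (rule smooth_on_local)
    fix y assume "y \<in> snd d ` fst d"
    then obtain x where x: "x \<in> fst d" "y = snd d x" by blast
    obtain c N where N: "c \<in> A" "open N" "x \<in> N" "N \<subseteq> fst c"
      "smooth_on (\<lambda>y. X (chart_inv c y) c) (snd c ` N)" using l[of x] by meson
    define N' where "N' = N \<inter> fst d"
    have N': "open N'" "x \<in> N'" "N' \<subseteq> fst c" "N' \<subseteq> fst d"
      using N x chart_open[OF d] by (auto simp: N'_def)
    \<comment> \<open>The \<open>d\<close>-coordinates of \<open>X\<close> are the Jacobian applied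
      to its \<open>c\<close>-coordinates. Smoothness of that expression is checked in
      \<open>c\<close> and then carried over.\<close>
    have "smooth_on (\<lambda>y. jac c d (chart_inv d y) (X (chart_inv d y) c)) (snd d ` N')"
    proof (rule smooth_on_change_chart[OF N(1) d N'(1,3,4)])
      have o: "open (snd c ` N')" "open (snd c ` (fst c \<inter> fst d))"
        using chart_image_open_subset N(1) N'(1,3) chart_image_open chart_open[OF d] by auto
      have "smooth_on (\<lambda>y. frechet_derivative (snd d \<circ> chart_inv c) (at y) (X (chart_inv c y) c))
          (snd c ` N')"
        using smooth_on_frechet_derivative_apply[OF o(2,1), of "\<lambda>y. y"
          "snd d \<circ> chart_inv c" "\<lambda>y. X (chart_inv c y) c"]
        using transition_smooth[OF N(1) d] N(5) N'(3,4) N'_def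
        by (auto simp: smooth_on_id intro: smooth_on_subset)
      then show "smooth_on (\<lambda>y. jac c d (chart_inv c y) (X (chart_inv c y) c)) (snd c ` N')"
        by (rule smooth_on_cong[rotated]) (use N(1) N'(3) in \<open>auto simp: jac_def chart_inv_left\<close>)
    qed
    then have "smooth_on (\<lambda>y. X (chart_inv d y) d) (snd d ` N')"
      by (rule smooth_on_cong[rotated])
         (use d N'(3,4) tangent_jac[OF t N(1) d, symmetric] in \<open>auto simp: chart_inv_left subset_iff\<close>)
    then show "\<exists>W. open W \<and> y \<in> W \<and> smooth_on (\<lambda>y. X (chart_inv d y) d) (W \<inter> snd d ` fst d)"
      using N' d x by (intro exI[of _ "snd d ` N'"] conjI chart_image_open_subset)
        (auto elim: smooth_on_subset)
  qed
  then show ?thesis using t by (simp add: vector_fields_def)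
qed

lemma vector_field_add:
  assumes "X \<in> vector_fields A" "Y \<in> vector_fields A" shows "X + Y \<in> vector_fields A"
  using assms tangent_add chart_image_open[OF _ open_UNIV]
  by (auto simp: vector_fields_def intro!: smooth_on_add)

lemma vector_field_zero: "0 \<in> vector_fields A"
  by (auto simp: vector_fields_def tangent_zero smooth_on_const)

lemma vector_field_sum:
  "(\<And>i. i \<in> I \<Longrightarrow> X i \<in> vector_fields A) \<Longrightarrow> sum X I \<in> vector_fields A"
  by (induction I rule: infinite_finite_induct) (auto intro: vector_field_zero vector_field_add)

lemma vector_field_scaleR:
  assumes "smooth_fun A UNIV f" "X \<in> vector_fields A"
  shows "(\<lambda>x. f x *\<^sub>R X x) \<in> vector_fields A"
  using assms tangent_scaleR chart_image_open[OF _ open_UNIV] smooth_funD[OF assms(1)]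
  by (auto simp: vector_fields_def scaleR_fun_def intro!: smooth_on_scaleR)

section \<open>Cutting off in a chart\<close>

text \<open>Closedness of \<open>K\<close> makes its complement open, so that extension by zero is
  smooth. The value 1 is required on a whole neighbourhood so that the bump contributes no
  derivative at \<open>x\<close>.\<close>

definition bump_at :: "('a, 'e) chart \<Rightarrow> 'a \<Rightarrow> ('a \<Rightarrow> real) \<Rightarrow> bool" where
  "bump_at c x \<beta> \<longleftrightarrow> smooth_fun A UNIV \<beta> \<and>
     (\<exists>K. closed K \<and> K \<subseteq> fst c \<and> (\<forall>y. y \<notin> K \<longrightarrow> \<beta> y = 0)) \<and>
     (\<exists>N. open N \<and> x \<in> N \<and> N \<subseteq> fst c \<and> (\<forall>y\<in>N. \<beta> y = 1))"

text \<open>Extension by zero: the domain of \<open>c\<close> and the complement of \<open>K\<close>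
  are open and cover the manifold, and on the latter the function vanishes identically.\<close>

lemma cutoff_smooth_fun:
  assumes "c \<in> A" "closed K" "K \<subseteq> fst c" "\<And>y. y \<notin> K \<Longrightarrow> f y = 0"
    and "smooth_on (\<lambda>y. f (chart_inv c y)) (snd c ` fst c)"
  shows "smooth_fun A UNIV f"
proof (rule smooth_fun_local)
  fix x
  show "\<exists>c\<in>A. \<exists>N. open N \<and> x \<in> N \<and> N \<subseteq> fst c \<and> smooth_on (\<lambda>y. f (chart_inv c y)) (snd c ` N)"
  proof (cases "x \<in> fst c")
    case True
    then show ?thesis
      using assms by (intro bexI[OF _ assms(1)] exI[of _ "fst c"]) (simp add: chart_open)
  next
    case False
    obtain d where d: "d \<in> A" "x \<in> fst d" by (rule chart_exists)
    have "smooth_on (\<lambda>y. f (chart_inv d y)) (snd d ` (fst d - K))"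
      by (rule smooth_on_cong[OF _ smooth_on_const[of 0]]) (use d assms in \<open>auto simp: chart_inv_left\<close>)
    then show ?thesis
      using d False assms chart_open[OF d(1)]
      by (intro bexI[OF _ d(1)] exI[of _ "fst d - K"]) auto
  qed
qed

lemma cutoff_vector_field:
  assumes "c \<in> A" "closed K" "K \<subseteq> fst c" "\<And>y. y \<notin> K \<Longrightarrow> X y = 0"
    and "\<And>y. y \<in> fst c \<Longrightarrow> X y \<in> tangent_space A y"
    and "smooth_on (\<lambda>y. X (chart_inv c y) c) (snd c ` fst c)"
  shows "X \<in> vector_fields A"
proof (rule vector_field_local)
  fix x
  show "X x \<in> tangent_space A x" 
  proof (cases "x \<in> fst c")
    case True
    then show ?thesis by (rule assms(5))
  next
    case False
    then have "X x = 0" using assms(3,4) by blast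
    then show ?thesis by (simp add: tangent_zero)
  qed
  show "\<exists>c\<in>A. \<exists>N. open N \<and> x \<in> N \<and> N \<subseteq> fst c \<and> smooth_on (\<lambda>y. X (chart_inv c y) c) (snd c ` N)"
  proof (cases "x \<in> fst c")
    case True
    then show ?thesis
      using assms by (intro bexI[OF _ assms(1)] exI[of _ "fst c"]) (simp add: chart_open)
  next
    case False
    obtain d where d: "d \<in> A" "x \<in> fst d" by (rule chart_exists)
    have "smooth_on (\<lambda>y. X (chart_inv d y) d) (snd d ` (fst d - K))"
      by (rule smooth_on_cong[OF _ smooth_on_const[of 0]]) (use d assms in \<open>auto simp: chart_inv_left\<close>)
    then show ?thesis
      using d False assms chart_open[OF d(1)]
      by (intro bexI[OF _ d(1)] exI[of _ "fst d - K"]) auto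
  qed
qed

lemma bump_exists:
  assumes "c \<in> A" "x \<in> fst c" obtains \<beta> where "bump_at c x \<beta>"
proof -
  have img: "open (snd c ` fst c)" using chart_image_open[OF assms(1) open_UNIV] by simp
  then obtain r where r: "r > 0" "cball (snd c x) r \<subseteq> snd c ` fst c"
    using assms(2) open_contains_cball by blast
  \<comment> \<open>With radius \<open>r/2\<close> the bump vanishes off the ball of radius
    \<open>r\<close>, so its support stays in the closed ball that defines \<open>K\<close>.\<close>
  obtain b :: "'e \<Rightarrow> real" where b: "smooth_on b UNIV" "\<And>y. y \<in> ball (snd c x) (r/2) \<Longrightarrow> b y = 1"
    "\<And>y. y \<notin> ball (snd c x) (2 * (r/2)) \<Longrightarrow> b y = 0"
    using bump_function_euclidean[of "r/2" "snd c x"] r(1) by auto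
  define \<beta> where "\<beta> = (\<lambda>y. if y \<in> fst c then b (snd c y) else 0)"
  define K where "K = chart_inv c ` cball (snd c x) r"
  have "compact K"
    unfolding K_def using chart_homeomorphism[OF assms(1)] r(2)
    by (intro compact_continuous_image compact_cball) (auto simp: homeomorphism_def elim: continuous_on_subset)
  \<comment> \<open>Compact sets are closed because the manifold is Hausdorff.\<close>
  then have K: "closed K" by (rule compact_imp_closed)
  have Kc: "K \<subseteq> fst c"
    using r(2) chart_inv_left[OF assms(1)] unfolding K_def by auto
  have 0: "\<beta> y = 0" if "y \<notin> K" for y
  proof (cases "y \<in> fst c")
    case True
    then have "snd c y \<notin> ball (snd c x) r"
      using that chart_inv_left[OF assms(1) True] unfolding K_def by (metis ball_subset_cball imageI subsetD)
    then show ?thesis using b(3) by (simp add: \<beta>_def)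
  qed (simp add: \<beta>_def)
  have "smooth_on (\<lambda>y. \<beta> (chart_inv c y)) (snd c ` fst c)"
    by (rule smooth_on_cong[OF _ smooth_on_subset[OF b(1)]])
       (auto simp: \<beta>_def chart_inv_left assms)
  then have s: "smooth_fun A UNIV \<beta>" using cutoff_smooth_fun[OF assms(1) K Kc 0] by simp
  define N where "N = fst c \<inter> snd c -` ball (snd c x) (r/2)"
  have "open N"
    unfolding N_def using chart_homeomorphism[OF assms(1)] chart_open[OF assms(1)]
    by (intro continuous_open_preimage) (auto simp: homeomorphism_def)
  moreover have "x \<in> N" "N \<subseteq> fst c" "\<forall>y\<in>N. \<beta> y = 1"
    using r assms b(2) by (auto simp: N_def \<beta>_def)
  ultimately show ?thesis using that s K Kc 0 unfolding bump_at_def by blast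
qed

lemma bump_smooth: "bump_at c x \<beta> \<Longrightarrow> smooth_fun A UNIV \<beta>"
  by (simp add: bump_at_def)

lemma bump_eq_1: "bump_at c x \<beta> \<Longrightarrow> \<beta> x = 1"
  by (auto simp: bump_at_def)

lemma bump_outside: "bump_at c x \<beta> \<Longrightarrow> y \<notin> fst c \<Longrightarrow> \<beta> y = 0"
  by (auto simp: bump_at_def)

lemma bump_cutoff_fun:
  assumes "bump_at c x \<beta>" "c \<in> A" "smooth_on (\<lambda>y. f (chart_inv c y)) (snd c ` fst c)"
  shows "smooth_fun A UNIV (\<lambda>y. \<beta> y * f y)"
proof -
  obtain K where "closed K" "K \<subseteq> fst c" "\<And>y. y \<notin> K \<Longrightarrow> \<beta> y = 0"
    using assms(1) by (auto simp: bump_at_def)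
  then show ?thesis
    using assms chart_image_open[OF assms(2) open_UNIV] smooth_funD[OF bump_smooth[OF assms(1)], of c "fst c"]
    by (intro cutoff_smooth_fun[of c K]) (auto intro!: smooth_on_mult)
qed

text \<open>The coordinate field with constant coordinates \<open>u\<close>, cut off so that it
  becomes a global field to which a connection can be applied.\<close>

definition ext :: "('a, 'e) chart \<Rightarrow> ('a \<Rightarrow> real) \<Rightarrow> 'e \<Rightarrow> 'a \<Rightarrow> ('a, 'e) tvec" where
  "ext c \<beta> u = (\<lambda>y. \<beta> y *\<^sub>R coord_vec A y c u)"

lemma ext_vector_field:
  assumes "bump_at c x \<beta>" "c \<in> A" shows "ext c \<beta> u \<in> vector_fields A"
proof -
  obtain K where "closed K" "K \<subseteq> fst c" "\<And>y. y \<notin> K \<Longrightarrow> \<beta> y = 0"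
    using assms(1) by (auto simp: bump_at_def)
  moreover have "smooth_on (\<lambda>y. ext c \<beta> u (chart_inv c y) c) (snd c ` fst c)"
    by (rule smooth_on_cong[OF _ smooth_on_scaleR[OF _
          smooth_funD[OF bump_smooth[OF assms(1)], of c "fst c"] smooth_on_const[of u]]])
       (use assms chart_image_open[OF assms(2) open_UNIV] in
         \<open>auto simp: ext_def chart_inv_left coord_vec_self scaleR_fun_def\<close>)
  ultimately show ?thesis
    using assms(2)
    by (intro cutoff_vector_field[of c K]) (auto simp: ext_def tangent_scaleR coord_vec_tangent)
qed

lemma ext_coord:
  "c \<in> A \<Longrightarrow> y \<in> fst c \<Longrightarrow> ext c \<beta> u y c = \<beta> y *\<^sub>R u"
  by (simp add: ext_def scaleR_fun_def coord_vec_self)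

lemma ext_at: "bump_at c x \<beta> \<Longrightarrow> ext c \<beta> u x = coord_vec A x c u"
  by (simp add: ext_def bump_eq_1)

end

section \<open>Affine connections in coordinates\<close>

lemma sum_fun_apply: "(\<Sum>i\<in>I. f i) x = (\<Sum>i\<in>I. f i x)"
  by (induction I rule: infinite_finite_induct) auto

locale connection = smooth_mfd A
  for A :: "('a::{t2_space, second_countable_topology}, 'e::euclidean_space) chart set" +
  fixes nabla :: "('a, 'e) connection"
  assumes conn: "affine_connection A nabla"
begin

lemma nabla_vector_field:
  "X \<in> vector_fields A \<Longrightarrow> Y \<in> vector_fields A \<Longrightarrow> nabla X Y \<in> vector_fields A"
  using conn by (simp add: affine_connection_def)

lemma nabla_add_left:
  "X \<in> vector_fields A \<Longrightarrow> X' \<in> vector_fields A \<Longrightarrow> Y \<in> vector_fields A \<Longrightarrow>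
     nabla (X + X') Y = nabla X Y + nabla X' Y"
  using conn by (simp add: affine_connection_def)

lemma nabla_add_right:
  "X \<in> vector_fields A \<Longrightarrow> Y \<in> vector_fields A \<Longrightarrow> Y' \<in> vector_fields A \<Longrightarrow>
     nabla X (Y + Y') = nabla X Y + nabla X Y'"
  using conn by (simp add: affine_connection_def)

lemma nabla_scaleR_left:
  "smooth_fun A UNIV f \<Longrightarrow> X \<in> vector_fields A \<Longrightarrow> Y \<in> vector_fields A \<Longrightarrow>
     nabla (\<lambda>x. f x *\<^sub>R X x) Y = (\<lambda>x. f x *\<^sub>R nabla X Y x)"
  using conn by (simp add: affine_connection_def)

lemma nabla_scaleR_right:
  "smooth_fun A UNIV f \<Longrightarrow> X \<in> vector_fields A \<Longrightarrow> Y \<in> vector_fields A \<Longrightarrow>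
     nabla X (\<lambda>x. f x *\<^sub>R Y x) = (\<lambda>x. differential A f x (X x) *\<^sub>R Y x + f x *\<^sub>R nabla X Y x)"
  using conn by (simp add: affine_connection_def)

lemma nabla_zero_left: "Y \<in> vector_fields A \<Longrightarrow> nabla 0 Y = 0"
  using nabla_add_left[of 0 0 Y] vector_field_zero by simp

lemma nabla_zero_right: "X \<in> vector_fields A \<Longrightarrow> nabla X 0 = 0"
  using nabla_add_right[of X 0 0] vector_field_zero by simp

lemma nabla_sum_left:
  assumes "Y \<in> vector_fields A" "\<And>i. i \<in> I \<Longrightarrow> X i \<in> vector_fields A"
  shows "nabla (\<Sum>i\<in>I. X i) Y = (\<Sum>i\<in>I. nabla (X i) Y)"
  using assms(2)
  by (induction I rule: infinite_finite_induct)
     (simp_all add: nabla_zero_left nabla_add_left assms(1) vector_field_sum)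

lemma nabla_sum_right:
  assumes "X \<in> vector_fields A" "\<And>i. i \<in> I \<Longrightarrow> Y i \<in> vector_fields A"
  shows "nabla X (\<Sum>i\<in>I. Y i) = (\<Sum>i\<in>I. nabla X (Y i))"
  using assms(2)
  by (induction I rule: infinite_finite_induct)
     (simp_all add: nabla_zero_right nabla_add_right assms(1) vector_field_sum)

text \<open>The bump enters twice because one factor is spent on each coefficient and one on each
  frame field; both must be smooth globally.\<close>

lemma bump_expansion:
  assumes "bump_at c x \<beta>" "c \<in> A" "X \<in> vector_fields A"
  shows "(\<lambda>y. \<beta> y *\<^sub>R (\<beta> y *\<^sub>R X y)) =
    (\<Sum>b\<in>Basis. (\<lambda>y. (\<beta> y * (X y c \<bullet> b)) *\<^sub>R ext c \<beta> b y))"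
proof
  fix y
  show "\<beta> y *\<^sub>R (\<beta> y *\<^sub>R X y) = (\<Sum>b\<in>Basis. (\<lambda>y. (\<beta> y * (X y c \<bullet> b)) *\<^sub>R ext c \<beta> b y)) y"
  proof (cases "y \<in> fst c")
    case True
    have "\<beta> y *\<^sub>R (\<beta> y *\<^sub>R X y) = (\<beta> y * \<beta> y) *\<^sub>R (\<Sum>b\<in>Basis. (X y c \<bullet> b) *\<^sub>R coord_vec A y c b)"
      using tangent_expansion[OF assms(2) True vector_field_tangent[OF assms(3), of y]] by simp
    then show ?thesis
      by (simp add: sum_fun_apply ext_def scaleR_sum_right mult_ac)
  next
    case False
    then show ?thesis
      using bump_outside[OF assms(1) False] by (simp add: sum_fun_apply)
  qed
qed

lemma bump_coefficient:
  assumes "bump_at c x \<beta>" "c \<in> A" "X \<in> vector_fields A"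
  shows "smooth_fun A UNIV (\<lambda>y. \<beta> y * (X y c \<bullet> b))"
  using chart_image_open[OF assms(2) open_UNIV] vector_field_smooth[OF assms(3,2)]
  by (intro bump_cutoff_fun[OF assms(1,2)] smooth_on_inner) simp_all

lemma nabla_expand_left:
  assumes "bump_at c x \<beta>" "c \<in> A" "X \<in> vector_fields A" "Y \<in> vector_fields A"
  shows "nabla X Y x = (\<Sum>b\<in>Basis. (X x c \<bullet> b) *\<^sub>R nabla (ext c \<beta> b) Y x)"
proof -
  note sm = bump_smooth[OF assms(1)] and vf = ext_vector_field[OF assms(1,2)]
    and bc = bump_coefficient[OF assms(1-3)]
  \<comment> \<open>Linearity over functions and \<open>\<beta> x = 1\<close> allow \<open>X\<close>
    to be replaced by its cut-off, which has a global frame expansion.\<close>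
  have "nabla X Y x = nabla (\<lambda>y. \<beta> y *\<^sub>R (\<beta> y *\<^sub>R X y)) Y x"
    using assms
    by (simp add: nabla_scaleR_left sm vector_field_scaleR bump_eq_1[OF assms(1)] del: scaleR_scaleR)
  also have "nabla (\<lambda>y. \<beta> y *\<^sub>R (\<beta> y *\<^sub>R X y)) Y x =
      (\<Sum>b\<in>Basis. nabla (\<lambda>y. (\<beta> y * (X y c \<bullet> b)) *\<^sub>R ext c \<beta> b y) Y) x"
    unfolding bump_expansion[OF assms(1-3)]
    by (subst nabla_sum_left) (auto intro: assms vector_field_scaleR bc vf)
  also have "\<dots> = (\<Sum>b\<in>Basis. (X x c \<bullet> b) *\<^sub>R nabla (ext c \<beta> b) Y x)"
    by (simp add: sum_fun_apply nabla_scaleR_left[OF bc vf assms(4)] bump_eq_1[OF assms(1)])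
  finally show ?thesis .
qed

text \<open>Only the coordinates of \<open>X x\<close> enter \<open>nabla_expand_left\<close>. Hence
  different extensions of a curve's velocity give the same covariant derivative.\<close>

lemma nabla_tensorial:
  assumes "X \<in> vector_fields A" "X' \<in> vector_fields A" "Y \<in> vector_fields A" "X x = X' x"
  shows "nabla X Y x = nabla X' Y x"
proof -
  obtain c where c: "c \<in> A" "x \<in> fst c" by (rule chart_exists)
  obtain \<beta> where \<beta>: "bump_at c x \<beta>" by (rule bump_exists[OF c])
  show ?thesis
    using nabla_expand_left[OF \<beta> c(1) assms(1,3)] nabla_expand_left[OF \<beta> c(1) assms(2,3)] assms(4)
    by simp
qed

lemma bump_differential:
  assumes "bump_at c x \<beta>" "c \<in> A" "v \<in> tangent_space A x"
    and f: "smooth_fun A UNIV (\<lambda>y. \<beta> y * f y)"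
    and D: "((\<lambda>y. f (chart_inv c y)) has_derivative D) (at (snd c x))"
  shows "differential A (\<lambda>y. \<beta> y * f y) x v = D (v c)"
proof -
  obtain N where N: "open N" "x \<in> N" "N \<subseteq> fst c" "\<And>y. y \<in> N \<Longrightarrow> \<beta> y = 1"
    using assms(1) by (auto simp: bump_at_def)
  have "((\<lambda>y. \<beta> (chart_inv c y) * f (chart_inv c y)) has_derivative D) (at (snd c x))"
    by (rule has_derivative_transform_within_open[OF D chart_image_open_subset[OF assms(2) N(1,3)]])
       (use N assms(2) in \<open>auto simp: chart_inv_left subset_iff\<close>)
  note this[THEN frechet_derivative_at, symmetric]
  moreover have "x \<in> fst c" using N by blast
  ultimately show ?thesis
    using differential_chart[OF f open_UNIV UNIV_I assms(2) _ assms(3)] by simp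
qed

lemma nabla_expand_right:
  assumes "bump_at c x \<beta>" "c \<in> A" "x \<in> fst c" "X \<in> vector_fields A" "Y \<in> vector_fields A"
    and D: "((\<lambda>y. Y (chart_inv c y) c) has_derivative D) (at (snd c x))"
  shows "nabla X Y x = coord_vec A x c (D (X x c)) +
    (\<Sum>b\<in>Basis. (Y x c \<bullet> b) *\<^sub>R nabla X (ext c \<beta> b) x)"
proof -
  note sm = bump_smooth[OF assms(1)] and vf = ext_vector_field[OF assms(1,2)]
    and bc = bump_coefficient[OF assms(1,2,5)] and b1 = bump_eq_1[OF assms(1)]
    and tX = vector_field_tangent[OF assms(4)]
  \<comment> \<open>In the direction slot only the value of the bump mattered; here the Leibniz rule
    also differentiates it, and this term vanishes because the bump is 1 near
    \<open>x\<close>.\<close>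
  have d0: "differential A \<beta> x (X x) = 0"
    using bump_differential[OF assms(1,2) tX, of "\<lambda>_. 1" "\<lambda>_. 0"] sm by simp
  have db: "differential A (\<lambda>y. \<beta> y * (Y y c \<bullet> b)) x (X x) = D (X x c) \<bullet> b" for b
    by (rule bump_differential[OF assms(1,2) tX bc]) (rule has_derivative_inner_left[OF D])
  have "nabla X Y x = nabla X (\<lambda>y. \<beta> y *\<^sub>R (\<beta> y *\<^sub>R Y y)) x"
    using assms by (simp add: nabla_scaleR_right sm vector_field_scaleR b1 d0 del: scaleR_scaleR)
  also have "nabla X (\<lambda>y. \<beta> y *\<^sub>R (\<beta> y *\<^sub>R Y y)) x =
      (\<Sum>b\<in>Basis. nabla X (\<lambda>y. (\<beta> y * (Y y c \<bullet> b)) *\<^sub>R ext c \<beta> b y)) x"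
    unfolding bump_expansion[OF assms(1,2,5)]
    by (subst nabla_sum_right) (auto intro: assms vector_field_scaleR bc vf)
  also have "\<dots> = (\<Sum>b\<in>Basis. (D (X x c) \<bullet> b) *\<^sub>R coord_vec A x c b) +
      (\<Sum>b\<in>Basis. (Y x c \<bullet> b) *\<^sub>R nabla X (ext c \<beta> b) x)"
    by (simp add: sum_fun_apply nabla_scaleR_right[OF bc assms(4) vf] b1 db ext_at[OF assms(1)]
        sum.distrib)
  also have "(\<Sum>b\<in>Basis. (D (X x c) \<bullet> b) *\<^sub>R coord_vec A x c b) = coord_vec A x c (D (X x c))"
    by (rule linear_euclidean_expansion[OF coord_vec_linear[OF assms(2,3)], symmetric])
  finally show ?thesis .
qed

text \<open>By \<open>nabla_coord\<close> the value does not depend on the choice of the bump function.\<close>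

definition christoffel :: "('a, 'e) chart \<Rightarrow> 'a \<Rightarrow> 'e \<Rightarrow> 'e \<Rightarrow> 'e" where
  "christoffel c x a b =
     (let \<beta> = (SOME \<beta>. bump_at c x \<beta>) in nabla (ext c \<beta> a) (ext c \<beta> b) x c)"

definition christoffel_map :: "('a, 'e) chart \<Rightarrow> 'a \<Rightarrow> 'e \<Rightarrow> 'e \<Rightarrow> 'e" where
  "christoffel_map c x u v = (\<Sum>a\<in>Basis. \<Sum>b\<in>Basis. ((u \<bullet> a) * (v \<bullet> b)) *\<^sub>R christoffel c x a b)"

text \<open>Expanding \<open>Y\<close> in the cut-off coordinate frame produces the derivative term
  by the Leibniz rule; expanding \<open>X\<close> reduces the rest to derivatives of frame fields
  along frame fields, the Christoffel symbols.\<close>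

lemma nabla_coord:
  assumes "c \<in> A" "x \<in> fst c" "X \<in> vector_fields A" "Y \<in> vector_fields A"
    and D: "((\<lambda>y. Y (chart_inv c y) c) has_derivative D) (at (snd c x))"
  shows "nabla X Y x c = D (X x c) + christoffel_map c x (X x c) (Y x c)"
proof -
  define \<beta> where "\<beta> = (SOME \<beta>. bump_at c x \<beta>)"
  have \<beta>: "bump_at c x \<beta>" using bump_exists[OF assms(1,2)] someI_ex[of "bump_at c x"] \<beta>_def by metis
  have "nabla X Y x = coord_vec A x c (D (X x c)) + (\<Sum>b\<in>Basis. (Y x c \<bullet> b) *\<^sub>R
      (\<Sum>a\<in>Basis. (X x c \<bullet> a) *\<^sub>R nabla (ext c \<beta> a) (ext c \<beta> b) x))"
    using nabla_expand_right[OF \<beta> assms(1-4) D]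
    by (simp add: nabla_expand_left[OF \<beta> assms(1,3) ext_vector_field[OF \<beta> assms(1)]])
  then have "nabla X Y x c = D (X x c) + (\<Sum>b\<in>Basis. (Y x c \<bullet> b) *\<^sub>R
      (\<Sum>a\<in>Basis. (X x c \<bullet> a) *\<^sub>R christoffel c x a b))"
    by (simp add: sum_fun_apply coord_vec_self assms scaleR_fun_def christoffel_def \<beta>_def Let_def)
  also have "(\<Sum>b\<in>Basis. (Y x c \<bullet> b) *\<^sub>R (\<Sum>a\<in>Basis. (X x c \<bullet> a) *\<^sub>R christoffel c x a b)) =
      christoffel_map c x (X x c) (Y x c)"
    unfolding christoffel_map_def scaleR_sum_right by (subst sum.swap) (simp add: mult_ac)
  finally show ?thesis .
qed

lemma christoffel_map_add_right: "christoffel_map c x u (v + w) = christoffel_map c x u v + christoffel_map c x u w"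
  by (simp add: christoffel_map_def inner_add_left algebra_simps sum.distrib)

lemma christoffel_map_scaleR_right: "christoffel_map c x u (r *\<^sub>R v) = r *\<^sub>R christoffel_map c x u v"
  by (simp add: christoffel_map_def scaleR_sum_right mult_ac)

lemma christoffel_map_linear: "linear (christoffel_map c x u)"
  by (intro linearI christoffel_map_add_right christoffel_map_scaleR_right)

lemma christoffel_map_Basis: "a \<in> Basis \<Longrightarrow> b \<in> Basis \<Longrightarrow> christoffel_map c x a b = christoffel c x a b"
  by (simp add: christoffel_map_def inner_Basis if_distrib[of "\<lambda>r. r * _"] if_distrib[of "\<lambda>r. _ * r"]
      if_distrib[of "\<lambda>r. r *\<^sub>R _"] sum.delta cong: if_cong)

text \<open>On \<open>N\<close> the frame field has constant coordinates, so only the Christoffel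
  term survives. One bump thus serves all points of \<open>N\<close>.\<close>

lemma nabla_ext_coord:
  assumes "bump_at c x \<beta>" "c \<in> A" "open N" "N \<subseteq> fst c" "\<And>y. y \<in> N \<Longrightarrow> \<beta> y = 1" "y \<in> N"
    and X: "X \<in> vector_fields A"
  shows "nabla X (ext c \<beta> v) y c = christoffel_map c y (X y c) v"
proof -
  have "((\<lambda>z. ext c \<beta> v (chart_inv c z) c) has_derivative (\<lambda>_. 0)) (at (snd c y))"
    by (rule has_derivative_transform_within_open[of "\<lambda>_. v", OF has_derivative_const
          chart_image_open_subset[OF assms(2,3,4)]])
       (use assms in \<open>auto simp: chart_inv_left ext_coord subset_iff\<close>)
  then show ?thesis
    using nabla_coord[OF assms(2) _ X ext_vector_field[OF assms(1,2)]] assms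
    by (auto simp: ext_coord)
qed

text \<open>Each symbol is defined with a bump chosen for its own point, so continuity is not
  immediate. Near a given point one fixed bump computes all symbols, as coordinates of a smooth
  field.\<close>

lemma christoffel_continuous:
  assumes "c \<in> A" "a \<in> Basis" "b \<in> Basis"
  shows "continuous_on (fst c) (\<lambda>x. christoffel c x a b)"
proof -
  have "isCont (\<lambda>x. christoffel c x a b) x" if x: "x \<in> fst c" for x
  proof -
    obtain \<beta> where \<beta>: "bump_at c x \<beta>" by (rule bump_exists[OF assms(1) x])
    then obtain N where N: "open N" "x \<in> N" "N \<subseteq> fst c" "\<And>y. y \<in> N \<Longrightarrow> \<beta> y = 1"
      by (auto simp: bump_at_def)
    note vf = ext_vector_field[OF \<beta> assms(1)]
    have 1: "continuous_on (snd c ` fst c) (\<lambda>z. nabla (ext c \<beta> a) (ext c \<beta> b) (chart_inv c z) c)"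
      by (intro smooth_on_imp_continuous_on vector_field_smooth nabla_vector_field vf assms)
    have 2: "continuous_on (fst c) (snd c)"
      using chart_homeomorphism[OF assms(1)] by (simp add: homeomorphism_def)
    have "continuous_on (fst c) (\<lambda>y. nabla (ext c \<beta> a) (ext c \<beta> b) (chart_inv c (snd c y)) c)"
      by (rule continuous_on_compose2[OF 1 2]) simp
    then have "continuous_on N (\<lambda>y. christoffel c y a b)"
    proof (rule continuous_on_eq[OF continuous_on_subset[OF _ N(3)]])
      fix y assume y: "y \<in> N"
      have "nabla (ext c \<beta> a) (ext c \<beta> b) y c = christoffel_map c y a b"
        using nabla_ext_coord[OF \<beta> assms(1) N(1,3,4) y vf] N y assms(1)
        by (auto simp: ext_coord)
      then show "nabla (ext c \<beta> a) (ext c \<beta> b) (chart_inv c (snd c y)) c = christoffel c y a b"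
        using y N(3) assms by (auto simp: chart_inv_left christoffel_map_Basis subset_iff)
    qed
    then show ?thesis using N by (simp add: continuous_on_eq_continuous_at)
  qed
  then show ?thesis by (simp add: continuous_at_imp_continuous_on)
qed

end

section \<open>Curves\<close>

context smooth_mfd
begin

text \<open>A smooth curve has local smooth extensions across the end points of
  \<open>[0,1]\<close>; their ordinary derivatives provide the one-sided ones and show
  continuity.\<close>

lemma curve_in_chart:
  assumes "smooth_curve A \<gamma>" "t \<in> {0..1}" "c \<in> A" "\<gamma> t \<in> fst c"
  obtains W h' where "open W" "t \<in> W" "continuous_on W h'" "\<And>s. s \<in> W \<Longrightarrow> s \<in> {0..1} \<Longrightarrow> \<gamma> s \<in> fst c"
    "\<And>s. s \<in> W \<Longrightarrow> s \<in> {0..1} \<Longrightarrow> (snd c \<circ> \<gamma> has_vector_derivative h' s) (at s within {0..1})"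
proof -
  have "continuous_on {0..1} \<gamma>" using assms(1) by (simp add: smooth_curve_def)
  then have "openin (top_of_set {0..1}) ({0..1} \<inter> \<gamma> -` fst c)"
    using continuous_openin_preimage_gen chart_open[OF assms(3)] by blast
  then obtain T where T: "open T" "{0..1} \<inter> \<gamma> -` fst c = {0..1} \<inter> T"
    by (auto simp: openin_open)
  have 1: "smooth_on (snd c \<circ> \<gamma>) {s \<in> {0..1}. \<gamma> s \<in> fst c}"
    using assms(1,3) by (auto simp: smooth_curve_def)
  have 2: "t \<in> {s \<in> {0..1}. \<gamma> s \<in> fst c}" using assms by simp
  obtain W h where W: "open W" "t \<in> W" "\<And>k. Ck_on k h W"
    "\<And>s. s \<in> W \<Longrightarrow> s \<in> {s \<in> {0..1}. \<gamma> s \<in> fst c} \<Longrightarrow> (snd c \<circ> \<gamma>) s = h s"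
    by (rule smooth_onE[OF 1 2]) (rule that)
  \<comment> \<open>Besides admitting the extension \<open>h\<close>, the neighbourhood must keep
    the curve inside the chart.\<close>
  define W' where "W' = W \<inter> T"
  define h' where "h' = (\<lambda>s. frechet_derivative h (at s) 1)"
  have "t \<in> T" using T(2) assms(2,4) by blast
  then have W': "open W'" "t \<in> W'" using W(1,2) T(1) by (auto simp: W'_def)
  have in_c: "\<gamma> s \<in> fst c" if "s \<in> W'" "s \<in> {0..1}" for s
  proof -
    have "s \<in> {0..1} \<inter> T" using that by (simp add: W'_def)
    then show ?thesis unfolding T(2)[symmetric] by simp
  qed
  have h: "Ck_on (Suc 0) h W'" by (rule Ck_on_subset[OF W(3)]) (simp add: W'_def)
  have "(snd c \<circ> \<gamma> has_vector_derivative h' s) (at s within {0..1})"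
    if s: "s \<in> W'" "s \<in> {0..1}" for s
  proof -
    have d: "h differentiable (at s)"
      using h W'(1) s(1) by (simp add: differentiable_on_eq_differentiable_at)
    have "frechet_derivative h (at s) r = r *\<^sub>R h' s" for r
      using linear_cmul[OF linear_frechet_derivative[OF d], of r 1] by (simp add: h'_def)
    then have "(h has_vector_derivative h' s) (at s)"
      using d unfolding frechet_derivative_works has_vector_derivative_def by presburger
    then have hs: "(h has_vector_derivative h' s) (at s within {0..1})"
      by (rule has_vector_derivative_at_within)
    obtain e where e: "e > 0" "ball s e \<subseteq> W'" using W'(1) s(1) open_contains_ball by blast
    show ?thesis
    proof (rule has_vector_derivative_transform_within[OF hs e(1) s(2)])
      fix x assume x: "x \<in> {0..1}" "dist x s < e"
      then have "x \<in> W'" using e(2) by (auto simp: dist_commute)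
      then show "h x = (snd c \<circ> \<gamma>) x" using W(4)[of x] in_c[OF _ x(1)] x(1) by (simp add: W'_def)
    qed
  qed
  moreover have "continuous_on W' h'" using h by (simp add: h'_def)
  ultimately show ?thesis using that W' in_c by blast
qed

lemma velocity_coord:
  assumes "smooth_curve A \<gamma>" "t \<in> {0..1}" "c \<in> A" "\<gamma> t \<in> fst c"
  shows "(snd c \<circ> \<gamma> has_vector_derivative velocity A \<gamma> t c) (at t within {0..1})"
proof -
  obtain h' where "(snd c \<circ> \<gamma> has_vector_derivative h') (at t within {0..1})"
    using curve_in_chart[OF assms] assms(2) by metis
  moreover from this have "velocity A \<gamma> t c = h'"
    using assms vector_derivative_within_closed_interval[of 0 1 t "snd c \<circ> \<gamma>" h']
    by (simp add: velocity_def)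
  ultimately show ?thesis by simp
qed

lemma velocity_coordI:
  assumes "t \<in> {0..1}" "c \<in> A" "\<gamma> t \<in> fst c"
    and "(snd c \<circ> \<gamma> has_vector_derivative v) (at t within {0..1})"
  shows "velocity A \<gamma> t c = v"
  using assms vector_derivative_within_closed_interval[of 0 1 t "snd c \<circ> \<gamma>" v]
  by (simp add: velocity_def)

lemma velocity_continuous:
  assumes "smooth_curve A \<gamma>" "c \<in> A" "\<gamma> ` {0..1} \<subseteq> fst c"
  shows "continuous_on {0..1} (\<lambda>t. velocity A \<gamma> t c)"
  unfolding continuous_on_eq_continuous_within
proof
  fix t :: real assume t: "t \<in> {0..1}"
  then have "\<gamma> t \<in> fst c" using assms(3) by blast
  with assms t obtain W h' where W: "open W" "t \<in> W" "continuous_on W h'"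
    "\<And>s. s \<in> W \<Longrightarrow> s \<in> {0..1} \<Longrightarrow> \<gamma> s \<in> fst c"
    "\<And>s. s \<in> W \<Longrightarrow> s \<in> {0..1} \<Longrightarrow> (snd c \<circ> \<gamma> has_vector_derivative h' s) (at s within {0..1})"
    using curve_in_chart by metis
  obtain e where e: "e > 0" "ball t e \<subseteq> W" using W open_contains_ball by blast
  have "continuous (at t within {0..1}) h'"
    using W(1-3) continuous_at_imp_continuous_within continuous_on_eq_continuous_at by blast
  then show "continuous (at t within {0..1}) (\<lambda>t. velocity A \<gamma> t c)"
  proof (rule continuous_transform_within[OF _ e(1) t])
    fix s :: real assume s: "s \<in> {0..1}" "dist s t < e"
    then have "s \<in> W" using e(2) by (auto simp: dist_commute)
    then show "h' s = velocity A \<gamma> s c"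
      using velocity_coordI[of s c \<gamma> "h' s"] W s assms by auto
  qed
qed

lemma curve_near:
  assumes "smooth_curve A \<gamma>" "t \<in> {0..1}" "open N" "\<gamma> t \<in> N"
  obtains \<delta> where "\<delta> > 0" "\<And>s. s \<in> {0..1} \<Longrightarrow> dist s t < \<delta> \<Longrightarrow> \<gamma> s \<in> N"
proof -
  have "continuous_on {0..1} \<gamma>" using assms(1) by (simp add: smooth_curve_def)
  then have "openin (top_of_set {0..1}) ({0..1} \<inter> \<gamma> -` N)"
    using continuous_openin_preimage_gen assms(3) by blast
  then obtain T where T: "open T" "{0..1} \<inter> \<gamma> -` N = {0..1} \<inter> T"
    by (auto simp: openin_open)
  then have "t \<in> T" using assms by blast
  then obtain \<delta> where "\<delta> > 0" "ball t \<delta> \<subseteq> T" using T(1) open_contains_ball by blast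
  then show ?thesis
    using T(2) by (intro that[of \<delta>]) (auto simp: dist_commute set_eq_iff subset_iff)
qed

text \<open>The target of \<open>f\<close> is kept general so that the rule serves real functions,
  coordinate maps and coordinates of vector fields.\<close>

lemma curve_chain:
  assumes "smooth_curve A \<gamma>" "t \<in> {0..1}" "c \<in> A" "\<gamma> t \<in> fst c"
    and D: "((\<lambda>y. f (chart_inv c y)) has_derivative D) (at (snd c (\<gamma> t)))"
  shows "((\<lambda>s. f (\<gamma> s)) has_vector_derivative D (velocity A \<gamma> t c)) (at t within {0..1})"
proof -
  have "((\<lambda>s. f (chart_inv c ((snd c \<circ> \<gamma>) s))) has_derivative (\<lambda>r. D (r *\<^sub>R velocity A \<gamma> t c)))
      (at t within {0..1})"
    by (rule has_derivative_compose[OF velocity_coord[OF assms(1-4), unfolded has_vector_derivative_def]])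
       (simp add: D)
  then have *: "((\<lambda>s. f (chart_inv c ((snd c \<circ> \<gamma>) s))) has_vector_derivative D (velocity A \<gamma> t c))
      (at t within {0..1})"
    using linear_cmul[OF has_derivative_linear[OF D]] by (simp add: has_vector_derivative_def)
  obtain \<delta> where \<delta>: "\<delta> > 0" "\<And>s. s \<in> {0..1} \<Longrightarrow> dist s t < \<delta> \<Longrightarrow> \<gamma> s \<in> fst c"
    using curve_near[OF assms(1,2) chart_open[OF assms(3)] assms(4)] by blast
  show ?thesis
    by (rule has_vector_derivative_transform_within[OF * \<delta>(1) assms(2)])
       (simp add: \<delta>(2) chart_inv_left assms(3))
qed

lemma velocity_tangent:
  assumes "smooth_curve A \<gamma>" "t \<in> {0..1}" shows "velocity A \<gamma> t \<in> tangent_space A (\<gamma> t)"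
proof (rule tangentI)
  fix c assume "\<not> (c \<in> A \<and> \<gamma> t \<in> fst c)"
  then show "velocity A \<gamma> t c = 0" by (auto simp: velocity_def)
next
  fix c d assume c: "c \<in> A" "d \<in> A" "\<gamma> t \<in> fst c" "\<gamma> t \<in> fst d"
  have "((\<lambda>s. snd d (\<gamma> s)) has_vector_derivative jac c d (\<gamma> t) (velocity A \<gamma> t c)) (at t within {0..1})"
    using curve_chain[OF assms c(1,3), of "snd d"] jac_has_derivative[OF c] by (simp add: comp_def)
  then show "velocity A \<gamma> t d = jac c d (\<gamma> t) (velocity A \<gamma> t c)"
    using velocity_coordI[of t d \<gamma>] assms(2) c(2,4) by (simp add: comp_def)
qed

end

section \<open>Parallel transport\<close>

context connection
begin

text \<open>The representing fields, their coefficients and the extension of the velocity all drop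
  out through \<open>nabla_coord\<close>. Thus \<open>D\<close> is determined by \<open>V\<close>,
  and being parallel becomes a linear differential equation.\<close>

lemma covariant_derivative_coord:
  assumes "smooth_curve A \<gamma>" "t \<in> {0..1}" "c \<in> A" "\<gamma> t \<in> fst c"
    and cd: "has_covariant_derivative A nabla \<gamma> V t D"
  shows "((\<lambda>s. V s c) has_vector_derivative D c - christoffel_map c (\<gamma> t) (velocity A \<gamma> t c) (V t c))
    (at t within {0..1})"
proof -
  obtain n :: nat and E f f' X \<delta> where E: "\<And>i. i < n \<Longrightarrow> E i \<in> vector_fields A"
    and f: "\<And>i. i < n \<Longrightarrow> (f i has_real_derivative f' i) (at t within {0..1})"
    and \<delta>: "\<delta> > 0" "\<And>s. s \<in> {0..1} \<Longrightarrow> \<bar>s - t\<bar> < \<delta> \<Longrightarrow> V s = (\<Sum>i<n. f i s *\<^sub>R E i (\<gamma> s))"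
    and X: "X \<in> vector_fields A" "X (\<gamma> t) = velocity A \<gamma> t"
    and D: "D = (\<Sum>i<n. f' i *\<^sub>R E i (\<gamma> t) + f i t *\<^sub>R nabla X (E i) (\<gamma> t))"
    using cd unfolding has_covariant_derivative_def by blast
  let ?v = "velocity A \<gamma> t c"
  define DE where "DE = (\<lambda>i. frechet_derivative (\<lambda>y. E i (chart_inv c y) c) (at (snd c (\<gamma> t))))"
  have DE: "((\<lambda>y. E i (chart_inv c y) c) has_derivative DE i) (at (snd c (\<gamma> t)))" if "i < n" for i
    unfolding DE_def using vector_field_has_derivative[OF E[OF that] assms(3,4)] .
  have Vt: "V t c = (\<Sum>i<n. f i t *\<^sub>R E i (\<gamma> t) c)"
    using \<delta> assms(2) by (simp add: sum_fun_apply scaleR_fun_def)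
  have "D c = (\<Sum>i<n. f' i *\<^sub>R E i (\<gamma> t) c + f i t *\<^sub>R (DE i ?v + christoffel_map c (\<gamma> t) ?v (E i (\<gamma> t) c)))"
    unfolding D using nabla_coord[OF assms(3,4) X(1) E DE] X(2)
    by (simp add: sum_fun_apply scaleR_fun_def)
  also have "\<dots> = (\<Sum>i<n. f i t *\<^sub>R DE i ?v + f' i *\<^sub>R E i (\<gamma> t) c) + christoffel_map c (\<gamma> t) ?v (V t c)"
    unfolding Vt by (simp add: linear_sum[OF christoffel_map_linear] linear_cmul[OF christoffel_map_linear]
        scaleR_add_right sum.distrib algebra_simps)
  finally have Dc: "(\<Sum>i<n. f i t *\<^sub>R DE i ?v + f' i *\<^sub>R E i (\<gamma> t) c) = D c - christoffel_map c (\<gamma> t) ?v (V t c)"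
    by simp
  have "((\<lambda>s. \<Sum>i<n. f i s *\<^sub>R E i (\<gamma> s) c) has_vector_derivative
      (\<Sum>i<n. f i t *\<^sub>R DE i ?v + f' i *\<^sub>R E i (\<gamma> t) c)) (at t within {0..1})"
    by (intro has_vector_derivative_sum has_vector_derivative_scaleR f
        curve_chain[OF assms(1-4) DE]) auto
  then have "((\<lambda>s. V s c) has_vector_derivative (\<Sum>i<n. f i t *\<^sub>R DE i ?v + f' i *\<^sub>R E i (\<gamma> t) c))
      (at t within {0..1})"
    by (rule has_vector_derivative_transform_within[OF _ \<delta>(1) assms(2)])
       (simp add: \<delta>(2) dist_real_def sum_fun_apply scaleR_fun_def)
  then show ?thesis unfolding Dc .
qed

text \<open>Converse of \<open>covariant_derivative_coord\<close> for \<open>D = 0\<close>: the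
  cut-off coordinate frame is the witness, with the coordinates of \<open>V\<close> as
  coefficients.\<close>

lemma covariant_derivative_zeroI:
  assumes \<gamma>: "smooth_curve A \<gamma>" "t \<in> {0..1}" "c \<in> A" "\<gamma> t \<in> fst c"
    and V: "\<And>s. s \<in> {0..1} \<Longrightarrow> V s \<in> tangent_space A (\<gamma> s)"
    and d: "((\<lambda>s. V s c) has_vector_derivative - christoffel_map c (\<gamma> t) (velocity A \<gamma> t c) (V t c))
      (at t within {0..1})"
  shows "has_covariant_derivative A nabla \<gamma> V t 0"
proof -
  let ?v = "velocity A \<gamma> t c" and ?W = "- christoffel_map c (\<gamma> t) (velocity A \<gamma> t c) (V t c)"
  obtain \<beta> where \<beta>: "bump_at c (\<gamma> t) \<beta>" by (rule bump_exists[OF \<gamma>(3,4)])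
  then obtain N where N: "open N" "\<gamma> t \<in> N" "N \<subseteq> fst c" "\<And>y. y \<in> N \<Longrightarrow> \<beta> y = 1"
    by (auto simp: bump_at_def)
  obtain \<delta> where \<delta>: "\<delta> > 0" "\<And>s. s \<in> {0..1} \<Longrightarrow> dist s t < \<delta> \<Longrightarrow> \<gamma> s \<in> N"
    using curve_near[OF \<gamma>(1,2) N(1,2)] by blast
  \<comment> \<open>The basis is numbered because \<open>has_covariant_derivative\<close> indexes
    its frame by natural numbers.\<close>
  obtain e where "bij_betw e {0..<DIM('e)} (Basis :: 'e set)"
    using ex_bij_betw_nat_finite[OF finite_Basis] by blast
  then have e: "bij_betw e {..<DIM('e)} (Basis :: 'e set)" by (simp add: atLeast0LessThan)
  note vf = ext_vector_field[OF \<beta> \<gamma>(3)]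
  have reindex: "(\<Sum>i<DIM('e). G (e i)) = (\<Sum>b\<in>Basis. G b)" for G :: "'e \<Rightarrow> 'z::comm_monoid_add"
    by (rule sum.reindex_bij_betw[OF e])
  \<comment> \<open>The value that the Leibniz rule assigns in this frame; the differential equation
    says exactly that its \<open>c\<close>-coordinates vanish.\<close>
  define D where "D = (\<Sum>i<DIM('e). (?W \<bullet> e i) *\<^sub>R ext c \<beta> (e i) (\<gamma> t) +
      (V t c \<bullet> e i) *\<^sub>R nabla (ext c \<beta> ?v) (ext c \<beta> (e i)) (\<gamma> t))"
  have nE: "nabla (ext c \<beta> ?v) (ext c \<beta> b) (\<gamma> t) c = christoffel_map c (\<gamma> t) ?v b" for b
    using nabla_ext_coord[OF \<beta> \<gamma>(3) N(1,3,4,2) vf] by (simp add: ext_coord \<gamma> bump_eq_1[OF \<beta>])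
  have "D = 0"
  proof (rule tangent_eqI[OF \<gamma>(3,4)])
    show "D \<in> tangent_space A (\<gamma> t)"
      unfolding D_def
      by (intro tangent_sum tangent_add tangent_scaleR vector_field_tangent nabla_vector_field vf)
    have "D c = (\<Sum>b\<in>Basis. (?W \<bullet> b) *\<^sub>R b + (V t c \<bullet> b) *\<^sub>R christoffel_map c (\<gamma> t) ?v b)"
      unfolding D_def reindex
      using reindex[of "\<lambda>b. (?W \<bullet> b) *\<^sub>R ext c \<beta> b (\<gamma> t) +
        (V t c \<bullet> b) *\<^sub>R nabla (ext c \<beta> ?v) (ext c \<beta> b) (\<gamma> t)"]
      by (simp add: sum_fun_apply scaleR_fun_def[of _ "ext _ _ _ _"]
          scaleR_fun_def[of _ "nabla _ _ _"] nE ext_coord \<gamma> bump_eq_1[OF \<beta>])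
    also have "\<dots> = ?W + christoffel_map c (\<gamma> t) ?v (V t c)"
      by (simp only: sum.distrib euclidean_representation
          linear_euclidean_expansion[OF christoffel_map_linear, of c "\<gamma> t" ?v "V t c"])
    finally show "D c = (0 :: ('a, 'e) tvec) c" by simp
  qed (rule tangent_zero)
  moreover have "V s = (\<Sum>i<DIM('e). (V s c \<bullet> e i) *\<^sub>R ext c \<beta> (e i) (\<gamma> s))"
    if s: "s \<in> {0..1}" "\<bar>s - t\<bar> < \<delta>" for s
  proof -
    have "\<gamma> s \<in> N" using \<delta>(2) s by (simp add: dist_real_def)
    then show ?thesis
      using tangent_expansion[OF \<gamma>(3) _ V[OF s(1)]] N(3,4)
        reindex[of "\<lambda>b. (V s c \<bullet> b) *\<^sub>R ext c \<beta> b (\<gamma> s)"]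
      by (auto simp: ext_def)
  qed
  moreover have "((\<lambda>s. V s c \<bullet> b) has_real_derivative ?W \<bullet> b) (at t within {0..1})" for b
    using bounded_linear.has_vector_derivative[OF bounded_linear_inner_left d]
    by (simp add: has_real_derivative_iff_has_vector_derivative)
  moreover have "ext c \<beta> ?v (\<gamma> t) = velocity A \<gamma> t"
    using tangent_coord_vec[OF \<gamma>(3,4) velocity_tangent[OF \<gamma>(1,2)]] by (simp add: ext_at[OF \<beta>])
  ultimately show ?thesis
    unfolding has_covariant_derivative_def using vf \<delta>(1) D_def
    by (intro exI[of _ "DIM('e)"] exI[of _ "\<lambda>i. ext c \<beta> (e i)"] exI[of _ "\<lambda>i s. V s c \<bullet> e i"]
        exI[of _ "\<lambda>i. ?W \<bullet> e i"] exI[of _ "ext c \<beta> ?v"]) auto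
qed

definition transport_matrix :: "('a, 'e) chart \<Rightarrow> (real \<Rightarrow> 'a) \<Rightarrow> real \<Rightarrow> 'e \<Rightarrow>\<^sub>L 'e" where
  "transport_matrix c \<gamma> t = Blinfun (\<lambda>w. - christoffel_map c (\<gamma> t) (velocity A \<gamma> t c) w)"

lemma transport_matrix_apply:
  "blinfun_apply (transport_matrix c \<gamma> t) w = - christoffel_map c (\<gamma> t) (velocity A \<gamma> t c) w"
  unfolding transport_matrix_def
  by (intro bounded_linear_Blinfun_apply[THEN fun_cong] linear_conv_bounded_linear[THEN iffD1]
      linear_compose_neg christoffel_map_linear)

lemma transport_matrix_continuous:
  assumes "smooth_curve A \<gamma>" "c \<in> A" "\<gamma> ` {0..1} \<subseteq> fst c"
  shows "continuous_on {0..1} (transport_matrix c \<gamma>)"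
proof (rule continuous_on_blinfun_componentwise)
  have "continuous_on {0..1} \<gamma>" using assms(1) by (simp add: smooth_curve_def)
  then show "continuous_on {0..1} (\<lambda>t. blinfun_apply (transport_matrix c \<gamma> t) b)" for b
    unfolding transport_matrix_apply christoffel_map_def
    by (intro continuous_intros velocity_continuous[OF assms]
        continuous_on_compose2[OF christoffel_continuous[OF assms(2)] _ assms(3)])
qed

text \<open>Confining the curve to one chart avoids patching local solutions; exponential charts
  contain the curves to which this is applied.\<close>

lemma parallel_exists:
  assumes "smooth_curve A \<gamma>" "c \<in> A" "\<gamma> ` {0..1} \<subseteq> fst c" "v \<in> tangent_space A (\<gamma> 0)"
  obtains V where "parallel_along A nabla \<gamma> V" "V 0 = v"
proof -
  obtain x where x: "x 0 = v c"
    "\<And>t. t \<in> {0..1} \<Longrightarrow> (x has_vector_derivative transport_matrix c \<gamma> t (x t)) (at t within {0..1})"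
    using linear_ode_exists[OF transport_matrix_continuous[OF assms(1-3)]] by blast
  define V where "V = (\<lambda>t. coord_vec A (\<gamma> t) c (x t))"
  have c: "\<gamma> t \<in> fst c" if "t \<in> {0..1}" for t using assms(3) that by blast
  have VT: "V t \<in> tangent_space A (\<gamma> t)" if "t \<in> {0..1}" for t
    unfolding V_def by (rule coord_vec_tangent[OF assms(2) c[OF that]])
  have Vc: "V t c = x t" if "t \<in> {0..1}" for t
    unfolding V_def by (rule coord_vec_self[OF assms(2) c[OF that]])
  have "has_covariant_derivative A nabla \<gamma> V t 0" if t: "t \<in> {0..1}" for t
  proof (rule covariant_derivative_zeroI[OF assms(1) t assms(2) c[OF t] VT])
    have "((\<lambda>s. V s c) has_vector_derivative transport_matrix c \<gamma> t (x t)) (at t within {0..1})"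
      by (rule has_vector_derivative_transform[OF t Vc x(2)[OF t]])
    then show "((\<lambda>s. V s c) has_vector_derivative - christoffel_map c (\<gamma> t) (velocity A \<gamma> t c) (V t c))
        (at t within {0..1})"
      by (simp add: transport_matrix_apply Vc[OF t])
  qed
  then have "parallel_along A nabla \<gamma> V" using VT by (simp add: parallel_along_def)
  moreover have "V 0 = v"
    unfolding V_def x(1) using tangent_coord_vec[OF assms(2) c assms(4)] by simp
  ultimately show ?thesis using that by blast
qed

lemma parallel_unique:
  assumes "smooth_curve A \<gamma>" "c \<in> A" "\<gamma> ` {0..1} \<subseteq> fst c"
    and "parallel_along A nabla \<gamma> V" "parallel_along A nabla \<gamma> V'" "V 0 = V' 0" and t: "t \<in> {0..1}"
  shows "V t = V' t"
proof (rule tangent_eqI[OF assms(2)])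
  have c: "\<gamma> s \<in> fst c" if "s \<in> {0..1}" for s using assms(3) that by blast
  show "\<gamma> t \<in> fst c" by (rule c[OF t])
  show "V t \<in> tangent_space A (\<gamma> t)" "V' t \<in> tangent_space A (\<gamma> t)"
    using assms(4,5) t by (auto simp: parallel_along_def)
  \<comment> \<open>The equation is linear, so the difference solves it with initial value
    0.\<close>
  have "V t c - V' t c = 0"
  proof (rule linear_ode_zero[OF transport_matrix_continuous[OF assms(1-3)] _ _ t])
    show "V 0 c - V' 0 c = 0" using assms(6) by simp
    fix s :: real assume s: "s \<in> {0..1}"
    have "((\<lambda>s. U s c) has_vector_derivative transport_matrix c \<gamma> s (U s c)) (at s within {0..1})"
      if "parallel_along A nabla \<gamma> U" for U
      using covariant_derivative_coord[OF assms(1) s assms(2) c[OF s], of U 0] that s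
      by (simp add: parallel_along_def transport_matrix_apply)
    then show "((\<lambda>s. V s c - V' s c) has_vector_derivative transport_matrix c \<gamma> s (V s c - V' s c))
        (at s within {0..1})"
      unfolding blinfun.diff_right using assms(4,5) by (intro has_vector_derivative_diff)
  qed
  then show "V t c = V' t c" by simp
qed

lemma parallel_transport_eq:
  assumes "smooth_curve A \<gamma>" "c \<in> A" "\<gamma> ` {0..1} \<subseteq> fst c" "parallel_along A nabla \<gamma> V"
  shows "parallel_transport A nabla \<gamma> (V 0) = V 1"
  unfolding parallel_transport_def
proof (rule the_equality)
  show "\<exists>V'. parallel_along A nabla \<gamma> V' \<and> V' 0 = V 0 \<and> V' 1 = V 1" using assms(4) by blast
  fix w assume "\<exists>V'. parallel_along A nabla \<gamma> V' \<and> V' 0 = V 0 \<and> V' 1 = w"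
  then show "w = V 1" using parallel_unique[OF assms(1-3) _ assms(4), of _ 1] by auto
qed

end

section \<open>Reparametrised geodesics\<close>

context smooth_mfd
begin

text \<open>The restriction to \<open>{0..1}\<close> keeps the curve extensional, the form in which
  geodesics in \<open>U\<close> are unique. The case \<open>r = 0\<close> is included and gives a
  constant curve.\<close>

lemma reparam:
  assumes \<sigma>: "smooth_curve A \<sigma>" and r: "r \<in> {0..1}"
  defines "\<tau> \<equiv> (\<lambda>s\<in>{0..1}. \<sigma> (r * s))"
  shows "smooth_curve A \<tau>"
    and "s \<in> {0..1} \<Longrightarrow> velocity A \<tau> s = r *\<^sub>R velocity A \<sigma> (r * s)"
proof -
  have rs: "r * s \<in> {0..1}" if "s \<in> {0..1}" for s
    using r that by (auto simp: mult_le_one)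
  then have rimg: "(*) r ` {0..1} \<subseteq> {0..1}" by blast
  have \<tau>: "\<tau> s = \<sigma> (r * s)" if "s \<in> {0..1}" for s using that by (simp add: \<tau>_def)
  have bl: "bounded_linear ((*) r)" by (rule bounded_linear_mult_right)
  show "smooth_curve A \<tau>"
    unfolding smooth_curve_def
  proof (intro conjI ballI)
    have 1: "continuous_on {0..1} \<sigma>" using \<sigma> by (simp add: smooth_curve_def)
    have "continuous_on {0..1} (\<lambda>s. \<sigma> (r * s))"
      by (rule continuous_on_compose2[OF 1 linear_continuous_on[OF bl] rimg])
    then show "continuous_on {0..1} \<tau>" by (rule continuous_on_eq) (simp add: \<tau>)
    fix c assume c: "c \<in> A"
    have "smooth_on (snd c \<circ> \<sigma>) {t \<in> {0..1}. \<sigma> t \<in> fst c}"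
      using \<sigma> c by (simp add: smooth_curve_def)
    moreover have "(*) r ` {s \<in> {0..1}. \<tau> s \<in> fst c} \<subseteq> {t \<in> {0..1}. \<sigma> t \<in> fst c}"
      using rimg \<tau> by (auto simp del: atLeastAtMost_iff)
    ultimately have "smooth_on (\<lambda>s. (snd c \<circ> \<sigma>) (r * s)) {s \<in> {0..1}. \<tau> s \<in> fst c}"
      by (intro smooth_on_compose_linear[OF bl])
    then show "smooth_on (snd c \<circ> \<tau>) {s \<in> {0..1}. \<tau> s \<in> fst c}"
      by (rule smooth_on_cong[rotated]) (simp add: \<tau>)
  qed
  assume s: "s \<in> {0..1}"
  show "velocity A \<tau> s = r *\<^sub>R velocity A \<sigma> (r * s)"
  proof
    fix c
    show "velocity A \<tau> s c = (r *\<^sub>R velocity A \<sigma> (r * s)) c"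
    proof (cases "c \<in> A \<and> \<tau> s \<in> fst c")
      case True
      then have "(snd c \<circ> \<sigma> has_vector_derivative velocity A \<sigma> (r * s) c) (at (r * s) within {0..1})"
        using velocity_coord[OF \<sigma> rs[OF s]] \<tau>[OF s] by simp
      then have "(snd c \<circ> \<sigma> has_vector_derivative velocity A \<sigma> (r * s) c) (at (r * s) within (*) r ` {0..1})"
        by (rule has_vector_derivative_within_subset[OF _ rimg])
      moreover have "((*) r has_vector_derivative r) (at s within {0..1})"
        by (auto intro!: derivative_eq_intros)
      ultimately have "((snd c \<circ> \<sigma>) \<circ> (*) r has_vector_derivative r *\<^sub>R velocity A \<sigma> (r * s) c) (at s within {0..1})"
        by (intro vector_diff_chain_within)
      then have "(snd c \<circ> \<tau> has_vector_derivative r *\<^sub>R velocity A \<sigma> (r * s) c) (at s within {0..1})"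
        by (rule has_vector_derivative_transform[OF s, rotated]) (simp add: \<tau>)
      then show ?thesis using velocity_coordI[OF s] True by (simp add: scaleR_fun_def)
    next
      case False
      then show ?thesis using \<tau>[OF s] by (auto simp: velocity_def scaleR_fun_def)
    qed
  qed
qed

end

context connection
begin

text \<open>The velocity and its extension to a field both scale by \<open>r\<close>, and the time
  change contributes another \<open>r\<close> to the derivatives of the coefficients; so the new
  covariant derivative is \<open>r * r\<close> times the old one, which is 0.\<close>

lemma geodesic_reparam:
  assumes \<sigma>: "geodesic A nabla \<sigma>" and r: "r \<in> {0..1}"
  shows "geodesic A nabla (\<lambda>s\<in>{0..1}. \<sigma> (r * s))"
proof -
  define \<tau> where "\<tau> = (\<lambda>s\<in>{0..1}. \<sigma> (r * s))"
  have s\<sigma>: "smooth_curve A \<sigma>" and par: "parallel_along A nabla \<sigma> (velocity A \<sigma>)"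
    using \<sigma> by (auto simp: geodesic_def)
  note re = reparam[OF s\<sigma> r, folded \<tau>_def]
  have rs: "r * s \<in> {0..1}" if "s \<in> {0..1}" for s
    using r that by (auto simp: mult_le_one)
  then have rimg: "(*) r ` {0..1} \<subseteq> {0..1}" by blast
  have "has_covariant_derivative A nabla \<tau> (velocity A \<tau>) s 0" if s: "s \<in> {0..1}" for s
  proof -
    have "has_covariant_derivative A nabla \<sigma> (velocity A \<sigma>) (r * s) 0"
      using par rs[OF s] by (simp add: parallel_along_def)
    then obtain n :: nat and E f f' X \<delta> where E: "\<And>i. i < n \<Longrightarrow> E i \<in> vector_fields A"
      and f: "\<And>i. i < n \<Longrightarrow> (f i has_real_derivative f' i) (at (r * s) within {0..1})"
      and \<delta>: "\<delta> > 0" "\<And>u. u \<in> {0..1} \<Longrightarrow> \<bar>u - r * s\<bar> < \<delta> \<Longrightarrow>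
          velocity A \<sigma> u = (\<Sum>i<n. f i u *\<^sub>R E i (\<sigma> u))"
      and X: "X \<in> vector_fields A" "X (\<sigma> (r * s)) = velocity A \<sigma> (r * s)"
      and D: "0 = (\<Sum>i<n. f' i *\<^sub>R E i (\<sigma> (r * s)) + f i (r * s) *\<^sub>R nabla X (E i) (\<sigma> (r * s)))"
      unfolding has_covariant_derivative_def by blast
    have \<tau>s: "\<tau> s = \<sigma> (r * s)" using s by (simp add: \<tau>_def)
    have "((\<lambda>u. r * f i (r * u)) has_real_derivative r * (f' i * r)) (at s within {0..1})" if "i < n" for i
    proof -
      have "(f i has_real_derivative f' i) (at (r * s) within (*) r ` {0..1})"
        by (rule DERIV_subset[OF f[OF that] rimg])
      then have "((\<lambda>u. f i (r * u)) has_real_derivative f' i * r) (at s within {0..1})"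
        using DERIV_image_chain[of "f i" "f' i" "(*) r" s "{0..1}" r] DERIV_cmult_Id
        by (simp add: comp_def)
      then show ?thesis by (rule DERIV_cmult)
    qed
    moreover have "velocity A \<tau> u = (\<Sum>i<n. (r * f i (r * u)) *\<^sub>R E i (\<tau> u))"
      if u: "u \<in> {0..1}" "\<bar>u - s\<bar> < \<delta>" for u
    proof -
      have "\<bar>r * u - r * s\<bar> = r * \<bar>u - s\<bar>" using r by (simp add: abs_mult flip: right_diff_distrib)
      also have "\<dots> \<le> 1 * \<bar>u - s\<bar>" using r by (intro mult_right_mono) auto
      finally have "velocity A \<sigma> (r * u) = (\<Sum>i<n. f i (r * u) *\<^sub>R E i (\<sigma> (r * u)))"
        using u by (intro \<delta>(2) rs) auto
      then show ?thesis using re(2)[OF u(1)] u(1) by (simp add: scaleR_sum_right \<tau>_def)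
    qed
    moreover have "(\<lambda>x. r *\<^sub>R X x) \<in> vector_fields A"
      by (rule vector_field_scaleR[OF smooth_fun_const X(1)])
    moreover have "r *\<^sub>R X (\<tau> s) = velocity A \<tau> s" using re(2)[OF s] X(2) \<tau>s by simp
    moreover have "0 = (\<Sum>i<n. (r * (f' i * r)) *\<^sub>R E i (\<tau> s) +
        (r * f i (r * s)) *\<^sub>R nabla (\<lambda>x. r *\<^sub>R X x) (E i) (\<tau> s))"
    proof -
      have "(\<Sum>i<n. (r * (f' i * r)) *\<^sub>R E i (\<tau> s) +
          (r * f i (r * s)) *\<^sub>R nabla (\<lambda>x. r *\<^sub>R X x) (E i) (\<tau> s)) =
        (r * r) *\<^sub>R (\<Sum>i<n. f' i *\<^sub>R E i (\<sigma> (r * s)) + f i (r * s) *\<^sub>R nabla X (E i) (\<sigma> (r * s)))"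
        unfolding \<tau>s scaleR_sum_right
        by (rule sum.cong[OF refl])
           (simp add: nabla_scaleR_left[OF smooth_fun_const X(1) E] scaleR_add_right mult_ac)
      then show ?thesis unfolding D[symmetric] by simp
    qed
    ultimately show ?thesis
      unfolding has_covariant_derivative_def using E \<delta>(1)
      by (intro exI[of _ n] exI[of _ E] exI[of _ "\<lambda>i u. r * f i (r * u)"]
          exI[of _ "\<lambda>i. r * (f' i * r)"] exI[of _ "\<lambda>x. r *\<^sub>R X x"]) auto
  qed
  then have "parallel_along A nabla \<tau> (velocity A \<tau>)"
    using velocity_tangent[OF re(1)] by (simp add: parallel_along_def)
  then show ?thesis using re(1) by (simp add: geodesic_def \<tau>_def)
qed

end

section \<open>The metric\<close>

locale riemannian_mfd = smooth_mfd A
  for A :: "('a::{t2_space, second_countable_topology}, 'e::euclidean_space) chart set" +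
  fixes g :: "'a \<Rightarrow> ('a, 'e) tvec \<Rightarrow> ('a, 'e) tvec \<Rightarrow> real"
  assumes metric: "riemannian_metric A g"
begin

lemma g_commute: "u \<in> tangent_space A x \<Longrightarrow> v \<in> tangent_space A x \<Longrightarrow> g x u v = g x v u"
  using metric unfolding riemannian_metric_def by meson

lemma g_add_left: "u \<in> tangent_space A x \<Longrightarrow> v \<in> tangent_space A x \<Longrightarrow> w \<in> tangent_space A x \<Longrightarrow>
    g x (u + v) w = g x u w + g x v w"
  using metric unfolding riemannian_metric_def by meson

lemma g_scaleR_left: "u \<in> tangent_space A x \<Longrightarrow> v \<in> tangent_space A x \<Longrightarrow>
    g x (r *\<^sub>R u) v = r * g x u v"
  using metric unfolding riemannian_metric_def by meson

lemma g_pos: "u \<in> tangent_space A x \<Longrightarrow> u \<noteq> 0 \<Longrightarrow> 0 < g x u u"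
  using metric unfolding riemannian_metric_def by meson

lemma g_add_right: "u \<in> tangent_space A x \<Longrightarrow> v \<in> tangent_space A x \<Longrightarrow> w \<in> tangent_space A x \<Longrightarrow>
    g x w (u + v) = g x w u + g x w v"
  by (simp add: g_commute[of w] g_add_left tangent_add)

lemma g_scaleR_right: "u \<in> tangent_space A x \<Longrightarrow> v \<in> tangent_space A x \<Longrightarrow>
    g x u (r *\<^sub>R v) = r * g x u v"
  by (simp add: g_commute[of u] g_scaleR_left tangent_scaleR)

lemma g_zero_left: "v \<in> tangent_space A x \<Longrightarrow> g x 0 v = 0"
  using g_scaleR_left[OF tangent_zero, of v x 0] by simp

lemma g_zero_right: "v \<in> tangent_space A x \<Longrightarrow> g x v 0 = 0"
  using g_scaleR_right[OF _ tangent_zero, of v x 0] by simp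

lemma g_diff_left: "u \<in> tangent_space A x \<Longrightarrow> v \<in> tangent_space A x \<Longrightarrow> w \<in> tangent_space A x \<Longrightarrow>
    g x (u - v) w = g x u w - g x v w"
  using g_add_left[of "u - v" x v w] by (simp add: tangent_diff)

lemma g_sum_left:
  assumes "\<And>i. i \<in> I \<Longrightarrow> v i \<in> tangent_space A x" "w \<in> tangent_space A x"
  shows "g x (\<Sum>i\<in>I. v i) w = (\<Sum>i\<in>I. g x (v i) w)"
  using assms(1)
  by (induction I rule: infinite_finite_induct) (simp_all add: g_zero_left g_add_left tangent_sum assms(2))

lemma g_sum_right:
  assumes "\<And>i. i \<in> I \<Longrightarrow> v i \<in> tangent_space A x" "w \<in> tangent_space A x"
  shows "g x w (\<Sum>i\<in>I. v i) = (\<Sum>i\<in>I. g x w (v i))"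
  using assms(1)
  by (induction I rule: infinite_finite_induct) (simp_all add: g_zero_right g_add_right tangent_sum assms(2))

lemma g_sum_sum:
  assumes "\<And>i. i \<in> I \<Longrightarrow> v i \<in> tangent_space A x" "\<And>j. j \<in> J \<Longrightarrow> w j \<in> tangent_space A x"
  shows "g x (\<Sum>i\<in>I. v i) (\<Sum>j\<in>J. w j) = (\<Sum>i\<in>I. \<Sum>j\<in>J. g x (v i) (w j))"
proof -
  have "g x (\<Sum>i\<in>I. v i) (\<Sum>j\<in>J. w j) = (\<Sum>i\<in>I. g x (v i) (\<Sum>j\<in>J. w j))"
    by (rule g_sum_left[OF assms(1) tangent_sum[OF assms(2)]])
  also have "\<dots> = (\<Sum>i\<in>I. \<Sum>j\<in>J. g x (v i) (w j))"
    by (rule sum.cong[OF refl]) (rule g_sum_right[OF assms(2,1)])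
  finally show ?thesis .
qed

definition coord_g :: "('a, 'e) chart \<Rightarrow> 'a \<Rightarrow> 'e \<Rightarrow> 'e \<Rightarrow> real" where
  "coord_g c x u v = g x (coord_vec A x c u) (coord_vec A x c v)"

lemma coord_g_bilinear:
  assumes "c \<in> A" "x \<in> fst c" shows "bounded_bilinear (coord_g c x)"
proof -
  note t = coord_vec_tangent[OF assms]
  have "bilinear (coord_g c x)"
    unfolding bilinear_def coord_g_def
    by (auto intro!: linearI simp: coord_vec_add[OF assms] coord_vec_scaleR[OF assms]
        g_add_left g_add_right g_scaleR_left g_scaleR_right t)
  then show ?thesis by (simp add: bilinear_conv_bounded_bilinear)
qed

lemma g_coord_g:
  "c \<in> A \<Longrightarrow> x \<in> fst c \<Longrightarrow> u \<in> tangent_space A x \<Longrightarrow> v \<in> tangent_space A x \<Longrightarrow>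
     g x u v = coord_g c x (u c) (v c)"
  by (simp add: coord_g_def tangent_coord_vec)

lemma coord_g_pos: "c \<in> A \<Longrightarrow> x \<in> fst c \<Longrightarrow> v \<noteq> 0 \<Longrightarrow> coord_g c x v v > 0"
  unfolding coord_g_def by (rule g_pos[OF coord_vec_tangent]) (metis coord_vec_self zero_fun_apply)+

lemma coord_g_expand:
  assumes "c \<in> A" "x \<in> fst c"
  shows "coord_g c x u v = (\<Sum>a\<in>Basis. \<Sum>b\<in>Basis. (u \<bullet> a) * ((v \<bullet> b) * coord_g c x a b))"
proof -
  interpret bounded_bilinear "coord_g c x" by (rule coord_g_bilinear[OF assms])
  have "linear (\<lambda>u. coord_g c x u v)" for v
    using bounded_linear_left bounded_linear.linear by blast
  moreover have "linear (coord_g c x u)" for u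
    using bounded_linear_right bounded_linear.linear by blast
  ultimately have "coord_g c x u v = (\<Sum>a\<in>Basis. (u \<bullet> a) *\<^sub>R coord_g c x a v)"
    "\<And>a. coord_g c x a v = (\<Sum>b\<in>Basis. (v \<bullet> b) *\<^sub>R coord_g c x a b)"
    using linear_euclidean_expansion by blast+
  then show ?thesis by (simp add: sum_distrib_left)
qed

text \<open>The metric is assumed smooth only on fields with constant coordinates; expanding both
  arguments over the basis passes to arbitrary fields.\<close>

lemma g_smooth_fun:
  assumes "Y \<in> vector_fields A" "Z \<in> vector_fields A"
  shows "smooth_fun A UNIV (\<lambda>y. g y (Y y) (Z y))"
  unfolding smooth_fun_def comp_def
proof
  fix c assume c: "c \<in> A"
  have o: "open (snd c ` fst c)" using chart_image_open[OF c open_UNIV] by simp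
  have gs: "smooth_on (\<lambda>y. coord_g c (chart_inv c y) a b) (snd c ` fst c)" for a b
    using metric c unfolding riemannian_metric_def coord_g_def by blast
  have "smooth_on (\<lambda>y. \<Sum>a\<in>Basis. \<Sum>b\<in>Basis. (Y (chart_inv c y) c \<bullet> a) *
      ((Z (chart_inv c y) c \<bullet> b) * coord_g c (chart_inv c y) a b)) (snd c ` fst c)"
    by (intro smooth_on_sum smooth_on_mult smooth_on_inner vector_field_smooth gs o c assms)
  then have "smooth_on (\<lambda>y. g (chart_inv c y) (Y (chart_inv c y)) (Z (chart_inv c y))) (snd c ` fst c)"
    by (rule smooth_on_cong[rotated])
       (use c assms in \<open>auto simp: chart_inv_left g_coord_g vector_field_tangent simp flip: coord_g_expand\<close>)
  then show "smooth_on (\<lambda>y. g (chart_inv c y) (Y (chart_inv c y)) (Z (chart_inv c y))) (snd c ` (fst c \<inter> UNIV))"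
    by simp
qed

text \<open>Justifies the definite description in \<open>grad\<close>: read in a chart, the metric
  is positive definite and the differential is a linear form.\<close>

lemma grad_exists_unique:
  assumes "smooth_fun A S f" "open S" "x \<in> S"
  shows "\<exists>!v. v \<in> tangent_space A x \<and> (\<forall>w\<in>tangent_space A x. g x v w = differential A f x w)"
proof -
  obtain c where c: "c \<in> A" "x \<in> fst c" by (rule chart_exists)
  define l where "l = frechet_derivative (\<lambda>y. f (chart_inv c y)) (at (snd c x))"
  have l: "linear l"
    unfolding l_def using smooth_fun_has_derivative[OF assms c] has_derivative_linear by blast
  have d: "differential A f x w = l (w c)" if "w \<in> tangent_space A x" for w
    unfolding l_def by (rule differential_chart[OF assms c that])
  note R = positive_definite_represents[OF coord_g_bilinear[OF c] coord_g_pos[OF c] l]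
  obtain v where v: "\<And>w. coord_g c x v w = l w" using R by blast
  show ?thesis
  proof (rule ex1I[of _ "coord_vec A x c v"])
    show "coord_vec A x c v \<in> tangent_space A x \<and>
        (\<forall>w\<in>tangent_space A x. g x (coord_vec A x c v) w = differential A f x w)"
      using c v by (simp add: d g_coord_g coord_vec_tangent coord_vec_self)
    fix u assume u: "u \<in> tangent_space A x \<and> (\<forall>w\<in>tangent_space A x. g x u w = differential A f x w)"
    have "coord_g c x (u c) w = l w" for w
      using u g_coord_g[OF c _ coord_vec_tangent[OF c], of u w] d[OF coord_vec_tangent[OF c], of w]
      by (simp add: coord_vec_self c coord_vec_tangent)
    then have "u c = v" using R v by blast
    then show "u = coord_vec A x c v" using tangent_coord_vec[OF c, of u] u by simp
  qed
qed

lemma grad_tangent: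
  "smooth_fun A S f \<Longrightarrow> open S \<Longrightarrow> x \<in> S \<Longrightarrow> grad A g f x \<in> tangent_space A x"
  using theI'[OF grad_exists_unique] unfolding grad_def by blast

lemma g_grad:
  "smooth_fun A S f \<Longrightarrow> open S \<Longrightarrow> x \<in> S \<Longrightarrow> w \<in> tangent_space A x \<Longrightarrow>
     g x (grad A g f x) w = differential A f x w"
  using theI'[OF grad_exists_unique] unfolding grad_def by blast

lemma grad_cong:
  "(\<And>w. w \<in> tangent_space A x \<Longrightarrow> differential A f x w = differential A h x w) \<Longrightarrow>
     grad A g f x = grad A g h x"
  unfolding grad_def by (metis (no_types, lifting))

end

section \<open>Duality\<close>

locale statistical_mfd = riemannian_mfd A g + n: connection A nabla + s: connection A nabla_s
  for A :: "('a::{t2_space, second_countable_topology}, 'e::euclidean_space) chart set"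
  and g :: "'a \<Rightarrow> ('a, 'e) tvec \<Rightarrow> ('a, 'e) tvec \<Rightarrow> real"
  and nabla nabla_s :: "('a, 'e) connection" +
  assumes dual: "dual_connections A g nabla nabla_s"
begin

text \<open>Duality is a statement about global fields. Writing \<open>V\<close> and
  \<open>W\<close> through such fields, the product rule turns it into the sum of the pairing of the
  covariant derivative of \<open>V\<close> with \<open>W\<close> and that of \<open>V\<close> with
  the dual covariant derivative of \<open>W\<close>; both are 0.\<close>

lemma parallel_g_derivative:
  assumes \<gamma>: "smooth_curve A \<gamma>" "t \<in> {0..1}"
    and V: "has_covariant_derivative A nabla \<gamma> V t 0"
    and W: "has_covariant_derivative A nabla_s \<gamma> W t 0"
    and Tan: "V t \<in> tangent_space A (\<gamma> t)" "W t \<in> tangent_space A (\<gamma> t)"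
  shows "((\<lambda>s. g (\<gamma> s) (V s) (W s)) has_real_derivative 0) (at t within {0..1})"
proof -
  let ?x = "\<gamma> t"
  obtain n :: nat and E f f' X \<delta> where E: "\<And>i. i < n \<Longrightarrow> E i \<in> vector_fields A"
    and f: "\<And>i. i < n \<Longrightarrow> (f i has_real_derivative f' i) (at t within {0..1})"
    and \<delta>: "\<delta> > 0" "\<And>s. s \<in> {0..1} \<Longrightarrow> \<bar>s - t\<bar> < \<delta> \<Longrightarrow> V s = (\<Sum>i<n. f i s *\<^sub>R E i (\<gamma> s))"
    and X: "X \<in> vector_fields A" "X ?x = velocity A \<gamma> t"
    and DV: "0 = (\<Sum>i<n. f' i *\<^sub>R E i ?x + f i t *\<^sub>R nabla X (E i) ?x)"
    using V unfolding has_covariant_derivative_def by blast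
  obtain m :: nat and F h h' X' \<epsilon> where F: "\<And>j. j < m \<Longrightarrow> F j \<in> vector_fields A"
    and h: "\<And>j. j < m \<Longrightarrow> (h j has_real_derivative h' j) (at t within {0..1})"
    and \<epsilon>: "\<epsilon> > 0" "\<And>s. s \<in> {0..1} \<Longrightarrow> \<bar>s - t\<bar> < \<epsilon> \<Longrightarrow> W s = (\<Sum>j<m. h j s *\<^sub>R F j (\<gamma> s))"
    and X': "X' \<in> vector_fields A" "X' ?x = velocity A \<gamma> t"
    and DW: "0 = (\<Sum>j<m. h' j *\<^sub>R F j ?x + h j t *\<^sub>R nabla_s X' (F j) ?x)"
    using W unfolding has_covariant_derivative_def by blast
  obtain c where c: "c \<in> A" "?x \<in> fst c" by (rule chart_exists)
  note Tv = vector_field_tangent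
  have eT: "E i y \<in> tangent_space A y" "nabla X (E i) y \<in> tangent_space A y" if "i < n" for i y
    using Tv E[OF that] n.nabla_vector_field[OF X(1)] by blast+
  have fT: "F j y \<in> tangent_space A y" "nabla_s X' (F j) y \<in> tangent_space A y" if "j < m" for j y
    using Tv F[OF that] s.nabla_vector_field[OF X'(1)] by blast+
  have sums: "g y (\<Sum>i<n. v i) (\<Sum>j<m. w j) = (\<Sum>i<n. \<Sum>j<m. g y (v i) (w j))"
    if "\<And>i. i < n \<Longrightarrow> v i \<in> tangent_space A y" "\<And>j. j < m \<Longrightarrow> w j \<in> tangent_space A y" for v w y
    using that by (intro g_sum_sum) auto
  have G: "((\<lambda>s. g (\<gamma> s) (E i (\<gamma> s)) (F j (\<gamma> s))) has_real_derivative
      g ?x (nabla X (E i) ?x) (F j ?x) + g ?x (E i ?x) (nabla_s X' (F j) ?x)) (at t within {0..1})"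
    if i: "i < n" and j: "j < m" for i j
  proof -
    let ?G = "\<lambda>y. g y (E i y) (F j y)"
    have sG: "smooth_fun A UNIV ?G" by (rule g_smooth_fun[OF E[OF i] F[OF j]])
    have "((\<lambda>s. ?G (\<gamma> s)) has_vector_derivative
        frechet_derivative (\<lambda>y. ?G (chart_inv c y)) (at (snd c ?x)) (velocity A \<gamma> t c)) (at t within {0..1})"
      by (rule curve_chain[OF \<gamma> c smooth_fun_has_derivative[OF sG open_UNIV UNIV_I c]])
    also have "frechet_derivative (\<lambda>y. ?G (chart_inv c y)) (at (snd c ?x)) (velocity A \<gamma> t c) =
        differential A ?G ?x (X ?x)"
      using differential_chart[OF sG open_UNIV UNIV_I c Tv[OF X(1)]] X(2) by simp
    also have "\<dots> = g ?x (nabla X (E i) ?x) (F j ?x) + g ?x (E i ?x) (nabla_s X (F j) ?x)"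
      using dual X(1) E[OF i] F[OF j] unfolding dual_connections_def by blast
    \<comment> \<open>Duality yields the extension \<open>X\<close> that came with \<open>V\<close>,
      whereas the equation for \<open>W\<close> uses \<open>X'\<close>; both extend the same
      velocity.\<close>
    also have "nabla_s X (F j) ?x = nabla_s X' (F j) ?x"
      by (rule s.nabla_tensorial[OF X(1) X'(1) F[OF j]]) (simp add: X X')
    finally show ?thesis by (simp add: has_real_derivative_iff_has_vector_derivative)
  qed
  define R where "R = (\<lambda>s. \<Sum>i<n. \<Sum>j<m. f i s * (h j s * g (\<gamma> s) (E i (\<gamma> s)) (F j (\<gamma> s))))"
  \<comment> \<open>The shape is the one that two applications of the product rule produce.\<close>
  define R' where "R' = (\<Sum>i<n. \<Sum>j<m.
      f' i * (h j t * g ?x (E i ?x) (F j ?x)) +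
      (h' j * g ?x (E i ?x) (F j ?x) + (g ?x (nabla X (E i) ?x) (F j ?x) +
        g ?x (E i ?x) (nabla_s X' (F j) ?x)) * h j t) * f i t)"
  have "(R has_real_derivative R') (at t within {0..1})"
    unfolding R_def R'_def by (intro DERIV_sum DERIV_mult f h G) auto
  moreover have "R' = 0"
  proof -
    have V: "V t = (\<Sum>i<n. f i t *\<^sub>R E i ?x)" using \<delta> \<gamma>(2) by simp
    have W: "W t = (\<Sum>j<m. h j t *\<^sub>R F j ?x)" using \<epsilon> \<gamma>(2) by simp
    have "0 = g ?x (\<Sum>i<n. f' i *\<^sub>R E i ?x + f i t *\<^sub>R nabla X (E i) ?x) (W t)"
      unfolding DV[symmetric] using g_zero_left Tan by simp
    also have "\<dots> = (\<Sum>i<n. \<Sum>j<m. h j t * (f' i * g ?x (E i ?x) (F j ?x) +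
        f i t * g ?x (nabla X (E i) ?x) (F j ?x)))"
      unfolding W
      by (subst sums; (intro sum.cong refl)?)
         (simp_all add: g_add_left g_scaleR_left g_scaleR_right eT fT tangent_add tangent_scaleR)
    finally have 1: "(\<Sum>i<n. \<Sum>j<m. h j t * (f' i * g ?x (E i ?x) (F j ?x) +
        f i t * g ?x (nabla X (E i) ?x) (F j ?x))) = 0" by simp
    have "0 = g ?x (V t) (\<Sum>j<m. h' j *\<^sub>R F j ?x + h j t *\<^sub>R nabla_s X' (F j) ?x)"
      unfolding DW[symmetric] using g_zero_right Tan by simp
    also have "\<dots> = (\<Sum>i<n. \<Sum>j<m. f i t * (h' j * g ?x (E i ?x) (F j ?x) +
        h j t * g ?x (E i ?x) (nabla_s X' (F j) ?x)))"
      unfolding V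
      by (subst sums; (intro sum.cong refl)?)
         (simp_all add: g_add_right g_scaleR_left g_scaleR_right eT fT tangent_add tangent_scaleR algebra_simps)
    finally have 2: "(\<Sum>i<n. \<Sum>j<m. f i t * (h' j * g ?x (E i ?x) (F j ?x) +
        h j t * g ?x (E i ?x) (nabla_s X' (F j) ?x))) = 0" by simp
    \<comment> \<open>The terms regroup into the two pairings evaluated in 1 and 2.\<close>
    have "R' = (\<Sum>i<n. \<Sum>j<m. h j t * (f' i * g ?x (E i ?x) (F j ?x) +
        f i t * g ?x (nabla X (E i) ?x) (F j ?x))) + (\<Sum>i<n. \<Sum>j<m. f i t * (h' j * g ?x (E i ?x) (F j ?x) +
        h j t * g ?x (E i ?x) (nabla_s X' (F j) ?x)))"
      unfolding R'_def sum.distrib[symmetric] by (intro sum.cong refl) (simp add: algebra_simps)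
    then show ?thesis using 1 2 by simp
  qed
  ultimately have "(R has_vector_derivative 0) (at t within {0..1})"
    by (simp add: has_real_derivative_iff_has_vector_derivative)
  moreover have "R s = g (\<gamma> s) (V s) (W s)" if s: "s \<in> {0..1}" "dist s t < min \<delta> \<epsilon>" for s
  proof -
    have "V s = (\<Sum>i<n. f i s *\<^sub>R E i (\<gamma> s))" "W s = (\<Sum>j<m. h j s *\<^sub>R F j (\<gamma> s))"
      using \<delta>(2)[OF s(1)] \<epsilon>(2)[OF s(1)] s(2) by (simp_all add: dist_real_def)
    then have "g (\<gamma> s) (V s) (W s) =
        (\<Sum>i<n. \<Sum>j<m. g (\<gamma> s) (f i s *\<^sub>R E i (\<gamma> s)) (h j s *\<^sub>R F j (\<gamma> s)))"
      by (simp only:) (rule sums; simp add: eT fT tangent_scaleR)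
    also have "\<dots> = R s"
      unfolding R_def by (intro sum.cong refl) (simp add: g_scaleR_left g_scaleR_right eT fT tangent_scaleR)
    finally show ?thesis by simp
  qed
  ultimately have "((\<lambda>s. g (\<gamma> s) (V s) (W s)) has_vector_derivative 0) (at t within {0..1})"
    using has_vector_derivative_transform_within[of R 0 t "{0..1}" "min \<delta> \<epsilon>"] \<delta>(1) \<epsilon>(1) \<gamma>(2) by simp
  then show ?thesis by (simp add: has_real_derivative_iff_has_vector_derivative)
qed

lemma parallel_g_constant:
  assumes "smooth_curve A \<gamma>" "parallel_along A nabla \<gamma> V" "parallel_along A nabla_s \<gamma> W"
  shows "g (\<gamma> 1) (V 1) (W 1) = g (\<gamma> 0) (V 0) (W 0)"
proof -
  have "\<exists>k. \<forall>t\<in>{0..1}. g (\<gamma> t) (V t) (W t) = k"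
  proof (rule has_derivative_zero_constant)
    fix t :: real assume t: "t \<in> {0..1}"
    then have "((\<lambda>s. g (\<gamma> s) (V s) (W s)) has_real_derivative 0) (at t within {0..1})"
      using assms by (intro parallel_g_derivative) (auto simp: parallel_along_def)
    then show "((\<lambda>s. g (\<gamma> s) (V s) (W s)) has_derivative (\<lambda>h. 0)) (at t within {0..1})"
      by (simp only: has_field_derivative_def lambda_zero)
  qed simp
  then show ?thesis by (metis atLeastAtMost_iff order_refl zero_le_one)
qed

end

section \<open>Exponential charts\<close>

context smooth_mfd
begin

text \<open>Maximality of the atlas turns the inverse of a diffeomorphism from the tangent space into a chart.\<close>

lemma tangent_diffeo_chart:
  assumes td: "tangent_diffeo A p E F" and c: "c \<in> A" "p \<in> fst c"
  defines "e \<equiv> (F ` E, \<lambda>q. inv_into E F q c)"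
  shows "e \<in> A" and "\<And>v. v \<in> E \<Longrightarrow> chart_inv e (v c) = F v"
proof -
  have ET: "E \<subseteq> tangent_space A p" and inj: "inj_on F E" and oF: "open (F ` E)"
    and oE: "open ((\<lambda>v. v c) ` E)"
    and cF: "continuous_on ((\<lambda>v. v c) ` E) (\<lambda>u. F (coord_vec A p c u))"
    using td c unfolding tangent_diffeo_def by auto
  have s1: "smooth_on (\<lambda>u. snd d (F (coord_vec A p c u))) {u \<in> (\<lambda>v. v c) ` E. F (coord_vec A p c u) \<in> fst d}"
    and s2: "smooth_on (\<lambda>y. inv_into E F (chart_inv d y) c) (snd d ` (fst d \<inter> F ` E))"
    if "d \<in> A" for d
    using td c that unfolding tangent_diffeo_def by auto
  have cv: "coord_vec A p c (v c) = v" if "v \<in> E" for v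
    using tangent_coord_vec[OF c] ET that by blast
  have se: "snd e (F v) = v c" if "v \<in> E" for v
    using inv_into_f_f[OF inj that] by (simp add: e_def)
  have fe: "fst e = F ` E" by (simp add: e_def)
  have img: "snd e ` fst e = (\<lambda>v. v c) ` E"
    unfolding fe image_image by (rule image_cong) (simp_all add: se)
  have inje: "inj_on (snd e) (fst e)"
  proof (rule inj_onI)
    fix x y assume "x \<in> fst e" "y \<in> fst e" and eq: "snd e x = snd e y"
    then obtain v w where vw: "v \<in> E" "w \<in> E" "x = F v" "y = F w" by (auto simp: e_def)
    then have "v = w" using tangent_eqI[OF c] ET eq se by (metis subsetD)
    then show "x = y" using vw by simp
  qed
  show ie: "chart_inv e (v c) = F v" if "v \<in> E" for v
  proof -
    have "F v \<in> fst e" using that by (simp add: e_def)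
    then show ?thesis
      unfolding chart_inv_def se[OF that, symmetric] by (rule inv_into_f_f[OF inje])
  qed
  \<comment> \<open>Continuity is local: in any chart \<open>d\<close> around \<open>q\<close>,
    \<open>snd e\<close> is the map that \<open>s2\<close> declares smooth, precomposed with
    \<open>snd d\<close>.\<close>
  have "isCont (snd e) q" if "q \<in> fst e" for q
  proof -
    obtain d where d: "d \<in> A" "q \<in> fst d" by (rule chart_exists)
    have 1: "continuous_on (fst d \<inter> F ` E) (snd d)"
      using chart_homeomorphism[OF d(1)] by (auto simp: homeomorphism_def elim: continuous_on_subset)
    have "continuous_on (fst d \<inter> F ` E) (\<lambda>q. inv_into E F (chart_inv d (snd d q)) c)"
      by (rule continuous_on_compose2[OF smooth_on_imp_continuous_on[OF s2[OF d(1)]] 1]) simp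
    then have "continuous_on (fst d \<inter> F ` E) (snd e)"
      by (rule continuous_on_eq) (simp add: e_def chart_inv_left d(1))
    then show ?thesis
      using d oF chart_open[OF d(1)] that by (simp add: continuous_on_eq_continuous_at open_Int e_def)
  qed
  then have ce: "continuous_on (fst e) (snd e)" by (simp add: continuous_at_imp_continuous_on)
  have cinv: "continuous_on (snd e ` fst e) (chart_inv e)"
    unfolding img by (rule continuous_on_eq[OF cF]) (auto simp: cv ie)
  have im2: "chart_inv e ` snd e ` fst e = fst e"
    unfolding fe image_image by (rule image_cong) (simp_all add: se ie)
  have "homeomorphism (fst e) (snd e ` fst e) (snd e) (chart_inv e)"
    unfolding homeomorphism_def using ce cinv im2 inje
    by (simp add: chart_inv_def f_inv_into_f)
  then have ch: "is_chart e"
    using oF oE unfolding is_chart_def img by (simp add: e_def)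
  have "compatible e d" if d: "d \<in> A" for d
    unfolding compatible_def
  proof
    have 0: "fst e \<inter> fst d = F ` {v \<in> E. F v \<in> fst d}" unfolding fe by auto
    have 1: "snd e ` (fst e \<inter> fst d) = (\<lambda>v. v c) ` {v \<in> E. F v \<in> fst d}"
      unfolding 0 image_image by (rule image_cong) (simp_all add: se)
    have 2: "{u \<in> (\<lambda>v. v c) ` E. F (coord_vec A p c u) \<in> fst d} = (\<lambda>v. v c) ` {v \<in> E. F v \<in> fst d}"
      using cv by auto
    show "smooth_on (snd d \<circ> chart_inv e) (snd e ` (fst e \<inter> fst d))"
      unfolding 1 by (rule smooth_on_cong[OF _ s1[OF d, unfolded 2]]) (auto simp: cv ie)
    have "snd e \<circ> chart_inv d = (\<lambda>y. inv_into E F (chart_inv d y) c)" by (simp add: e_def comp_def)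
    then show "smooth_on (snd e \<circ> chart_inv d) (snd d ` (fst e \<inter> fst d))"
      using s2[OF d] by (simp add: e_def Int_commute)
  qed
  then show "e \<in> A" using ch mfd unfolding smooth_manifold_def by blast
qed

end

section \<open>The Phi-function of a dually convex set\<close>

locale dually_convex_mfd = statistical_mfd A g nabla nabla_s
  for A :: "('a::{t2_space, second_countable_topology}, 'e::euclidean_space) chart set"
  and g :: "'a \<Rightarrow> ('a, 'e) tvec \<Rightarrow> ('a, 'e) tvec \<Rightarrow> real"
  and nabla nabla_s :: "('a, 'e) connection" +
  fixes U :: "'a set"
  assumes dc: "dually_convex A nabla nabla_s U"
begin

lemma open_U: "open U"
  using dc by (simp add: dually_convex_def)

lemma geodesic_unique:
  assumes "p \<in> U" "q \<in> U"
  shows "\<exists>!\<sigma>. geodesic_from_to A nabla U p q \<sigma>" "\<exists>!\<sigma>. geodesic_from_to A nabla_s U p q \<sigma>"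
  using dc assms unfolding dually_convex_def by blast+

lemma geodesic_between_n:
  "p \<in> U \<Longrightarrow> q \<in> U \<Longrightarrow> geodesic_from_to A nabla U p q (geodesic_between A nabla U p q)"
  unfolding geodesic_between_def by (rule theI'[OF geodesic_unique(1)])

lemma geodesic_between_s:
  "p \<in> U \<Longrightarrow> q \<in> U \<Longrightarrow> geodesic_from_to A nabla_s U p q (geodesic_between A nabla_s U p q)"
  unfolding geodesic_between_def by (rule theI'[OF geodesic_unique(2)])

lemma geodesic_between_s_eq:
  "p \<in> U \<Longrightarrow> q \<in> U \<Longrightarrow> geodesic_from_to A nabla_s U p q \<sigma> \<Longrightarrow> geodesic_between A nabla_s U p q = \<sigma>"
  unfolding geodesic_between_def by (rule the1_equality[OF geodesic_unique(2)])

lemma exp_inv_tangent: "p \<in> U \<Longrightarrow> q \<in> U \<Longrightarrow> exp_inv A nabla U p q \<in> tangent_space A p"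
  using geodesic_between_n[of p q] velocity_tangent[of "geodesic_between A nabla U p q" 0]
  by (auto simp: exp_inv_def geodesic_from_to_def geodesic_def)

lemma exp_inv_s_tangent: "p \<in> U \<Longrightarrow> q \<in> U \<Longrightarrow> exp_inv A nabla_s U p q \<in> tangent_space A p"
  using geodesic_between_s[of p q] velocity_tangent[of "geodesic_between A nabla_s U p q" 0]
  by (auto simp: exp_inv_def geodesic_from_to_def geodesic_def)

end

locale dually_convex_pointed = dually_convex_mfd A g nabla nabla_s U
  for A :: "('a::{t2_space, second_countable_topology}, 'e::euclidean_space) chart set"
  and g :: "'a \<Rightarrow> ('a, 'e) tvec \<Rightarrow> ('a, 'e) tvec \<Rightarrow> real"
  and nabla nabla_s :: "('a, 'e) connection" and U :: "'a set" +
  fixes p :: 'a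
  assumes p: "p \<in> U"
begin

abbreviation "geo \<equiv> geodesic_between A nabla_s U p"
abbreviation "ei \<equiv> exp_inv A nabla U p"
abbreviation "ei_s \<equiv> exp_inv A nabla_s U p"
abbreviation "\<phi> \<equiv> phi_fun A g nabla nabla_s U p"
abbreviation "Pv \<equiv> Pi_vec A nabla nabla_s U p"

lemma geo_facts:
  assumes "q \<in> U"
  shows "smooth_curve A (geo q)" "parallel_along A nabla_s (geo q) (velocity A (geo q))"
    "t \<in> {0..1} \<Longrightarrow> geo q t \<in> U" "geo q 0 = p" "geo q 1 = q"
  using geodesic_between_s[OF p assms] by (auto simp: geodesic_from_to_def geodesic_def)

text \<open>The slowed-down initial segment is a starred geodesic in \<open>U\<close> with the
  required end points, so uniqueness identifies it.\<close>

lemma geo_radial: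
  assumes q: "q \<in> U" and t: "t \<in> {0..1}"
  shows "geo (geo q t) = (\<lambda>s\<in>{0..1}. geo q (t * s))"
proof (rule geodesic_between_s_eq[OF p geo_facts(3)[OF q t]])
  have ts: "t * s \<in> {0..1}" if "s \<in> {0..1}" for s using t that by (auto simp: mult_le_one)
  have "geodesic A nabla_s (geo q)"
    using geodesic_between_s[OF p q] by (simp add: geodesic_from_to_def)
  then have "geodesic A nabla_s (\<lambda>s\<in>{0..1}. geo q (t * s))" by (rule s.geodesic_reparam[OF _ t])
  then show "geodesic_from_to A nabla_s U p (geo q t) (\<lambda>s\<in>{0..1}. geo q (t * s))"
    using geo_facts[OF q] ts by (auto simp: geodesic_from_to_def)
qed

lemma geo_radial_velocity:
  assumes q: "q \<in> U" and t: "t \<in> {0..1}" and s: "s \<in> {0..1}"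
  shows "velocity A (geo (geo q t)) s = t *\<^sub>R velocity A (geo q) (t * s)"
  unfolding geo_radial[OF q t] by (rule reparam(2)[OF geo_facts(1)[OF q] t s])

text \<open>This is \<open>geo_radial_velocity\<close> at time 0. In the chart \<open>e\<close> of
  \<open>exp_charts\<close> it says that starred geodesics from \<open>p\<close> are straight
  rays.\<close>

lemma ei_s_radial:
  "q \<in> U \<Longrightarrow> t \<in> {0..1} \<Longrightarrow> ei_s (geo q t) = t *\<^sub>R ei_s q"
  using geo_radial_velocity[of q t 0] by (simp add: exp_inv_def)

text \<open>The chart \<open>c\<close> coordinatises the tangent space at \<open>p\<close>;
  \<open>e\<close> inverts the starred exponential map, read in \<open>c\<close>. Once
  \<open>e\<close> belongs to the atlas, the smooth inverse of the other exponential map may be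
  expressed in it, which is the last clause.\<close>

lemma exp_charts:
  obtains c e where "c \<in> A" "p \<in> fst c" "e \<in> A" "U \<subseteq> fst e" "\<forall>q\<in>U. snd e q = ei_s q c"
    "smooth_on (\<lambda>y. ei (chart_inv e y) c) (snd e ` U)"
proof -
  obtain c where c: "c \<in> A" "p \<in> fst c" by (rule chart_exists)
  obtain E where E: "exp_diffeo A nabla U p E" "exp_diffeo A nabla_s U p E"
    using dc p by (auto simp: dually_convex_def)
  define e where "e = (exp_map A nabla_s p ` E, \<lambda>q. inv_into E (exp_map A nabla_s p) q c)"
  have "tangent_diffeo A p E (exp_map A nabla_s p)" using E(2) by (simp add: exp_diffeo_def)
  then have e: "e \<in> A" unfolding e_def by (rule tangent_diffeo_chart[OF _ c])
  have Ue: "U \<subseteq> fst e" using E(2) by (simp add: exp_diffeo_def e_def)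
  have "\<forall>q\<in>U. snd e q = ei_s q c"
    using E(2) by (simp add: exp_diffeo_def e_def)
  moreover have "smooth_on (\<lambda>y. ei (chart_inv e y) c) (snd e ` U)"
  proof -
    have "smooth_on (\<lambda>y. inv_into E (exp_map A nabla p) (chart_inv e y) c)
        (snd e ` (fst e \<inter> exp_map A nabla p ` E))"
      using E(1) c e unfolding exp_diffeo_def tangent_diffeo_def by blast
    moreover have "U \<subseteq> fst e \<inter> exp_map A nabla p ` E"
      using E(1) Ue by (simp add: exp_diffeo_def)
    ultimately have "smooth_on (\<lambda>y. inv_into E (exp_map A nabla p) (chart_inv e y) c) (snd e ` U)"
      using smooth_on_subset image_mono by metis
    then show ?thesis
      by (rule smooth_on_cong[rotated])
         (use E(1) Ue e in \<open>auto simp: chart_inv_left exp_diffeo_def subset_iff\<close>)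
  qed
  ultimately show ?thesis using that c e Ue by blast
qed

text \<open>Duality moves the pairing with the geodesic velocity from \<open>q\<close> back to \<open>p\<close>, so that no
  smooth dependence of parallel transport on the end point is needed.\<close>

lemma Pi_vec_pairing:
  assumes q: "q \<in> U"
  shows "Pv q \<in> tangent_space A q" "g q (Pv q) (velocity A (geo q) 1) = g p (ei q) (ei_s q)"
proof -
  \<comment> \<open>The geodesic stays in \<open>U\<close>, hence in one chart, so the one-chart
    existence theorem for parallel fields applies.\<close>
  obtain e where e: "e \<in> A" "U \<subseteq> fst e" by (rule exp_charts)
  note gf = geo_facts[OF q]
  have ge: "geo q ` {0..1} \<subseteq> fst e" using gf(3) e(2) by blast
  have "ei q \<in> tangent_space A (geo q 0)" using exp_inv_tangent[OF p q] gf(4) by simp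
  then obtain V where V: "parallel_along A nabla (geo q) V" "V 0 = ei q"
    using n.parallel_exists[OF gf(1) e(1) ge] by blast
  have "Pv q = V 1"
    using n.parallel_transport_eq[OF gf(1) e(1) ge V(1)] V(2) by (simp add: Pi_vec_def)
  moreover have "V 1 \<in> tangent_space A (geo q 1)" using V(1) by (simp add: parallel_along_def)
  \<comment> \<open>The starred geodesic has a velocity parallel for \<open>nabla_s\<close>, so it
    may be paired with the \<open>nabla\<close>-parallel field \<open>V\<close>.\<close>
  ultimately show "Pv q \<in> tangent_space A q" "g q (Pv q) (velocity A (geo q) 1) = g p (ei q) (ei_s q)"
    using parallel_g_constant[OF gf(1) V(1) gf(2)] gf(4,5) V(2) by (simp_all add: exp_inv_def)
qed

text \<open>The vector at \<open>geo q t\<close> refers to the geodesic ending there, whose final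
  velocity is \<open>t\<close> times that of \<open>geo q\<close> at \<open>t\<close> and whose
  initial velocity is \<open>t\<close> times \<open>ei_s q\<close>. The factor appears on both sides
  of the duality identity and cancels.\<close>

lemma phi_integral:
  assumes q: "q \<in> U"
  shows "\<phi> q = integral {0..1} (\<lambda>t. g p (ei (geo q t)) (ei_s q))"
proof -
  have "integral {0..1} (\<lambda>t. g p (ei (geo q t)) (ei_s q)) =
      integral {0..1} (\<lambda>t. g (geo q t) (Pv (geo q t)) (velocity A (geo q) t))"
  \<comment> \<open>At \<open>t = 0\<close> the factor cannot be cancelled; a single point does not
    affect the integral.\<close>
  proof (rule integral_spike[of "{0}"])
    fix t :: real assume t: "t \<in> {0..1} - {0}"
    let ?x = "geo q t"
    have x: "?x \<in> U" using geo_facts(3)[OF q] t by simp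
    have "t * g ?x (Pv ?x) (velocity A (geo q) t) = g ?x (Pv ?x) (velocity A (geo ?x) 1)"
      using geo_radial_velocity[OF q, of t 1] t velocity_tangent[OF geo_facts(1)[OF q], of t]
      by (simp add: g_scaleR_right Pi_vec_pairing(1)[OF x])
    also have "\<dots> = t * g p (ei ?x) (ei_s q)"
      using ei_s_radial[OF q, of t] t
      by (simp add: Pi_vec_pairing(2)[OF x] g_scaleR_right exp_inv_tangent[OF p x] exp_inv_s_tangent[OF p q])
    finally show "g ?x (Pv ?x) (velocity A (geo q) t) = g p (ei ?x) (ei_s q)"
      using t by simp
  qed simp
  then show ?thesis by (simp add: phi_fun_def Let_def)
qed


text \<open>By \<open>ei_s_radial\<close> the coordinates of \<open>geo q t\<close> are
  \<open>t\<close> times those of \<open>q\<close>; the last three claims read this off for points,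
  inverse coordinates and end velocities.\<close>

lemma radial_chart:
  assumes "e \<in> A" "c \<in> A" "p \<in> fst c" "U \<subseteq> fst e" "\<forall>q\<in>U. snd e q = ei_s q c"
  shows "open (snd e ` U)"
    and "y \<in> snd e ` U \<Longrightarrow> t \<in> {0..1} \<Longrightarrow> t *\<^sub>R y \<in> snd e ` U"
    and "q \<in> U \<Longrightarrow> t \<in> {0..1} \<Longrightarrow> chart_inv e (t *\<^sub>R snd e q) = geo q t"
    and "q \<in> U \<Longrightarrow> velocity A (geo q) 1 e = snd e q"
proof -
  show "open (snd e ` U)" using chart_image_open_subset[OF assms(1) open_U assms(4)] .
  have *: "snd e (geo q t) = t *\<^sub>R snd e q" if "q \<in> U" "t \<in> {0..1}" for q t
    using that assms(5) geo_facts(3)[OF that(1)] ei_s_radial[OF that] by (simp add: scaleR_fun_def)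
  show "t *\<^sub>R y \<in> snd e ` U" if "y \<in> snd e ` U" "t \<in> {0..1}"
  proof -
    obtain q where q: "q \<in> U" "y = snd e q" using \<open>y \<in> snd e ` U\<close> by blast
    then show ?thesis using *[OF q(1) that(2), symmetric] geo_facts(3)[OF q(1) that(2)] by simp
  qed
  show "chart_inv e (t *\<^sub>R snd e q) = geo q t" if "q \<in> U" "t \<in> {0..1}"
    using *[OF that] chart_inv_left[OF assms(1)] geo_facts(3)[OF that] assms(4) by (metis subsetD)
  show "velocity A (geo q) 1 e = snd e q" if q: "q \<in> U"
  proof (rule velocity_coordI)
    have "((\<lambda>t. t *\<^sub>R snd e q) has_vector_derivative snd e q) (at 1 within {0..1})"
      by (auto intro!: derivative_eq_intros)
    then show "(snd e \<circ> geo q has_vector_derivative snd e q) (at 1 within {0..1})"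
      by (rule has_vector_derivative_transform[rotated 2]) (simp_all add: *[OF q])
  qed (use q assms geo_facts(5) in auto)
qed

text \<open>In the exponential chart the end velocity at \<open>q\<close> has the same coordinates
  as \<open>q\<close> itself, so the second claim concerns the derivative of \<phi> at
  \<open>y\<close> in the direction \<open>y\<close>.\<close>

lemma phi_smooth_radial:
  shows "smooth_fun A U \<phi>"
    and "q \<in> U \<Longrightarrow> differential A \<phi> q (velocity A (geo q) 1) = g q (Pv q) (velocity A (geo q) 1)"
proof -
  obtain c e where c: "c \<in> A" "p \<in> fst c" and e: "e \<in> A" "U \<subseteq> fst e" "\<forall>q\<in>U. snd e q = ei_s q c"
    and G: "smooth_on (\<lambda>y. ei (chart_inv e y) c) (snd e ` U)"
    by (rule exp_charts)
  define S where "S = snd e ` U"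
  note e3 = bspec[OF e(3)]
  note rc = radial_chart[OF e(1) c e(2,3), folded S_def]
  interpret B: bounded_bilinear "coord_g c p" by (rule coord_g_bilinear[OF c])
  \<comment> \<open>Linear in \<open>v\<close> and smooth in \<open>y\<close>: the metric at
    \<open>p\<close> paired with the coordinates of \<open>ei\<close>.\<close>
  define H where "H = (\<lambda>v y. coord_g c p (ei (chart_inv e y) c) v)"
  have H: "smooth_on (H v) S" for v
    unfolding H_def S_def
    by (rule smooth_on_bounded_linear_comp[OF B.bounded_linear_left rc(1)[unfolded S_def] G])
  have inS: "t *\<^sub>R y \<in> S" if "y \<in> S" "0 \<le> t" "t \<le> 1" for t y using rc(2) that by simp
  have cH: "continuous_on {0..1} (\<lambda>t. H v (t *\<^sub>R y))" if "y \<in> S" for v y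
    by (rule continuous_on_compose2[OF smooth_on_imp_continuous_on[OF H]])
       (use that inS in \<open>auto intro!: continuous_intros\<close>)
  have phi: "\<phi> (chart_inv e y) = integral {0..1} (\<lambda>t. H y (t *\<^sub>R y))" if y: "y \<in> S" for y
  proof -
    obtain q where q: "q \<in> U" "y = snd e q" using y S_def by blast
    have "chart_inv e y = q" using q e chart_inv_left by blast
    then have "\<phi> (chart_inv e y) = integral {0..1} (\<lambda>t. g p (ei (geo q t)) (ei_s q))"
      using phi_integral[OF q(1)] by simp
    also have "\<dots> = integral {0..1} (\<lambda>t. H y (t *\<^sub>R y))"
    proof (rule integral_cong)
      fix t :: real assume t: "t \<in> {0..1}"
      have "g p (ei (geo q t)) (ei_s q) = coord_g c p (ei (geo q t) c) (ei_s q c)"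
        by (rule g_coord_g[OF c exp_inv_tangent[OF p geo_facts(3)[OF q(1) t]] exp_inv_s_tangent[OF p q(1)]])
      then show "g p (ei (geo q t)) (ei_s q) = H y (t *\<^sub>R y)"
        using rc(3)[OF q(1) t] e3[OF q(1)] q(2) by (simp add: H_def)
    qed
    finally show ?thesis .
  qed
  have "smooth_on (\<lambda>y. \<phi> (chart_inv e y)) S"
  proof (rule smooth_on_cong)
    \<comment> \<open>The integrand depends on \<open>y\<close> also through its linear slot.
      Expanding that slot over the basis moves it outside and leaves integrands that depend on
      \<open>t *\<^sub>R y\<close> alone.\<close>
    show "smooth_on (\<lambda>y. \<Sum>b\<in>Basis. (y \<bullet> b) * integral {0..1} (\<lambda>t. H b (t *\<^sub>R y))) S"
      by (intro smooth_on_sum smooth_on_mult smooth_on_inner smooth_on_id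
          smooth_on_radial_integral[OF rc(1) inS H] rc(1))
    fix y assume y: "y \<in> S"
    have "H y z = (\<Sum>b\<in>Basis. (y \<bullet> b) * H b z)" for z
      using linear_euclidean_expansion[OF bounded_linear.linear[OF B.bounded_linear_right], of _ y]
      by (simp add: H_def)
    then have "integral {0..1} (\<lambda>t. H y (t *\<^sub>R y)) =
        integral {0..1} (\<lambda>t. \<Sum>b\<in>Basis. (y \<bullet> b) * H b (t *\<^sub>R y))" by simp
    also have "\<dots> = (\<Sum>b\<in>Basis. integral {0..1} (\<lambda>t. (y \<bullet> b) * H b (t *\<^sub>R y)))"
      by (intro integral_sum integrable_continuous_real continuous_intros cH y finite_Basis)
    also have "\<dots> = (\<Sum>b\<in>Basis. (y \<bullet> b) * integral {0..1} (\<lambda>t. H b (t *\<^sub>R y)))" by simp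
    finally show "(\<Sum>b\<in>Basis. (y \<bullet> b) * integral {0..1} (\<lambda>t. H b (t *\<^sub>R y))) = \<phi> (chart_inv e y)"
      using phi[OF y] by simp
  qed
  then show sf: "smooth_fun A U \<phi>"
    using e open_U unfolding S_def by (intro smooth_fun_local) blast
  assume q: "q \<in> U"
  define y where "y = snd e q"
  have y: "y \<in> S" using q by (simp add: S_def y_def)
  define D where "D = frechet_derivative (\<lambda>z. \<phi> (chart_inv e z)) (at y)"
  have D: "((\<lambda>z. \<phi> (chart_inv e z)) has_derivative D) (at y)"
    unfolding D_def y_def using smooth_fun_has_derivative[OF sf open_U q e(1)] e(2) q by blast
  \<comment> \<open>Substituting \<open>s * t\<close> for the variable absorbs the factor
    \<open>s\<close> of the linear slot, so \<phi> along the ray becomes an integral with variable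
    upper end.\<close>
  have radial: "\<phi> (chart_inv e (s *\<^sub>R y)) = integral {0..s} (\<lambda>t. H y (t *\<^sub>R y))"
    if s: "s \<in> {0..1}" for s
  proof -
    have *: "((\<lambda>t. s *\<^sub>R H y ((s * t) *\<^sub>R y)) has_integral
        (integral {s * 0..s * 1} (\<lambda>t. H y (t *\<^sub>R y)))) {0..1}"
      using s
      by (intro has_integral_substitution[where c = 0 and d = 1] cH y)
         (auto intro!: derivative_eq_intros simp: mult_le_one simp flip: has_real_derivative_iff_has_vector_derivative)
    have "integral {0..s} (\<lambda>t. H y (t *\<^sub>R y)) = integral {0..1} (\<lambda>t. s *\<^sub>R H y ((s * t) *\<^sub>R y))"
      using integral_unique[OF *] by simp
    also have "(\<lambda>t. s *\<^sub>R H y ((s * t) *\<^sub>R y)) = (\<lambda>t. H (s *\<^sub>R y) (t *\<^sub>R (s *\<^sub>R y)))"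
      by (simp add: H_def B.scaleR_right mult.commute)
    also have "integral {0..1} \<dots> = \<phi> (chart_inv e (s *\<^sub>R y))"
      using phi[of "s *\<^sub>R y"] inS[OF y] s by simp
    finally show ?thesis by simp
  qed
  have "((\<lambda>s. integral {0..s} (\<lambda>t. H y (t *\<^sub>R y))) has_vector_derivative H y (1 *\<^sub>R y)) (at 1 within {0..1})"
    by (rule integral_has_vector_derivative[OF cH[OF y]]) simp
  then have 1: "((\<lambda>s. \<phi> (chart_inv e (s *\<^sub>R y))) has_vector_derivative H y y) (at 1 within {0..1})"
    by (intro has_vector_derivative_transform[OF _ radial]) auto
  have "((\<lambda>s. \<phi> (chart_inv e (s *\<^sub>R y))) has_derivative (\<lambda>r. D (r *\<^sub>R y))) (at 1 within {0..1})"
    by (rule has_derivative_compose[of "\<lambda>s. s *\<^sub>R y" _ _ _ "\<lambda>z. \<phi> (chart_inv e z)"])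
       (auto intro!: derivative_eq_intros simp: D)
  then have 2: "((\<lambda>s. \<phi> (chart_inv e (s *\<^sub>R y))) has_vector_derivative D y) (at 1 within {0..1})"
    using linear_cmul[OF has_derivative_linear[OF D]] by (simp add: has_vector_derivative_def)
  \<comment> \<open>The same one-sided derivative at 1, once by the fundamental theorem of calculus
    and once by the chain rule.\<close>
  have "D y = H y y"
    using vector_derivative_within_closed_interval[OF zero_less_one _ 1]
      vector_derivative_within_closed_interval[OF zero_less_one _ 2] by simp
  also have "\<dots> = coord_g c p (ei q c) y"
    using chart_inv_left[OF e(1)] e(2) q by (simp add: H_def y_def subset_iff)
  also have "\<dots> = g p (ei q) (ei_s q)"
    using g_coord_g[OF c exp_inv_tangent[OF p q] exp_inv_s_tangent[OF p q]] e3[OF q]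
    by (simp add: y_def)
  also have "\<dots> = g q (Pv q) (velocity A (geo q) 1)" using Pi_vec_pairing(2)[OF q] by simp
  finally show "differential A \<phi> q (velocity A (geo q) 1) = g q (Pv q) (velocity A (geo q) 1)"
    using differential_chart[OF sf open_U q e(1)] e(2) q rc(4)[OF q]
      velocity_tangent[OF geo_facts(1)[OF q], of 1] geo_facts(5)[OF q]
    by (simp add: D_def y_def subset_iff)
qed

text \<open>End velocities give just one direction at each point, but the hypothesis holds at all
  points of \<open>U\<close>: integrated along rays, it fixes the difference of the functions, and
  with it every direction of the differential.\<close>

lemma differential_determined_radially:
  assumes \<psi>: "smooth_fun A U \<psi>" and \<eta>: "smooth_fun A U \<eta>"
    and eq: "\<And>q. q \<in> U \<Longrightarrow>
      differential A \<psi> q (velocity A (geo q) 1) = differential A \<eta> q (velocity A (geo q) 1)"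
    and q: "q \<in> U" and w: "w \<in> tangent_space A q"
  shows "differential A \<psi> q w = differential A \<eta> q w"
proof -
  obtain c e where c: "c \<in> A" "p \<in> fst c" and e: "e \<in> A" "U \<subseteq> fst e" "\<forall>q\<in>U. snd e q = ei_s q c"
    by (rule exp_charts) blast
  define S where "S = snd e ` U"
  note e3 = bspec[OF e(3)]
  note rc = radial_chart[OF e(1) c e(2,3), folded S_def]
  define f where "f = (\<lambda>y. \<psi> (chart_inv e y))"
  define h where "h = (\<lambda>y. \<eta> (chart_inv e y))"
  have df: "(f has_derivative frechet_derivative f (at y)) (at y)" if "y \<in> S" for y
    unfolding f_def using that smooth_fun_has_derivative[OF \<psi> open_U _ e(1)] e(2) by (auto simp: S_def)
  have dh: "(h has_derivative frechet_derivative h (at y)) (at y)" if "y \<in> S" for y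
    unfolding h_def using that smooth_fun_has_derivative[OF \<eta> open_U _ e(1)] e(2) by (auto simp: S_def)
  have rad: "frechet_derivative f (at y) y = frechet_derivative h (at y) y" if "y \<in> S" for y
  proof -
    obtain x where x: "x \<in> U" "y = snd e x" using \<open>y \<in> S\<close> S_def by blast
    have "velocity A (geo x) 1 \<in> tangent_space A x"
      using velocity_tangent[OF geo_facts(1)[OF x(1)], of 1] geo_facts(5)[OF x(1)] by simp
    then show ?thesis
      using eq[OF x(1)] differential_chart[OF \<psi> open_U x(1) e(1)] differential_chart[OF \<eta> open_U x(1) e(1)]
        e(2) x rc(4)[OF x(1)] by (simp add: f_def h_def subset_iff)
  qed
  \<comment> \<open>All rays share the origin, the coordinate of \<open>p\<close>, so the constant
    is the same for every ray.\<close>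
  have const: "f y - h y = f 0 - h 0" if y: "y \<in> S" for y
  proof -
    let ?k = "\<lambda>s. f (s *\<^sub>R y) - h (s *\<^sub>R y)"
    have dk: "(?k has_derivative
        (\<lambda>r. frechet_derivative f (at (s *\<^sub>R y)) (r *\<^sub>R y) - frechet_derivative h (at (s *\<^sub>R y)) (r *\<^sub>R y))) (at s)"
      if "s \<in> {0..1}" for s
      using df[OF rc(2)[OF y that]] dh[OF rc(2)[OF y that]]
      by (intro has_derivative_diff has_derivative_compose[of "\<lambda>s. s *\<^sub>R y" _ s UNIV f]
          has_derivative_compose[of "\<lambda>s. s *\<^sub>R y" _ s UNIV h]) (auto intro!: derivative_eq_intros)
    have "?k 1 = ?k 0"
    proof (rule DERIV_isconst_end[of 0 1 ?k])
      show "continuous_on {0..1} ?k"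
        using dk has_derivative_continuous by (blast intro: continuous_at_imp_continuous_on)
      show "(?k has_real_derivative 0) (at s)" if s: "0 < s" "s < 1" for s
      proof -
        have sy: "s *\<^sub>R y \<in> S" using rc(2)[OF y] s by simp
        have lin: "linear (frechet_derivative f (at (s *\<^sub>R y)))" "linear (frechet_derivative h (at (s *\<^sub>R y)))"
          using df[OF sy] dh[OF sy] has_derivative_linear by blast+
        \<comment> \<open>The hypothesis at \<open>s *\<^sub>R y\<close> concerns the direction
          \<open>s *\<^sub>R y\<close>; dividing by the positive \<open>s\<close> gives the
          direction \<open>y\<close> of the ray.\<close>
        have "s * frechet_derivative f (at (s *\<^sub>R y)) y = s * frechet_derivative h (at (s *\<^sub>R y)) y"
          using rad[OF sy] by (simp add: linear_cmul lin)
        then have "frechet_derivative f (at (s *\<^sub>R y)) y = frechet_derivative h (at (s *\<^sub>R y)) y"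
          using s by simp
        then have "(\<lambda>r. frechet_derivative f (at (s *\<^sub>R y)) (r *\<^sub>R y) -
            frechet_derivative h (at (s *\<^sub>R y)) (r *\<^sub>R y)) = (\<lambda>_. 0)"
          by (simp add: linear_cmul lin)
        then show ?thesis using dk[of s] s unfolding has_field_derivative_def lambda_zero[symmetric] by simp
      qed
    qed simp
    then show ?thesis by simp
  qed
  define y where "y = snd e q"
  have y: "y \<in> S" using q by (simp add: S_def y_def)
  have "((\<lambda>z. h z + (f 0 - h 0)) has_derivative frechet_derivative h (at y)) (at y)"
    using has_derivative_add[OF dh[OF y] has_derivative_const, of "f 0 - h 0"] by simp
  then have "(f has_derivative frechet_derivative h (at y)) (at y)"
    by (rule has_derivative_transform_within_open[OF _ rc(1) y]) (use const in \<open>simp add: algebra_simps\<close>)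
  then have "frechet_derivative f (at y) = frechet_derivative h (at y)"
    using frechet_derivative_at by metis
  then show ?thesis
    using differential_chart[OF \<psi> open_U q e(1) _ w] differential_chart[OF \<eta> open_U q e(1) _ w] e(2) q
    by (auto simp: f_def h_def y_def)
qed

text \<open>\<open>grad\<close> is a definite description that \<open>grad_exists_unique\<close>
  justifies for smooth functions; therefore smoothness of \<phi> is part of the claim.\<close>

lemma decomposition:
  "smooth_fun A U \<phi> \<and>
     (\<exists>V. (\<forall>q\<in>U. V q \<in> tangent_space A q \<and> Pv q = grad A g \<phi> q + V q \<and>
             g q (V q) (velocity A (geo q) 1) = 0) \<and>
          (\<forall>\<psi> W. smooth_fun A U \<psi> \<and>
             (\<forall>q\<in>U. W q \<in> tangent_space A q \<and> Pv q = grad A g \<psi> q + W q \<and>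
                g q (W q) (velocity A (geo q) 1) = 0) \<longrightarrow>
             (\<forall>q\<in>U. grad A g \<psi> q = grad A g \<phi> q \<and> W q = V q)))"
\<comment> \<open>The decomposition forces this remainder; its orthogonality is the radial
  derivative formula of \<open>phi_smooth_radial\<close>.\<close>
proof (intro conjI exI[of _ "\<lambda>q. Pv q - grad A g \<phi> q"] ballI allI impI)
  show sf: "smooth_fun A U \<phi>" by (rule phi_smooth_radial(1))
  have vel: "velocity A (geo q) 1 \<in> tangent_space A q" if "q \<in> U" for q
    using velocity_tangent[OF geo_facts(1)[OF that], of 1] geo_facts(5)[OF that] by simp
  fix q assume q: "q \<in> U"
  note gT = grad_tangent[OF sf open_U q]
  show "Pv q - grad A g \<phi> q \<in> tangent_space A q"
    by (intro tangent_diff Pi_vec_pairing(1) q gT)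
  show "Pv q = grad A g \<phi> q + (Pv q - grad A g \<phi> q)" by simp
  show "g q (Pv q - grad A g \<phi> q) (velocity A (geo q) 1) = 0"
    using phi_smooth_radial(2)[OF q] g_grad[OF sf open_U q vel[OF q]]
    by (simp add: g_diff_left Pi_vec_pairing(1)[OF q] gT vel[OF q])
next
  have sf: "smooth_fun A U \<phi>" by (rule phi_smooth_radial(1))
  have vel: "velocity A (geo q) 1 \<in> tangent_space A q" if "q \<in> U" for q
    using velocity_tangent[OF geo_facts(1)[OF that], of 1] geo_facts(5)[OF that] by simp
  fix \<psi> W q
  assume a: "smooth_fun A U \<psi> \<and> (\<forall>q\<in>U. W q \<in> tangent_space A q \<and> Pv q = grad A g \<psi> q + W q \<and>
      g q (W q) (velocity A (geo q) 1) = 0)" and q: "q \<in> U"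
  have s\<psi>: "smooth_fun A U \<psi>" using a by simp
  \<comment> \<open>Pairing the decomposition with the end velocity eliminates \<open>W\<close>, so
    both functions have the same radial derivatives.\<close>
  have "differential A \<psi> x (velocity A (geo x) 1) = differential A \<phi> x (velocity A (geo x) 1)"
    if x: "x \<in> U" for x
  proof -
    have W: "W x \<in> tangent_space A x" "Pv x = grad A g \<psi> x + W x" "g x (W x) (velocity A (geo x) 1) = 0"
      using a x by blast+
    have "g x (Pv x) (velocity A (geo x) 1) = g x (grad A g \<psi> x) (velocity A (geo x) 1)"
      unfolding W(2) using g_add_left[OF grad_tangent[OF s\<psi> open_U x] W(1) vel[OF x]] W(3) by simp
    then show ?thesis
      using phi_smooth_radial(2)[OF x] g_grad[OF s\<psi> open_U x vel[OF x]] by simp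
  qed
  then show "grad A g \<psi> q = grad A g \<phi> q"
    by (intro grad_cong differential_determined_radially[OF s\<psi> sf _ q])
  then show "W q = Pv q - grad A g \<phi> q" using a q by (metis add_diff_cancel_left')
qed

end

section \<open>Exchange of the two connections and conclusion\<close>

lemma dually_convex_pointedI:
  assumes "statistical_manifold A g nabla nabla_s" "dually_convex A nabla nabla_s U" "p \<in> U"
  shows "dually_convex_pointed A g nabla nabla_s U p"
  using assms unfolding statistical_manifold_def
  by unfold_locales auto

text \<open>Symmetry of the metric lets the duality identity be used with \<open>Y\<close> and
  \<open>Z\<close> exchanged.\<close>

lemma statistical_manifold_dual:
  assumes "statistical_manifold A g nabla nabla_s" shows "statistical_manifold A g nabla_s nabla"
proof -
  have dual: "dual_connections A g nabla nabla_s" and metric: "riemannian_metric A g"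
    using assms by (simp_all add: statistical_manifold_def)
  have g_commute: "g x u v = g x v u" if "u \<in> tangent_space A x" "v \<in> tangent_space A x" for x u v
    using metric that unfolding riemannian_metric_def by meson
  have "dual_connections A g nabla_s nabla"
    unfolding dual_connections_def
  proof (intro ballI allI)
    fix X Y Z x assume XYZ: "X \<in> vector_fields A" "Y \<in> vector_fields A" "Z \<in> vector_fields A"
    have T: "F y \<in> tangent_space A y" if "F \<in> vector_fields A" for F y
      using that by (simp add: vector_fields_def)
    have nf: "nabla X Z \<in> vector_fields A" "nabla_s X Y \<in> vector_fields A"
      using assms XYZ by (auto simp: statistical_manifold_def affine_connection_def)
    have "(\<lambda>y. g y (Y y) (Z y)) = (\<lambda>y. g y (Z y) (Y y))"
      using g_commute T XYZ by blast
    then have "differential A (\<lambda>y. g y (Y y) (Z y)) x (X x) =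
        g x (nabla X Z x) (Y x) + g x (Z x) (nabla_s X Y x)"
      using dual XYZ by (simp add: dual_connections_def)
    also have "\<dots> = g x (nabla_s X Y x) (Z x) + g x (Y x) (nabla X Z x)"
      using g_commute[OF T[OF nf(1)] T[OF XYZ(2)]] g_commute[OF T[OF XYZ(3)] T[OF nf(2)]] by simp
    finally show "differential A (\<lambda>y. g y (Y y) (Z y)) x (X x) =
        g x (nabla_s X Y x) (Z x) + g x (Y x) (nabla X Z x)" .
  qed
  then show ?thesis using assms by (simp add: statistical_manifold_def)
qed

lemma dually_convex_dual: "dually_convex A nabla nabla_s U \<Longrightarrow> dually_convex A nabla_s nabla U"
  unfolding dually_convex_def by blast

theorem mainTheorem4:
  fixes A :: "('a::{t2_space, second_countable_topology}, 'e::euclidean_space) chart set"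
    and g :: "'a \<Rightarrow> ('a, 'e) tvec \<Rightarrow> ('a, 'e) tvec \<Rightarrow> real"
    and nabla nabla_s :: "('a, 'e) connection"
    and U :: "'a set"
  assumes "statistical_manifold A g nabla nabla_s"
    and "dually_convex A nabla nabla_s U"
  shows
    "(\<forall>p\<in>U. smooth_fun A U (phi_fun A g nabla nabla_s U p) \<and>
       (\<exists>V. (\<forall>q\<in>U. V q \<in> tangent_space A q \<and>
               Pi_vec A nabla nabla_s U p q = grad A g (phi_fun A g nabla nabla_s U p) q + V q \<and>
               g q (V q) (velocity A (geodesic_between A nabla_s U p q) 1) = 0) \<and>
            (\<forall>\<psi> W. smooth_fun A U \<psi> \<and>
               (\<forall>q\<in>U. W q \<in> tangent_space A q \<and>
                  Pi_vec A nabla nabla_s U p q = grad A g \<psi> q + W q \<and>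
                  g q (W q) (velocity A (geodesic_between A nabla_s U p q) 1) = 0) \<longrightarrow>
               (\<forall>q\<in>U. grad A g \<psi> q = grad A g (phi_fun A g nabla nabla_s U p) q \<and> W q = V q)))) \<and>
     (\<forall>p\<in>U. smooth_fun A U (phi_fun A g nabla_s nabla U p) \<and>
       (\<exists>V. (\<forall>q\<in>U. V q \<in> tangent_space A q \<and>
               Pi_vec A nabla_s nabla U p q = grad A g (phi_fun A g nabla_s nabla U p) q + V q \<and>
               g q (V q) (velocity A (geodesic_between A nabla U p q) 1) = 0) \<and>
            (\<forall>\<psi> W. smooth_fun A U \<psi> \<and>
               (\<forall>q\<in>U. W q \<in> tangent_space A q \<and>
                  Pi_vec A nabla_s nabla U p q = grad A g \<psi> q + W q \<and>
                  g q (W q) (velocity A (geodesic_between A nabla U p q) 1) = 0) \<longrightarrow>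
               (\<forall>q\<in>U. grad A g \<psi> q = grad A g (phi_fun A g nabla_s nabla U p) q \<and> W q = V q))))"
  \<comment> \<open>The second instance has the connections exchanged and yields the dual
    conjunct.\<close>
  using dually_convex_pointed.decomposition[OF dually_convex_pointedI[OF assms]]
    dually_convex_pointed.decomposition[OF dually_convex_pointedI[OF
      statistical_manifold_dual[OF assms(1)] dually_convex_dual[OF assms(2)]]]
  by (intro conjI ballI) blast+

end
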